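(* Let $\mathbf A\in\mathbb R^{n\times d}$ and $\mathbf b\in\mathbb R^n$, and let $\tau_1,\dots,\tau_n$ be the leverage scores of $\mathbf A$. Fix $D\ge 1$. There is a constant $C>0$ depending only on $D$ such that the following holds for every $\epsilon\in(0,1)$. Let $\boldsymbol\xi=(\xi_1,\dots,\xi_n)\in\{0,1\}^n$ be a random vector whose distribution $\mu$ (i) is $k$-homogeneous, (ii) is one-sided $\ell_\infty$-independent with parameter $D$, and (iii) has marginals $\Pr[\xi_i=1]=\tilde p_i:=\min(1,c\,\tau_i)$ for all $i$, for some constant $c>0$. Let $\tilde{\mathbf A}$, $\tilde{\mathbf b}$ be the reweighted subsampled data and target determined by $\boldsymbol\xi$, and let $\tilde{\mathbf x}^*\in\arg\min_{\mathbf x\in\mathbb R^d}\|\tilde{\mathbf A}\mathbf x-\tilde{\mathbf b}\|_2^2$. If $k\ge C\,(d\log d+d/\epsilon)$, then with probability at least $99/100$, $$\|\mathbf A\tilde{\mathbf x}^*-\mathbf b\|_2^2\le(1+\epsilon)\min_{\mathbf x\in\mathbb R^d}\|\mathbf A\mathbf x-\mathbf b\|_2^2 .$$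
   Context: Leverage scores: let $\mathbf U$ be a matrix whose columns form an orthonormal basis of the column span of $\mathbf A$, with rows $\mathbf u_i$; the $i$-th leverage score is $\tau_i=\|\mathbf u_i\|_2^2=\mathbf a_i^T(\mathbf A^T\mathbf A)^{+}\mathbf a_i$, where $\mathbf a_i$ is the $i$-th row of $\mathbf A$; $\sum_i\tau_i=\mathrm{rank}(\mathbf A)\le d$. Homogeneity: a distribution on $\{0,1\}^n$ is $k$-homogeneous if every realization has exactly $k$ ones. One-sided $\ell_\infty$-independence: for $\mathcal S\subseteq[n]$ and $i,j\in[n]\setminus\mathcal S$ (with the conditioning events of positive probability) set $\mathcal I^{\mathcal S}_\mu(i,j)=\Pr[\xi_j=1\mid \xi_i=1,\ \xi_\ell=1\ \forall\ell\in\mathcal S]-\Pr[\xi_j=1\mid \xi_\ell=1\ \forall\ell\in\mathcal S]$; $\mu$ is one-sided $\ell_\infty$-independent with parameter $D$ if $\max_i\sum_j|\mathcal I^{\mathcal S}_\mu(i,j)|\le D$ for all $\mathcal S\subseteq[n]$. Reweighted subsample: $\tilde{\mathbf A}$ has one row $\mathbf a_i/\sqrt{\tilde p_i}$ for each $i$ with $\xi_i=1$, and $\tilde{\mathbf b}$ has the corresponding entries $b_i/\sqrt{\tilde p_i}$ (equivalently $\tilde{\mathbf A}=\mathbf S\mathbf A$, $\tilde{\mathbf b}=\mathbf S\mathbf b$ where $\mathbf S\in\mathbb R^{k\times n}$ has one row per selected $i$, equal to $1/\sqrt{\tilde p_i}$ in column $i$ and $0$ elsewhere). *)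

theory Defs
  imports "Jordan_Normal_Form.Matrix" "HOL-Probability.Probability"
begin

definition sqnorm :: "real Matrix.vec \<Rightarrow> real" where
  "sqnorm v = (\<Sum>i<dim_vec v. (v $ i)^2)"

definition colspan :: "real mat \<Rightarrow> real Matrix.vec set" where
  "colspan A = {Matrix.mult_mat_vec A x | x. x \<in> carrier_vec (dim_col A)}"

definition orthonormal_colspan_basis :: "real mat \<Rightarrow> real mat \<Rightarrow> bool" where
  "orthonormal_colspan_basis A U \<longleftrightarrow>
     dim_row U = dim_row A \<and> transpose_mat U * U = 1\<^sub>m (dim_col U) \<and> colspan U = colspan A"

definition leverage_score :: "real mat \<Rightarrow> nat \<Rightarrow> real" where
  "leverage_score A i = sqnorm (Matrix.row (SOME U. orthonormal_colspan_basis A U) i)"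

definition sampling_mat :: "nat \<Rightarrow> (nat \<Rightarrow> real) \<Rightarrow> nat set \<Rightarrow> real mat" where
  "sampling_mat n p T =
     (let s = sorted_list_of_set T in
      Matrix.mat (card T) n (\<lambda>(r, i). if i = s ! r then 1 / sqrt (p i) else 0))"

definition cond_prob :: "nat set pmf \<Rightarrow> nat \<Rightarrow> nat set \<Rightarrow> real" where
  "cond_prob \<mu> j T = measure_pmf.prob \<mu> {X. insert j T \<subseteq> X} / measure_pmf.prob \<mu> {X. T \<subseteq> X}"

(* distribution on {0,1}^n, realizations identified with subsets of {..<n} *)
definition k_homogeneous :: "nat \<Rightarrow> nat \<Rightarrow> nat set pmf \<Rightarrow> bool" where
  "k_homogeneous n k \<mu> \<longleftrightarrow> (\<forall>X \<in> set_pmf \<mu>. X \<subseteq> {..<n} \<and> card X = k)"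

definition one_sided_linf_independent :: "nat \<Rightarrow> nat set pmf \<Rightarrow> real \<Rightarrow> bool" where
  "one_sided_linf_independent n \<mu> D \<longleftrightarrow>
     (\<forall>S \<subseteq> {..<n}. \<forall>i \<in> {..<n} - S.
        measure_pmf.prob \<mu> {X. insert i S \<subseteq> X} > 0 \<longrightarrow>
        (\<Sum>j \<in> {..<n} - S. \<bar>cond_prob \<mu> j (insert i S) - cond_prob \<mu> j S\<bar>) \<le> D)"

end

theory Submission
  imports Defs
begin

text \<open>Write \<open>u\<^sub>i\<close> for the rows of an orthonormal basis matrix, \<open>Y\<^sub>i = u\<^sub>i u\<^sub>i\<^sup>T / p\<^sub>i\<close>, and reveal the
  sampled indices one at a time in uniformly random order, starting from those with \<open>p\<^sub>i = 1\<close>.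
  With \<open>\<pi>\<^sub>j = Pr[\<xi>\<^sub>j = 1 | S]\<close> for the revealed set \<open>S\<close>, the potential
  \<open>tr (I + \<Sum>\<^bsub>j\<in>S\<^esub> Y\<^sub>j + (1 - \<alpha>) \<Sum>\<^bsub>j\<notin>S\<^esub> \<pi>\<^sub>j Y\<^sub>j)\<^bsup>-q\<^esup>\<close>, where \<open>q\<close> is a power of two of order
  \<open>log d\<close>, is a supermartingale: one-sided independence bounds each increment by
  \<open>(D + 1) / c\<close> and its second moment by a multiple of the drift created by the damping
  \<open>1 - \<alpha>\<close>. The only noncommutative ingredient is the Lieb--Thirring trace inequality
  \<open>tr (XY)\<^sup>q \<le> tr X\<^sup>q Y\<^sup>q\<close>, which for powers of two follows from Cauchy--Schwarz.
  Markov's inequality yields \<open>\<Sum>\<^bsub>i sampled\<^esub> Y\<^sub>i \<ge> I / 2\<close>. A covariance bound controls the sampled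
  cross term between \<open>u\<close> and the optimal residual, and on the intersection of the two events
  the minimizer of the sketched problem is nearly optimal.\<close>

section \<open>Trace inequalities in an algebra with involution\<close>

text \<open>The revealing order starts from p_i = 1 because the increment bound needs every
  unrevealed Y_i to satisfy Y^2 = Y / c. This is exact when p_i = c \<tau>_i, whereas an index with
  p_i = 1 can have leverage score above 1 / c. Such indices are sampled almost surely, so revealing
  them changes no probability.

  Homogeneity and independence meet in one step. Reveal i next with probability \<pi>_i / m, where m
  indices are still missing. The expected change of \<pi>_l is then a multiple of the covariance of
  \<xi>_l with a constant sum, hence zero. The second moment needs sums over i for fixed l, while
  independence bounds sums over l for fixed i; the weights \<pi>_i turn influences into covariances,
  which are symmetric.

  The summand I makes the inverse a contraction, so conjugation never enlarges a perturbation. The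
  price is that 1 + 9/10 at the start is compared with 1 + 1/2 on failure, which gives the rate
  15/19 per unit of q.

  No spectral theorem enters: positivity is carried by explicit factorizations updated by rank-one
  terms, and operator norms by left multiplication.\<close>

locale trace_algebra =
  fixes tr :: "'a::real_algebra_1 \<Rightarrow> real" and adj :: "'a \<Rightarrow> 'a"
  assumes tr_add: "tr (x + y) = tr x + tr y"
    and tr_scale: "tr (a *\<^sub>R x) = a * tr x"
    and tr_comm: "tr (x * y) = tr (y * x)"
    and adj_add: "adj (x + y) = adj x + adj y"
    and adj_scale: "adj (a *\<^sub>R x) = a *\<^sub>R adj x"
    and adj_mult: "adj (x * y) = adj y * adj x"
    and adj_adj: "adj (adj x) = x"
    and tr_adj: "tr (adj x) = tr x"
    and tr_pos: "0 \<le> tr (adj x * x)"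
begin

lemma tr_zero: "tr 0 = 0"
  using tr_scale[of 0 0] by simp

lemma tr_minus: "tr (- x) = - tr x"
  using tr_add[of x "- x"] by (simp add: tr_zero)

lemma tr_diff: "tr (x - y) = tr x - tr y"
  using tr_add[of x "- y"] by (simp add: tr_minus)

lemma tr_sum: "tr (\<Sum>i\<in>I. f i) = (\<Sum>i\<in>I. tr (f i))"
  by (induction I rule: infinite_finite_induct) (auto simp: tr_zero tr_add)

lemma adj_zero: "adj 0 = 0"
  using adj_scale[of 0 0] by simp

lemma adj_minus: "adj (- x) = - adj x"
  using adj_scale[of "-1" x] by simp

lemma adj_diff: "adj (x - y) = adj x - adj y"
  using adj_add[of x "- y"] by (simp add: adj_minus)

lemma adj_sum: "adj (\<Sum>i\<in>I. f i) = (\<Sum>i\<in>I. adj (f i))"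
  by (induction I rule: infinite_finite_induct) (auto simp: adj_zero adj_add)

lemma adj_one: "adj 1 = 1"
  using adj_mult[of "adj 1" 1] by (simp add: adj_adj)

lemma adj_power: "adj (x ^ n) = adj x ^ n"
  by (induction n) (simp_all add: adj_one adj_mult power_commutes)

lemmas adj_simps = adj_add adj_diff adj_minus adj_zero adj_one adj_scale adj_mult adj_adj adj_power adj_sum
lemmas tr_simps = tr_add tr_diff tr_minus tr_zero tr_scale tr_sum

text \<open>The squared Hilbert-Schmidt length. It comes from a seminorm only: in the matrix
  instance the trace sees a single size, so nonzero families can have \<open>nsq\<close>
  zero.\<close>

definition nsq :: "'a \<Rightarrow> real" where "nsq x = tr (adj x * x)"

lemma nsq_nonneg: "0 \<le> nsq x"
  by (simp add: nsq_def tr_pos)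

lemma nsq_adj: "nsq (adj x) = nsq x"
  by (simp add: nsq_def adj_adj tr_comm)

lemma nsq_scale: "nsq (a *\<^sub>R x) = a\<^sup>2 * nsq x"
  by (simp add: nsq_def adj_simps tr_simps power2_eq_square)

lemma tr_adj_mult_comm: "tr (adj x * y) = tr (adj y * x)"
  by (metis adj_adj adj_mult tr_adj)

lemma tr_assoc3: "tr (x * y * z) = tr (y * z * x)"
  by (metis mult.assoc tr_comm)

lemma nsq_add: "nsq (x + y) = nsq x + 2 * tr (adj x * y) + nsq y"
  using tr_adj_mult_comm[of x y] by (simp add: nsq_def adj_simps algebra_simps tr_simps)

lemma Cauchy_Schwarz_tr: "(tr (adj x * y))\<^sup>2 \<le> nsq x * nsq y"
proof -
  have quad: "0 \<le> a\<^sup>2 * nsq x + 2 * a * tr (adj x * y) + nsq y" for a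
    using nsq_nonneg[of "a *\<^sub>R x + y"] by (simp add: nsq_add nsq_scale adj_simps tr_simps)
  show ?thesis
  proof (cases "nsq x = 0")
    case True
    have "tr (adj x * y) = 0"
    proof (rule ccontr)
      assume neq: "tr (adj x * y) \<noteq> 0"
      \<comment> \<open>With \<open>nsq x\<close> zero the quadratic is affine in its parameter; the
        value chosen here makes it equal to -1.\<close>
      show False
        using quad[of "- (nsq y + 1) / (2 * tr (adj x * y))"] neq True by (simp add: field_simps)
    qed
    then show ?thesis using True by simp
  next
    case False
    then have pos: "nsq x > 0" using nsq_nonneg[of x] by simp
    have "0 \<le> nsq x * ((- tr (adj x * y) / nsq x)\<^sup>2 * nsq x + 2 * (- tr (adj x * y) / nsq x) * tr (adj x * y) + nsq y)"
      using quad[of "- tr (adj x * y) / nsq x"] pos by (intro mult_nonneg_nonneg) linarith+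
    also have "\<dots> = nsq x * nsq y - (tr (adj x * y))\<^sup>2"
      using pos by (simp add: field_simps power2_eq_square)
    finally show ?thesis by simp
  qed
qed

lemma Cauchy_Schwarz_tr_abs: "\<bar>tr (adj x * y)\<bar> \<le> sqrt (nsq x) * sqrt (nsq y)"
  using Cauchy_Schwarz_tr[of x y]
  by (metis real_sqrt_abs real_sqrt_le_mono real_sqrt_mult)

text \<open>Cauchy-Schwarz with one factor of the length of \<open>x\<close> cancelled. It converts
  information on quadratic forms into operator bounds.\<close>

lemma nsq_cancel:
  assumes "nsq x \<le> a * tr (adj x * y)" "0 \<le> a"
  shows "nsq x \<le> a\<^sup>2 * nsq y"
proof (cases "nsq x = 0")
  case True
  then show ?thesis by (simp add: nsq_nonneg)
next
  case False
  then have pos: "nsq x > 0" using nsq_nonneg[of x] by simp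
  have "nsq x * nsq x \<le> (a * tr (adj x * y)) * (a * tr (adj x * y))"
    using assms nsq_nonneg[of x] by (intro mult_mono) auto
  also have "\<dots> = a\<^sup>2 * (tr (adj x * y))\<^sup>2" by (simp add: power2_eq_square)
  also have "\<dots> \<le> a\<^sup>2 * (nsq x * nsq y)" by (intro mult_left_mono Cauchy_Schwarz_tr) auto
  also have "\<dots> = nsq x * (a\<^sup>2 * nsq y)" by simp
  finally show ?thesis using pos by simp
qed

lemma nsq_triangle: "sqrt (nsq (x + y)) \<le> sqrt (nsq x) + sqrt (nsq y)"
proof (rule real_le_lsqrt)
  have "nsq (x + y) \<le> nsq x + 2 * (sqrt (nsq x) * sqrt (nsq y)) + nsq y"
    using Cauchy_Schwarz_tr_abs[of x y] by (simp add: nsq_add)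
  also have "\<dots> = (sqrt (nsq x) + sqrt (nsq y))\<^sup>2"
    by (simp add: power2_sum nsq_nonneg)
  finally show "nsq (x + y) \<le> (sqrt (nsq x) + sqrt (nsq y))\<^sup>2" .
qed (use nsq_nonneg in auto)

section \<open>Cyclic powers and the Lieb-Thirring inequality\<close>

lemma power_pair_shift: "(x * y) ^ n * x = x * (y * x) ^ n" for x y :: 'a
  by (induction n) (simp_all add: mult.assoc power_commutes)

lemma tr_power_comm: "tr ((x * y) ^ n) = tr ((y * x) ^ n)"
proof (cases n)
  case (Suc m)
  have "tr ((x * y) ^ n) = tr ((x * y) ^ m * x * y)"
    by (simp add: Suc power_commutes mult.assoc flip: power_Suc2)
  also have "\<dots> = tr (x * (y * x) ^ m * y)" by (simp add: power_pair_shift)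
  also have "\<dots> = tr ((y * x) ^ m * (y * x))" by (metis mult.assoc tr_comm)
  finally show ?thesis by (simp add: Suc power_commutes)
qed simp

lemma tr_sandwich_square:
  assumes "adj x = x" "adj y = y"
  shows "tr (x ^ n * y ^ n) \<le> sqrt (tr (x ^ (2 * n)) * tr (y ^ (2 * n)))"
  using Cauchy_Schwarz_tr_abs[of "x ^ n" "y ^ n"] assms
  by (simp add: nsq_def adj_power real_sqrt_mult mult_2 power_add)

text \<open>The two claims need each other. The next trace bound applies the old one to
  \<open>z ^ 2\<close>, regroups cyclically into a product of the self-adjoint elements
  \<open>adj z * z\<close> and \<open>z * adj z\<close>, and separates them by the old product bound
  and Cauchy-Schwarz. The next product bound applies the old trace bound to \<open>x * y\<close> and
  the old product bound to the squares of \<open>x\<close> and \<open>y\<close>.\<close>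

lemma trace_power_inequalities:
  "(\<forall>z. \<bar>tr (z ^ (2 ^ Suc j))\<bar> \<le> tr ((adj z * z) ^ (2 ^ j))) \<and>
   (\<forall>x y. adj x = x \<longrightarrow> adj y = y \<longrightarrow> tr ((x * y) ^ (2 ^ j)) \<le> tr (x ^ (2 ^ j) * y ^ (2 ^ j)))"
proof (induction j)
  case 0
  have "\<bar>tr (z ^ 2)\<bar> \<le> tr (adj z * z)" for z
  proof -
    have "\<bar>tr (z ^ 2)\<bar> \<le> sqrt (nsq z) * sqrt (nsq z)"
      using Cauchy_Schwarz_tr_abs[of "adj z" z] by (simp add: nsq_adj adj_adj power2_eq_square)
    also have "\<dots> = nsq z" using nsq_nonneg[of z] by simp
    finally show ?thesis by (simp add: nsq_def)
  qed
  then show ?case by (simp add: numeral_2_eq_2)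
next
  case (Suc j)
  define p :: nat where "p = 2 ^ j"
  have T: "\<bar>tr (z ^ (2 * p))\<bar> \<le> tr ((adj z * z) ^ p)" for z
    using Suc by (simp add: p_def)
  have L: "tr ((x * y) ^ p) \<le> tr (x ^ p * y ^ p)" if "adj x = x" "adj y = y" for x y
    using Suc that by (simp add: p_def)
  have T': "\<bar>tr (z ^ (4 * p))\<bar> \<le> tr ((adj z * z) ^ (2 * p))" for z
  proof -
    have "\<bar>tr (z ^ (4 * p))\<bar> = \<bar>tr ((z ^ 2) ^ (2 * p))\<bar>" by (simp flip: power_mult)
    also have "\<dots> \<le> tr ((adj (z ^ 2) * z ^ 2) ^ p)" by (rule T)
    also have "(adj (z ^ 2) * z ^ 2) = adj z * ((adj z * z) * z)"
      by (simp add: adj_mult power2_eq_square mult.assoc)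
    also have "tr ((adj z * ((adj z * z) * z)) ^ p) = tr (((adj z * z) * (z * adj z)) ^ p)"
      by (subst tr_power_comm) (simp add: mult.assoc)
    also have "\<dots> \<le> tr ((adj z * z) ^ p * (z * adj z) ^ p)"
      by (rule L) (simp_all add: adj_simps)
    also have "\<dots> \<le> sqrt (tr ((adj z * z) ^ (2 * p)) * tr ((z * adj z) ^ (2 * p)))"
      by (rule tr_sandwich_square) (simp_all add: adj_simps)
    also have "tr ((z * adj z) ^ (2 * p)) = tr ((adj z * z) ^ (2 * p))" by (rule tr_power_comm)
    also have "sqrt (tr ((adj z * z) ^ (2 * p)) * tr ((adj z * z) ^ (2 * p))) = \<bar>tr ((adj z * z) ^ (2 * p))\<bar>"
      by (simp flip: power2_eq_square)
    also have "\<dots> = tr ((adj z * z) ^ (2 * p))"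
      using nsq_nonneg[of "(adj z * z) ^ p"] by (simp add: nsq_def adj_simps mult_2 power_add)
    finally show ?thesis .
  qed
  have L': "tr ((x * y) ^ (2 * p)) \<le> tr (x ^ (2 * p) * y ^ (2 * p))" if xy: "adj x = x" "adj y = y" for x y
  proof -
    have "tr ((x * y) ^ (2 * p)) \<le> tr ((adj (x * y) * (x * y)) ^ p)" using T[of "x * y"] by simp
    also have "adj (x * y) * (x * y) = y * (x ^ 2 * y)"
      by (simp add: adj_mult xy power2_eq_square mult.assoc)
    also have "tr ((y * (x ^ 2 * y)) ^ p) = tr ((x ^ 2 * y ^ 2) ^ p)"
      by (subst tr_power_comm) (simp add: power2_eq_square mult.assoc)
    also have "\<dots> \<le> tr ((x ^ 2) ^ p * (y ^ 2) ^ p)" by (rule L) (simp_all add: adj_power xy)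
    finally show ?thesis by (simp add: power_mult)
  qed
  show ?case using T' L' by (auto simp: p_def)
qed

lemma trace_Lieb_Thirring:
  assumes "adj x = x" "adj y = y"
  shows "tr ((x * y) ^ (2 ^ j)) \<le> tr (x ^ (2 ^ j) * y ^ (2 ^ j))"
  using trace_power_inequalities assms by blast

section \<open>Norms and operator bounds\<close>

definition nrm :: "'a \<Rightarrow> real" where "nrm x = sqrt (nsq x)"

lemma nrm_nonneg: "0 \<le> nrm x"
  by (simp add: nrm_def nsq_nonneg)

lemma nrm_square: "(nrm x)\<^sup>2 = nsq x"
  by (simp add: nrm_def nsq_nonneg)

lemma nrm_zero: "nrm 0 = 0"
  by (simp add: nrm_def nsq_def tr_zero)

lemma nrm_triangle: "nrm (x + y) \<le> nrm x + nrm y"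
  unfolding nrm_def by (rule nsq_triangle)

lemma nrm_scale: "nrm (a *\<^sub>R x) = \<bar>a\<bar> * nrm x"
  by (simp add: nrm_def nsq_scale real_sqrt_mult)

lemma nrm_minus: "nrm (- x) = nrm x"
  using nrm_scale[of "-1" x] by simp

lemma nrm_triangle_diff: "nrm x - nrm y \<le> nrm (x + y)"
  using nrm_triangle[of "x + y" "- y"] by (simp add: nrm_minus)

lemma nrm_sum: "nrm (\<Sum>i\<in>I. f i) \<le> (\<Sum>i\<in>I. nrm (f i))"
proof (induction I rule: infinite_finite_induct)
  case (insert i I)
  then show ?case using nrm_triangle[of "f i" "sum f I"] by simp
qed (simp_all add: nrm_zero)

lemma tr_le_nrm: "\<bar>tr (adj x * y)\<bar> \<le> nrm x * nrm y"
  unfolding nrm_def by (rule Cauchy_Schwarz_tr_abs)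

lemma nsq_weighted_sum_le:
  "nsq (\<Sum>j\<in>J. a j *\<^sub>R y j) \<le> (\<Sum>j\<in>J. \<bar>a j\<bar>) * (\<Sum>j\<in>J. \<bar>a j\<bar> * nsq (y j))"
proof -
  have "nrm (\<Sum>j\<in>J. a j *\<^sub>R y j) \<le> (\<Sum>j\<in>J. \<bar>a j\<bar> * nrm (y j))"
    using nrm_sum[of "\<lambda>j. a j *\<^sub>R y j" J] by (simp add: nrm_scale)
  also have "\<dots> = (\<Sum>j\<in>J. sqrt \<bar>a j\<bar> * (sqrt \<bar>a j\<bar> * nrm (y j)))"
    by (simp flip: mult.assoc)
  finally have "(nrm (\<Sum>j\<in>J. a j *\<^sub>R y j))\<^sup>2 \<le> (\<Sum>j\<in>J. sqrt \<bar>a j\<bar> * (sqrt \<bar>a j\<bar> * nrm (y j)))\<^sup>2"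
    by (intro power_mono nrm_nonneg)
  also have "\<dots> \<le> (\<Sum>j\<in>J. (sqrt \<bar>a j\<bar>)\<^sup>2) * (\<Sum>j\<in>J. (sqrt \<bar>a j\<bar> * nrm (y j))\<^sup>2)"
    by (rule Cauchy_Schwarz_ineq_sum)
  finally show ?thesis by (simp add: nrm_square power_mult_distrib)
qed

text \<open>The operator norm, read off from left multiplication on the algebra itself, so that no
  underlying vector space is needed.\<close>

definition opbound :: "real \<Rightarrow> 'a \<Rightarrow> bool" where
  "opbound a x \<longleftrightarrow> (\<forall>z. nrm (x * z) \<le> a * nrm z)"

lemma opboundD: "opbound a x \<Longrightarrow> nrm (x * z) \<le> a * nrm z"
  by (simp add: opbound_def)

lemma opbound_mult:
  assumes "opbound a x" "opbound b y" "0 \<le> a"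
  shows "opbound (a * b) (x * y)"
  unfolding opbound_def
proof
  fix z
  have "nrm (x * y * z) \<le> a * nrm (y * z)"
    using opboundD[OF assms(1), of "y * z"] by (simp add: mult.assoc)
  also have "\<dots> \<le> a * (b * nrm z)"
    using assms by (intro mult_left_mono opboundD) auto
  finally show "nrm (x * y * z) \<le> a * b * nrm z" by simp
qed

lemma opbound_add: "opbound a x \<Longrightarrow> opbound b y \<Longrightarrow> opbound (a + b) (x + y)"
  unfolding opbound_def distrib_right by (meson add_mono nrm_triangle order_trans)

lemma opbound_scale: "opbound a x \<Longrightarrow> opbound (\<bar>c\<bar> * a) (c *\<^sub>R x)"
  by (simp add: opbound_def nrm_scale mult_left_mono mult.assoc)

lemma opbound_one: "opbound 1 1"
  by (simp add: opbound_def)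

lemma opbound_sum: "(\<And>i. i \<in> I \<Longrightarrow> opbound (a i) (x i)) \<Longrightarrow> opbound (\<Sum>i\<in>I. a i) (\<Sum>i\<in>I. x i)"
  by (induction I rule: infinite_finite_induct) (auto simp: opbound_add, auto simp: opbound_def nrm_zero)

lemma opbound_mono: "opbound a x \<Longrightarrow> a \<le> b \<Longrightarrow> opbound b x"
  unfolding opbound_def by (meson mult_right_mono nrm_nonneg order_trans)

lemma opbound_power: "opbound a x \<Longrightarrow> 0 \<le> a \<Longrightarrow> opbound (a ^ n) (x ^ n)"
  by (induction n) (simp_all add: opbound_one opbound_mult)

text \<open>The squared norm of \<open>adj x * z\<close> pairs \<open>x * (adj x * z)\<close> with
  \<open>z\<close>, so the bound for \<open>x\<close> applies and one factor cancels.\<close>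

lemma opbound_adj:
  assumes "opbound a x" "0 \<le> a"
  shows "opbound a (adj x)"
  unfolding opbound_def
proof
  fix z
  define y where "y = adj x * z"
  have "nrm y * nrm y = tr (adj (x * y) * z)"
    by (simp add: y_def nsq_def adj_simps mult.assoc flip: nrm_square power2_eq_square) 
      (simp add: nrm_square nsq_def adj_simps mult.assoc)
  also have "\<dots> \<le> nrm (x * y) * nrm z" using tr_le_nrm[of "x * y" z] by simp
  also have "\<dots> \<le> (a * nrm y) * nrm z"
    using assms by (intro mult_right_mono opboundD nrm_nonneg)
  finally have "nrm y * nrm y \<le> nrm y * (a * nrm z)" by (simp add: mult_ac)
  then show "nrm (adj x * z) \<le> a * nrm z"
    using nrm_nonneg[of y] assms(2) nrm_nonneg[of z]
    by (cases "nrm y = 0") (auto simp: y_def)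
qed

text \<open>The Neumann bound without a series: \<open>G * z = z - E * (G * z)\<close> together with
  the reverse triangle inequality.\<close>

lemma resolvent_opbound:
  assumes E: "opbound \<eta> E" and inv: "(1 + E) * G = 1" and \<eta>: "\<eta> < 1"
  shows "opbound (1 / (1 - \<eta>)) G"
  unfolding opbound_def
proof
  fix z
  have "nrm (G * z) - nrm (E * (G * z)) \<le> nrm (G * z + E * (G * z))" by (rule nrm_triangle_diff)
  also have "G * z + E * (G * z) = ((1 + E) * G) * z" by (simp add: algebra_simps)
  finally have "nrm (G * z) \<le> \<eta> * nrm (G * z) + nrm z"
    using opboundD[OF E, of "G * z"] by (simp add: inv)
  then show "nrm (G * z) \<le> 1 / (1 - \<eta>) * nrm z" using \<eta> by (simp add: field_simps)
qed

text \<open>The remainder keeps \<open>E\<close> on both sides, so that under the trace it becomes a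
  quadratic form of \<open>K\<close> and is controlled by the squared norm of \<open>E\<close>
  applied to the weight.\<close>

lemma resolvent_power_expansion:
  assumes inv: "(1 + E) * G = 1" "G * (1 + E) = 1" and G: "opbound g G" and g: "1 \<le> g"
  shows "\<exists>K. G ^ n = 1 - real n *\<^sub>R E + E * K * E \<and> opbound ((real n)\<^sup>2 * g ^ n) K"
proof (induction n)
  case 0
  show ?case by (intro exI[of _ 0]) (simp add: opbound_def nrm_zero)
next
  case (Suc n)
  then obtain K where K: "G ^ n = 1 - real n *\<^sub>R E + E * K * E" "opbound ((real n)\<^sup>2 * g ^ n) K"
    by blast
  have inv': "G + E * G = 1" "G + G * E = 1" using inv by (simp_all add: algebra_simps)
  then have comm: "E * G = G * E" by (metis add_left_imp_eq)
  have G1: "G = 1 - E * G" using inv'(1) by (simp add: eq_diff_eq)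
  have EG: "E * G = E - E * G * E"
  proof -
    have "E * G = E * (1 - G * E)" using inv'(2) by (metis eq_diff_eq)
    then show ?thesis by (simp add: algebra_simps)
  qed
  have G2: "G = 1 - E + E * G * E" using G1 EG by (metis diff_diff_eq2 diff_add_eq)
  \<comment> \<open>Substituting \<open>G = 1 - E + E * G * E\<close> and commuting \<open>E\<close>
    with \<open>G\<close> yields the new linear term; everything else already has \<open>E\<close>
    outside and is collected here.\<close>
  define K' where "K' = (real (Suc n) *\<^sub>R 1 + K) * G"
  have "G ^ Suc n = G ^ n * G" by (simp add: power_commutes)
  also have "\<dots> = G - real n *\<^sub>R (E * G) + E * K * (E * G)"
    by (simp add: K(1) algebra_simps)
  also have "E * K * (E * G) = E * K * G * E" by (simp add: comm mult.assoc)
  also have "G - real n *\<^sub>R (E * G) + E * K * G * E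
      = (1 - E + E * G * E) - real n *\<^sub>R (E - E * G * E) + E * K * G * E"
    using G2 EG by metis
  also have "\<dots> = 1 - real (Suc n) *\<^sub>R E + E * K' * E"
    by (simp add: K'_def algebra_simps)
  finally have eq: "G ^ Suc n = 1 - real (Suc n) *\<^sub>R E + E * K' * E" .
  have "opbound ((real (Suc n) * 1 + (real n)\<^sup>2 * g ^ n) * g) K'"
    unfolding K'_def using g opbound_scale[OF opbound_one, of "real (Suc n)"]
    by (intro opbound_mult opbound_add K G) (auto simp: K(2))
  moreover have "(real (Suc n) * 1 + (real n)\<^sup>2 * g ^ n) * g \<le> (real (Suc n))\<^sup>2 * g ^ Suc n"
  proof -
    have "real (Suc n) * 1 + (real n)\<^sup>2 * g ^ n \<le> real (Suc n) * g ^ n + (real n)\<^sup>2 * g ^ n"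
      using g by (intro add_right_mono mult_left_mono one_le_power) auto
    also have "\<dots> = (real (Suc n) + (real n)\<^sup>2) * g ^ n" by (simp add: algebra_simps)
    also have "\<dots> \<le> (real (Suc n))\<^sup>2 * g ^ n"
      using g by (intro mult_right_mono) (auto simp: power2_eq_square algebra_simps)
    finally show ?thesis using g by (simp add: mult_right_mono mult.assoc[symmetric] mult.commute[of g])
  qed
  ultimately show ?case using eq opbound_mono by blast
qed

text \<open>A certificate that \<open>B\<close> is positive and invertible: \<open>W\<close> stands
  in for a square root of \<open>B\<close>, and \<open>V * adj V\<close> is the inverse of
  \<open>B\<close>.\<close>

definition factor_pair :: "'a \<Rightarrow> 'a \<Rightarrow> 'a \<Rightarrow> bool" where
  "factor_pair B V W \<longleftrightarrow> V * W = 1 \<and> W * V = 1 \<and> B = adj W * W"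

text \<open>For a column vector z, adj z x z is a scalar. This expresses that fact where vectors and
  scalars are themselves elements of the algebra.\<close>

definition rank_one :: "'a \<Rightarrow> bool" where
  "rank_one z \<longleftrightarrow> (\<forall>x. z * adj z * x * z * adj z = tr (adj z * x * z) *\<^sub>R (z * adj z))"

text \<open>\<open>1 + \<beta> T\<close> is the square root of \<open>1 + T\<close> when \<open>T\<^sup>2 = s T\<close>.\<close>
lemma factor_pair_add_rank_one:
  assumes fp: "factor_pair B V W" and z: "rank_one z"
  shows "\<exists>V' W'. factor_pair (B + z * adj z) V' W'"
proof -
  \<comment> \<open>\<open>B + z * adj z\<close> equals \<open>adj W * (1 + T) * W\<close>, so only
    \<open>1 + T\<close> needs a square root.\<close>
  define T where "T = adj V * z * adj z * V"
  define s where "s = nsq (adj V * z)"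
  \<comment> \<open>This is (sqrt (1 + s) - 1) / s rationalized, so it stays meaningful at s = 0.
    The next constant makes 1 - \<gamma> T the inverse of 1 + \<beta> T.\<close>
  define \<beta> where "\<beta> = 1 / (1 + sqrt (1 + s))"
  define \<gamma> where "\<gamma> = \<beta> / (1 + \<beta> * s)"
  have s: "0 \<le> s" by (simp add: s_def nsq_nonneg)
  have VW: "V * W = 1" "W * V = 1" "B = adj W * W" using fp by (simp_all add: factor_pair_def)
  have VW': "adj W * adj V = 1" "adj V * adj W = 1" using VW by (metis adj_mult adj_one)+
  have TT: "T * T = s *\<^sub>R T"
  proof -
    have "T * T = adj V * (z * adj z * (V * adj V) * z * adj z) * V"
      by (simp add: T_def mult.assoc)
    also have "z * adj z * (V * adj V) * z * adj z = tr (adj z * (V * adj V) * z) *\<^sub>R (z * adj z)"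
      using z unfolding rank_one_def by blast
    also have "adj V * \<dots> * V = tr (adj z * (V * adj V) * z) *\<^sub>R T"
      by (simp add: T_def mult.assoc)
    finally show ?thesis by (simp add: s_def nsq_def adj_simps mult.assoc)
  qed
  have adjT: "adj T = T" by (simp add: T_def adj_simps mult.assoc)
  define t where "t = sqrt (1 + s)"
  have t: "1 \<le> t" "s = t\<^sup>2 - 1" using s by (auto simp: t_def)
  have \<beta>: "2 * \<beta> + \<beta>\<^sup>2 * s = 1"
  proof -
    have \<beta>t: "\<beta> * (1 + t) = 1" using t(1) by (simp add: \<beta>_def t_def[symmetric])
    have "\<beta> * s = (\<beta> * (1 + t)) * (t - 1)" by (simp add: t(2) power2_eq_square algebra_simps)
    then have \<beta>s: "\<beta> * s = t - 1" by (simp only: \<beta>t mult_1)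
    have "2 * \<beta> + \<beta>\<^sup>2 * s = 2 * \<beta> + \<beta> * (\<beta> * s)" by (simp add: power2_eq_square)
    also have "\<dots> = \<beta> * (1 + t)" unfolding \<beta>s by (simp add: algebra_simps)
    finally show ?thesis using \<beta>t by simp
  qed
  have "0 \<le> \<beta>" using s by (simp add: \<beta>_def)
  then have "1 + \<beta> * s > 0" using s by (simp add: add_pos_nonneg)
  then have \<gamma>: "\<beta> - \<gamma> - \<beta> * \<gamma> * s = 0" by (simp add: \<gamma>_def field_simps)
  define L where "L = 1 + \<beta> *\<^sub>R T"
  define M where "M = 1 - \<gamma> *\<^sub>R T"
  have "L * M = 1 + (\<beta> - \<gamma> - \<beta> * \<gamma> * s) *\<^sub>R T"
    by (simp add: L_def M_def algebra_simps TT)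
  then have inv_lm: "L * M = 1" by (simp add: \<gamma>)
  have "M * L = 1 + (\<beta> - \<gamma> - \<beta> * \<gamma> * s) *\<^sub>R T"
    by (simp add: L_def M_def algebra_simps TT)
  then have inv_ml: "M * L = 1" by (simp add: \<gamma>)
  have "L * L = 1 + (\<beta> + \<beta> + \<beta> * \<beta> * s) *\<^sub>R T"
    unfolding L_def distrib_left distrib_right scaleR_add_left
    by (simp add: TT algebra_simps)
  moreover have "\<beta> + \<beta> + \<beta> * \<beta> * s = 1" using \<beta> by (simp add: power2_eq_square)
  ultimately have LL: "L * L = 1 + T" by simp
  have "factor_pair (B + z * adj z) (V * M) (L * W)"
    unfolding factor_pair_def
  proof (intro conjI)
    show "V * M * (L * W) = 1" using inv_ml VW by (metis mult.assoc mult_1)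
    show "L * W * (V * M) = 1" using inv_lm VW by (metis mult.assoc mult_1)
    have "adj (L * W) * (L * W) = adj W * (L * L) * W"
      by (simp add: adj_mult L_def adj_simps adjT mult.assoc)
    also have "\<dots> = B + (adj W * adj V) * z * adj z * (V * W)"
      by (simp add: LL VW(3) algebra_simps T_def)
    finally show "B + z * adj z = adj (L * W) * (L * W)" by (simp add: VW VW')
  qed
  then show ?thesis by blast
qed

lemma rank_one_scale: "rank_one z \<Longrightarrow> rank_one (a *\<^sub>R z)"
  by (simp add: rank_one_def adj_simps tr_simps)

lemma factor_pair_sum_rank_one:
  assumes "finite J" "\<And>j. j \<in> J \<Longrightarrow> rank_one (z j)" "\<And>j. j \<in> J \<Longrightarrow> 0 \<le> w j"
  shows "\<exists>V W. factor_pair (1 + (\<Sum>j\<in>J. w j *\<^sub>R (z j * adj (z j)))) V W"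
  using assms
proof (induction J)
  case empty
  show ?case by (intro exI[of _ 1]) (simp add: factor_pair_def adj_one)
next
  case (insert j J)
  then obtain V W where "factor_pair (1 + (\<Sum>j\<in>J. w j *\<^sub>R (z j * adj (z j)))) V W" by auto
  then obtain V' W' where
    "factor_pair (1 + (\<Sum>j\<in>J. w j *\<^sub>R (z j * adj (z j))) + (sqrt (w j) *\<^sub>R z j) * adj (sqrt (w j) *\<^sub>R z j)) V' W'"
    using factor_pair_add_rank_one rank_one_scale insert.prems by (metis insertI1)
  moreover have "(sqrt (w j) *\<^sub>R z j) * adj (sqrt (w j) *\<^sub>R z j) = w j *\<^sub>R (z j * adj (z j))"
    using insert.prems by (simp add: adj_scale)
  ultimately show ?case using insert.hyps by (auto simp: algebra_simps)
qed

lemma factor_pair_inverse: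
  assumes "factor_pair B V W"
  shows "(V * adj V) * B = 1" "B * (V * adj V) = 1"
proof -
  have VW: "V * W = 1" "W * V = 1" "B = adj W * W" using assms by (simp_all add: factor_pair_def)
  have VW': "adj W * adj V = 1" "adj V * adj W = 1" using VW by (metis adj_mult adj_one)+
  show "(V * adj V) * B = 1" "B * (V * adj V) = 1"
    using VW VW' by (metis mult.assoc mult_1 mult_1_right)+
qed

text \<open>The weight \<open>V (V\<^sup>* V)\<^bsup>q/2\<^esup>\<close> is a square root of the power \<open>q + 1\<close> of \<open>V V\<^sup>* = B\<^sup>-\<^sup>1\<close>,
  and it does not depend on the perturbation \<open>\<Delta>\<close>.\<close>
lemma tr_inverse_power_perturbation:
  fixes j :: nat
  defines "q \<equiv> 2 ^ Suc j"
  assumes fp: "factor_pair B V W" and ge1: "\<And>z. nsq z \<le> tr (adj z * B * z)"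
    and fp': "factor_pair (B + \<Delta>) V' W'"
    and \<Delta>: "adj \<Delta> = \<Delta>" "opbound \<eta> \<Delta>" and \<eta>: "0 \<le> \<eta>" "real q * \<eta> \<le> 1 / 2"
  defines "Z \<equiv> V * (adj V * V) ^ (2 ^ j)"
  shows "tr ((V' * adj V') ^ q) \<le> tr ((V * adj V) ^ q) - real q * tr (adj Z * \<Delta> * Z)
           + 2 * (real q)\<^sup>2 * nsq (\<Delta> * Z)"
proof -
  define A' where "A' = V' * adj V'"
  \<comment> \<open>In coordinates where \<open>B\<close> becomes 1, the perturbation is
    \<open>E\<close> and the new inverse is \<open>G\<close>, the inverse of \<open>1 + E\<close>.
    Going back, \<open>A' = V * (G * adj V)\<close>.\<close>
  define E where "E = adj V * \<Delta> * V"
  define G where "G = W * A' * adj W"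
  define S where "S = adj V * V"
  define Th where "Th = S ^ (2 ^ j)"
  have VW: "V * W = 1" "W * V = 1" "B = adj W * W" using fp by (simp_all add: factor_pair_def)
  have VW': "adj W * adj V = 1" "adj V * adj W = 1" using VW by (metis adj_mult adj_one)+
  have A': "A' * (B + \<Delta>) = 1" "(B + \<Delta>) * A' = 1"
    using factor_pair_inverse[OF fp'] by (simp_all add: A'_def)
  have adjs: "adj A' = A'" "adj E = E" "adj G = G" "adj S = S" "adj Th = Th"
    by (simp_all add: A'_def E_def G_def S_def Th_def adj_simps \<Delta> mult.assoc)
  have q2: "q = 2 ^ j + 2 ^ j" by (simp add: q_def)
  have E1: "1 + E = adj V * (B + \<Delta>) * V"
  proof -
    have "adj V * (B + \<Delta>) * V = (adj V * adj W) * (W * V) + E"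
      by (simp add: E_def VW(3) algebra_simps)
    then show ?thesis by (simp add: VW VW')
  qed
  have "(1 + E) * G = adj V * ((B + \<Delta>) * ((V * W) * A')) * adj W"
    by (simp add: E1 G_def mult.assoc)
  then have inv1: "(1 + E) * G = 1" by (simp add: VW(1) VW' A')
  have "G * (1 + E) = W * (A' * ((adj W * adj V) * (B + \<Delta>))) * V"
    by (simp add: E1 G_def mult.assoc)
  then have inv2: "G * (1 + E) = 1" by (simp add: VW(2) VW' A')
  have A'_eq: "A' = V * (G * adj V)"
  proof -
    have "V * (G * adj V) = (V * W) * A' * (adj W * adj V)" by (simp add: G_def mult.assoc)
    then show ?thesis by (simp add: VW VW')
  qed
  \<comment> \<open>Since \<open>B\<close> dominates 1, \<open>V\<close> contracts: the length of
    \<open>V * z\<close> is at most that of \<open>W * (V * z)\<close>, which is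
    \<open>z\<close>.\<close>
  have V1: "opbound 1 V"
    unfolding opbound_def
  proof
    fix z
    have "nsq (V * z) \<le> nsq (W * (V * z))"
      using ge1[of "V * z"] by (simp add: nsq_def adj_simps VW(3) mult.assoc)
    also have "W * (V * z) = z" using VW by (metis mult.assoc mult_1)
    finally show "nrm (V * z) \<le> 1 * nrm z" by (simp add: nrm_def)
  qed
  have aV1: "opbound 1 (adj V)" using opbound_adj[OF V1] by simp
  have "opbound (1 * \<eta> * 1) E"
    unfolding E_def by (intro opbound_mult aV1 V1 \<Delta>) (use \<eta> in auto)
  then have E\<eta>: "opbound \<eta> E" by simp
  have "1 \<le> q" unfolding q_def by simp
  then have q1: "1 \<le> real q" by linarith
  have "\<eta> \<le> real q * \<eta>" using q1 \<eta>(1) mult_right_mono[of 1 "real q" \<eta>] by simp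
  then have \<eta>2: "\<eta> \<le> 1 / 2" using \<eta> by simp
  define g where "g = 1 / (1 - \<eta>)"
  have g1: "1 \<le> g" using \<eta>2 \<eta> by (simp add: g_def)
  \<comment> \<open>By Bernoulli, (1 - \<eta>)^q is at least 1 - q \<eta>, hence at least 1/2. This
    is the factor 2 of the error term.\<close>
  have gq: "g ^ q \<le> 2"
  proof -
    have "1 / 2 \<le> 1 + real q * (- \<eta>)" using \<eta> by simp
    also have "\<dots> \<le> (1 + - \<eta>) ^ q" using \<eta>2 by (intro Bernoulli_inequality) auto
    finally have "1 / 2 \<le> (1 - \<eta>) ^ q" by simp
    then show ?thesis using \<eta>2 by (simp add: g_def power_one_over field_simps)
  qed
  have Gg: "opbound g G" unfolding g_def using \<eta>2 by (intro resolvent_opbound[OF E\<eta> inv1]) auto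
  obtain K where K: "G ^ q = 1 - real q *\<^sub>R E + E * K * E" "opbound ((real q)\<^sup>2 * g ^ q) K"
    using resolvent_power_expansion[OF inv1 inv2 Gg g1] by blast
  have K2: "opbound (2 * (real q)\<^sup>2) K"
    by (rule opbound_mono[OF K(2)]) (use gq in \<open>simp add: mult_right_mono mult.commute\<close>)
  have VTh: "Z = V * Th" by (simp add: Z_def Th_def S_def)
  have S_q: "S ^ q = Th * Th" by (simp add: q2 Th_def power_add)
  \<comment> \<open>Cyclicity brings \<open>S = adj V * V\<close> next to \<open>G\<close>.
    Lieb-Thirring then separates the powers, and only \<open>G ^ q\<close> depends on the
    perturbation.\<close>
  have "tr (A' ^ q) = tr ((G * S) ^ q)"
    by (simp add: A'_eq S_def tr_power_comm[of V] mult.assoc)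
  also have "\<dots> \<le> tr (G ^ q * S ^ q)"
    unfolding q_def by (rule trace_Lieb_Thirring) (simp_all add: adjs)
  also have "\<dots> = tr (S ^ q) - real q * tr (E * S ^ q) + tr (E * K * E * S ^ q)"
    by (simp add: K(1) algebra_simps tr_simps)
  also have "tr (S ^ q) = tr ((V * adj V) ^ q)" unfolding S_def by (rule tr_power_comm)
  also have "tr (E * S ^ q) = tr (adj Z * \<Delta> * Z)"
  proof -
    have "tr (E * S ^ q) = tr ((E * Th) * Th)" by (simp add: S_q mult.assoc)
    also have "\<dots> = tr (Th * (E * Th))" by (rule tr_comm)
    finally show ?thesis by (simp add: E_def VTh adj_mult adjs mult.assoc)
  qed
  also have "tr (E * K * E * S ^ q) = tr (adj (E * Th) * (K * (E * Th)))"
  proof -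
    have "tr (E * K * E * S ^ q) = tr ((E * K * E * Th) * Th)" by (simp add: S_q mult.assoc)
    also have "\<dots> = tr (Th * (E * K * E * Th))" by (rule tr_comm)
    finally show ?thesis by (simp add: adj_mult adjs mult.assoc)
  qed
  also have "tr (adj (E * Th) * (K * (E * Th))) \<le> 2 * (real q)\<^sup>2 * nsq (\<Delta> * Z)"
  proof -
    have "tr (adj (E * Th) * (K * (E * Th))) \<le> nrm (E * Th) * nrm (K * (E * Th))"
      using tr_le_nrm[of "E * Th" "K * (E * Th)"] by simp
    also have "\<dots> \<le> nrm (E * Th) * (2 * (real q)\<^sup>2 * nrm (E * Th))"
      by (intro mult_left_mono opboundD K2 nrm_nonneg)
    also have "\<dots> = 2 * (real q)\<^sup>2 * (nrm (E * Th))\<^sup>2" by (simp add: power2_eq_square)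
    also have "\<dots> \<le> 2 * (real q)\<^sup>2 * (nrm (\<Delta> * Z))\<^sup>2"
    proof -
      have "nrm (E * Th) \<le> nrm (\<Delta> * Z)"
        using opboundD[OF aV1, of "\<Delta> * Z"] by (simp add: E_def VTh mult.assoc)
      then show ?thesis by (intro mult_left_mono power_mono nrm_nonneg) auto
    qed
    finally show ?thesis by (simp add: nrm_square)
  qed
  finally show ?thesis unfolding A'_def by simp
qed

text \<open>One step of the supermartingale in abstract form. The weight \<open>Z\<close> is the
  same for all \<open>i\<close>, so the linear term averages exactly to the drift. Because
  \<open>Y l * Y l = R *\<^sub>R Y l\<close>, the quadratic term is again bounded by the numbers
  \<open>y l\<close>. Drift q \<alpha> F and loss 2 q^2 \<delta>^2 R F therefore share the factor
  \<open>F\<close>, and the last smallness condition compares them.\<close>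

lemma tr_inverse_power_average:
  fixes j :: nat and \<omega> :: "'i \<Rightarrow> real" and a :: "'i \<Rightarrow> 'j \<Rightarrow> real"
  defines "q \<equiv> 2 ^ Suc j"
  assumes fp: "factor_pair B V W" and ge1: "\<And>z. nsq z \<le> tr (adj z * B * z)"
    and fp': "\<And>i. i \<in> I \<Longrightarrow> factor_pair (B + (\<Sum>l\<in>J. a i l *\<^sub>R Y l)) (V' i) (W' i)"
    and Y: "\<And>l. l \<in> J \<Longrightarrow> adj (Y l) = Y l" "\<And>l. l \<in> J \<Longrightarrow> Y l * Y l = R *\<^sub>R Y l" and R: "0 < R"
    and a: "\<And>i. i \<in> I \<Longrightarrow> (\<Sum>l\<in>J. \<bar>a i l\<bar>) \<le> \<delta>" and \<delta>: "0 \<le> \<delta>"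
    and \<omega>: "\<And>i. i \<in> I \<Longrightarrow> 0 \<le> \<omega> i" "(\<Sum>i\<in>I. \<omega> i) = 1"
    and f: "\<And>l. l \<in> J \<Longrightarrow> 0 \<le> f l"
    and mean: "\<And>l. l \<in> J \<Longrightarrow> (\<Sum>i\<in>I. \<omega> i * a i l) = \<alpha> * f l"
    and var: "\<And>l. l \<in> J \<Longrightarrow> (\<Sum>i\<in>I. \<omega> i * \<bar>a i l\<bar>) \<le> \<delta> * f l"
    and small: "real q * (\<delta> * R) \<le> 1 / 2" "2 * real q * \<delta>\<^sup>2 * R \<le> \<alpha>"
  shows "(\<Sum>i\<in>I. \<omega> i * tr ((V' i * adj (V' i)) ^ q)) \<le> tr ((V * adj V) ^ q)"
proof -
  define Z where "Z = V * (adj V * V) ^ (2 ^ j)"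
  define \<Delta> where "\<Delta> i = (\<Sum>l\<in>J. a i l *\<^sub>R Y l)" for i
  define y where "y l = tr (adj Z * Y l * Z)" for l
  have nsqY: "nsq (Y l * z) = R * tr (adj z * Y l * z)" if "l \<in> J" for l z
  proof -
    have "nsq (Y l * z) = tr (adj z * (Y l * Y l) * z)"
      by (simp add: nsq_def adj_mult Y(1) that mult.assoc)
    then show ?thesis by (simp add: Y that tr_simps)
  qed
  have y: "0 \<le> y l" if "l \<in> J" for l
    using nsqY[OF that, of Z] nsq_nonneg[of "Y l * Z"] R by (simp add: y_def zero_le_mult_iff)
  have opY: "opbound R (Y l)" if "l \<in> J" for l
    unfolding opbound_def
  proof
    fix z
    have "nsq (Y l * z) = R * tr (adj (Y l * z) * z)"
      by (simp add: nsqY that adj_mult Y mult.assoc)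
    then have "nsq (Y l * z) \<le> R\<^sup>2 * nsq z" using R by (intro nsq_cancel) auto
    then show "nrm (Y l * z) \<le> R * nrm z"
      using R nsq_nonneg[of z] unfolding nrm_def
      by (intro real_le_lsqrt) (auto simp: power_mult_distrib nsq_nonneg)
  qed
  have step: "tr ((V' i * adj (V' i)) ^ q) \<le> tr ((V * adj V) ^ q) - real q * tr (adj Z * \<Delta> i * Z)
           + 2 * (real q)\<^sup>2 * nsq (\<Delta> i * Z)" if i: "i \<in> I" for i
    unfolding q_def Z_def
  proof (rule tr_inverse_power_perturbation[OF fp ge1])
    show "factor_pair (B + \<Delta> i) (V' i) (W' i)" using fp'[OF i] by (simp add: \<Delta>_def)
    show "adj (\<Delta> i) = \<Delta> i" by (simp add: \<Delta>_def adj_simps Y)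
    have "opbound (\<Sum>l\<in>J. \<bar>a i l\<bar> * R) (\<Delta> i)"
      unfolding \<Delta>_def by (intro opbound_sum opbound_scale opY)
    then show "opbound (\<delta> * R) (\<Delta> i)"
      by (rule opbound_mono) (use a[OF i] R in \<open>simp flip: sum_distrib_right\<close>)
    show "0 \<le> \<delta> * R" using \<delta> R by simp
    show "real (2 ^ Suc j) * (\<delta> * R) \<le> 1 / 2" using small by (simp add: q_def)
  qed
  have lin: "tr (adj Z * \<Delta> i * Z) = (\<Sum>l\<in>J. a i l * y l)" for i
    by (simp add: \<Delta>_def y_def sum_distrib_left sum_distrib_right tr_simps)
  have quad: "nsq (\<Delta> i * Z) \<le> \<delta> * R * (\<Sum>l\<in>J. \<bar>a i l\<bar> * y l)" if i: "i \<in> I" for i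
  proof -
    have "nsq (\<Delta> i * Z) = nsq (\<Sum>l\<in>J. a i l *\<^sub>R (Y l * Z))"
      by (simp add: \<Delta>_def sum_distrib_right)
    also have "\<dots> \<le> (\<Sum>l\<in>J. \<bar>a i l\<bar>) * (\<Sum>l\<in>J. \<bar>a i l\<bar> * nsq (Y l * Z))"
      by (rule nsq_weighted_sum_le)
    also have "(\<Sum>l\<in>J. \<bar>a i l\<bar> * nsq (Y l * Z)) = R * (\<Sum>l\<in>J. \<bar>a i l\<bar> * y l)"
      by (simp add: nsqY y_def sum_distrib_left mult_ac)
    also have "(\<Sum>l\<in>J. \<bar>a i l\<bar>) * (R * (\<Sum>l\<in>J. \<bar>a i l\<bar> * y l)) \<le> \<delta> * (R * (\<Sum>l\<in>J. \<bar>a i l\<bar> * y l))"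
      using R y by (intro mult_right_mono a i mult_nonneg_nonneg sum_nonneg) auto
    finally show ?thesis by (simp add: mult.assoc)
  qed
  have avg1: "(\<Sum>i\<in>I. \<omega> i * (\<Sum>l\<in>J. a i l * y l)) = \<alpha> * (\<Sum>l\<in>J. f l * y l)"
  proof -
    have "(\<Sum>i\<in>I. \<omega> i * (\<Sum>l\<in>J. a i l * y l)) = (\<Sum>l\<in>J. (\<Sum>i\<in>I. \<omega> i * a i l) * y l)"
      by (simp add: sum_distrib_left sum_distrib_right mult.assoc) (rule sum.swap)
    then show ?thesis by (simp add: mean sum_distrib_left mult.assoc)
  qed
  have avg2: "(\<Sum>i\<in>I. \<omega> i * (\<Sum>l\<in>J. \<bar>a i l\<bar> * y l)) \<le> \<delta> * (\<Sum>l\<in>J. f l * y l)"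
  proof -
    have "(\<Sum>i\<in>I. \<omega> i * (\<Sum>l\<in>J. \<bar>a i l\<bar> * y l)) = (\<Sum>l\<in>J. (\<Sum>i\<in>I. \<omega> i * \<bar>a i l\<bar>) * y l)"
      by (simp add: sum_distrib_left sum_distrib_right mult.assoc) (rule sum.swap)
    also have "\<dots> \<le> (\<Sum>l\<in>J. (\<delta> * f l) * y l)" by (intro sum_mono mult_right_mono var y)
    finally show ?thesis by (simp add: sum_distrib_left mult.assoc)
  qed
  define F where "F = (\<Sum>l\<in>J. f l * y l)"
  have F: "0 \<le> F" unfolding F_def by (intro sum_nonneg mult_nonneg_nonneg f y)
  have "(\<Sum>i\<in>I. \<omega> i * tr ((V' i * adj (V' i)) ^ q))
      \<le> (\<Sum>i\<in>I. \<omega> i * (tr ((V * adj V) ^ q) - real q * (\<Sum>l\<in>J. a i l * y l)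
           + 2 * (real q)\<^sup>2 * (\<delta> * R * (\<Sum>l\<in>J. \<bar>a i l\<bar> * y l))))"
  proof (intro sum_mono mult_left_mono \<omega>)
    fix i assume i: "i \<in> I"
    have "2 * (real q)\<^sup>2 * nsq (\<Delta> i * Z) \<le> 2 * (real q)\<^sup>2 * (\<delta> * R * (\<Sum>l\<in>J. \<bar>a i l\<bar> * y l))"
      by (intro mult_left_mono quad i) auto
    then show "tr ((V' i * adj (V' i)) ^ q) \<le> tr ((V * adj V) ^ q) - real q * (\<Sum>l\<in>J. a i l * y l)
           + 2 * (real q)\<^sup>2 * (\<delta> * R * (\<Sum>l\<in>J. \<bar>a i l\<bar> * y l))"
      using step[OF i] by (simp add: lin)
  qed
  also have "\<dots> = (\<Sum>i\<in>I. \<omega> i) * tr ((V * adj V) ^ q) - real q * (\<Sum>i\<in>I. \<omega> i * (\<Sum>l\<in>J. a i l * y l))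
      + 2 * (real q)\<^sup>2 * (\<delta> * R) * (\<Sum>i\<in>I. \<omega> i * (\<Sum>l\<in>J. \<bar>a i l\<bar> * y l))"
    by (simp only: ring_distribs sum.distrib sum_subtractf sum_distrib_left sum_distrib_right mult_ac)
  also have "\<dots> \<le> tr ((V * adj V) ^ q) - real q * (\<alpha> * F) + 2 * (real q)\<^sup>2 * (\<delta> * R) * (\<delta> * F)"
    unfolding avg1 F_def[symmetric] \<omega>(2)
    using avg2 R \<delta> by (intro add_mono mult_left_mono) (auto simp: F_def)
  also have "\<dots> = tr ((V * adj V) ^ q) - real q * F * (\<alpha> - 2 * real q * \<delta>\<^sup>2 * R)"
    by (simp add: algebra_simps power2_eq_square)
  also have "\<dots> \<le> tr ((V * adj V) ^ q)"
    using small(2) F by simp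
  finally show ?thesis .
qed

text \<open>The form bound makes the inverse \<open>A\<close> bounded by \<open>1 / s\<close>. An
  even power of \<open>A\<close> has trace \<open>nsq (A ^ p)\<close>, which is compared with
  \<open>nsq 1 = tr 1\<close>.\<close>

lemma tr_inverse_power_le:
  assumes fp: "factor_pair B V W" and s: "0 < s" and ge: "\<And>z. s * nsq z \<le> tr (adj z * B * z)"
  shows "tr ((V * adj V) ^ (2 * p)) \<le> tr 1 / s ^ (2 * p)"
proof -
  define A where "A = V * adj V"
  have adjA: "adj A = A" by (simp add: A_def adj_simps)
  have BA: "B * A = 1" using factor_pair_inverse[OF fp] by (simp add: A_def)
  have "opbound (1 / s) A"
    unfolding opbound_def
  proof
    fix z
    have "s * nsq (A * z) \<le> tr (adj (A * z) * (B * A) * z)"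
      using ge[of "A * z"] by (simp add: mult.assoc)
    then have "nsq (A * z) \<le> (1 / s) * tr (adj (A * z) * z)"
      using s by (simp add: BA field_simps)
    then have "nsq (A * z) \<le> (1 / s)\<^sup>2 * nsq z" using s by (intro nsq_cancel) auto
    then show "nrm (A * z) \<le> 1 / s * nrm z"
      using s nsq_nonneg[of z] unfolding nrm_def
      by (intro real_le_lsqrt) (auto simp: power_mult_distrib power_divide nsq_nonneg)
  qed
  then have "nrm (A ^ p * 1) \<le> (1 / s) ^ p * nrm 1"
    using s by (intro opboundD opbound_power) auto
  then have "(nrm (A ^ p))\<^sup>2 \<le> ((1 / s) ^ p * nrm 1)\<^sup>2"
    by (intro power_mono nrm_nonneg) auto
  then have "nsq (A ^ p) \<le> (1 / s) ^ (2 * p) * nsq 1"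
    unfolding power_mult_distrib nrm_square by (simp add: mult.commute flip: power_mult)
  then show ?thesis
    by (simp add: nsq_def adj_simps adjA mult_2 power_add power_one_over A_def[symmetric])
qed

text \<open>Cauchy-Schwarz applied to 1 = tr (adj x V W x) bounds the form of the inverse at
  \<open>x\<close> below by 1 / \<beta>. Each further application squares the bound and doubles the
  power, which is Jensen's inequality for powers of two. Finally \<open>contr\<close> removes
  \<open>x\<close>.\<close>

lemma tr_inverse_power_ge:
  assumes fp: "factor_pair B V W" and x: "nsq x = 1" and le: "tr (adj x * B * x) \<le> \<beta>"
    and contr: "\<And>z. nsq (z * x) \<le> nsq z"
  shows "(1 / \<beta>) ^ (2 ^ Suc j) \<le> tr ((V * adj V) ^ (2 ^ Suc j))"
proof -
  define A where "A = V * adj V"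
  have adjA: "adj A = A" by (simp add: A_def adj_simps)
  have VW: "V * W = 1" "B = adj W * W" using fp by (simp_all add: factor_pair_def)
  have "1 = (tr (adj (adj V * x) * (W * x)))\<^sup>2"
  proof -
    have "adj (adj V * x) * (W * x) = adj x * (V * W) * x" by (simp add: adj_simps mult.assoc)
    then show ?thesis using x by (simp add: VW nsq_def)
  qed
  also have "\<dots> \<le> nsq (adj V * x) * nsq (W * x)" by (rule Cauchy_Schwarz_tr)
  also have "nsq (adj V * x) = tr (adj x * A * x)" by (simp add: nsq_def A_def adj_simps mult.assoc)
  also have "nsq (W * x) = tr (adj x * B * x)" by (simp add: nsq_def VW adj_simps mult.assoc)
  finally have one: "1 \<le> tr (adj x * A * x) * tr (adj x * B * x)" .
  have nnA: "0 \<le> tr (adj x * A * x)"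
    using nsq_nonneg[of "adj V * x"] by (simp add: nsq_def A_def adj_simps mult.assoc)
  then have oneb: "1 \<le> tr (adj x * A * x) * \<beta>" using one le by (meson mult_left_mono order_trans)
  then have \<beta>: "0 < \<beta>" using nnA
    by (metis less_numeral_extra(1) mult_nonneg_nonpos not_less order.strict_trans1 order.trans)
  have base: "1 / \<beta> \<le> tr (adj x * A * x)" using oneb \<beta> by (simp add: field_simps)
  have double: "tr (adj x * A ^ (p + p) * x) = nsq (A ^ p * x)" for p
    by (simp add: nsq_def adj_simps adjA power_add mult.assoc)
  have pow: "(1 / \<beta>) ^ (2 ^ i) \<le> tr (adj x * A ^ (2 ^ i) * x)" for i
  proof (induction i)
    case 0
    show ?case using base by simp
  next
    case (Suc i)
    have "(1 / \<beta>) ^ (2 ^ Suc i) = ((1 / \<beta>) ^ (2 ^ i))\<^sup>2" by (simp add: mult.commute flip: power_mult)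
    also have "\<dots> \<le> (tr (adj x * (A ^ (2 ^ i) * x)))\<^sup>2"
      using Suc \<beta> by (intro power_mono) (auto simp: mult.assoc)
    also have "\<dots> \<le> nsq x * nsq (A ^ (2 ^ i) * x)" by (rule Cauchy_Schwarz_tr)
    also have "\<dots> = tr (adj x * A ^ (2 ^ Suc i) * x)" using double[of "2 ^ i"] x by (simp add: mult_2)
    finally show ?case .
  qed
  have "(1 / \<beta>) ^ (2 ^ Suc j) \<le> nsq (A ^ (2 ^ j) * x)"
    using pow[of "Suc j"] double[of "2 ^ j"] by (simp add: mult_2)
  also have "\<dots> \<le> nsq (A ^ (2 ^ j))" by (rule contr)
  also have "\<dots> = tr (A ^ (2 ^ Suc j))" by (simp add: nsq_def adj_simps adjA mult_2 power_add)
  finally show ?thesis by (simp add: A_def)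
qed

end

section \<open>Conditioning on inclusion\<close>

definition incl :: "nat set pmf \<Rightarrow> nat set \<Rightarrow> real" where
  "incl \<mu> S = measure_pmf.prob \<mu> {X. S \<subseteq> X}"

lemma incl_nonneg: "0 \<le> incl \<mu> S"
  by (simp add: incl_def)

lemma incl_eq_0_iff: "incl \<mu> S = 0 \<longleftrightarrow> \<not> 0 < incl \<mu> S"
  using incl_nonneg[of \<mu> S] by auto

lemma cond_prob_eq_incl: "cond_prob \<mu> j T = incl \<mu> (insert j T) / incl \<mu> T"
  by (simp add: cond_prob_def incl_def)

lemma one_sided_linf_independent_incl:
  assumes "one_sided_linf_independent n \<mu> D" "S \<subseteq> {..<n}" "i \<in> {..<n} - S" "0 < incl \<mu> (insert i S)"
  shows "(\<Sum>j\<in>{..<n} - S. \<bar>cond_prob \<mu> j (insert i S) - cond_prob \<mu> j S\<bar>) \<le> D"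
  using assms unfolding one_sided_linf_independent_def incl_def by blast

lemma incl_mono: "S \<subseteq> T \<Longrightarrow> incl \<mu> T \<le> incl \<mu> S"
  unfolding incl_def by (intro measure_pmf.finite_measure_mono) auto

lemma cond_prob_nonneg: "0 \<le> cond_prob \<mu> i S"
  by (simp add: cond_prob_eq_incl incl_nonneg)

text \<open>The conditional covariance of the indicators of \<open>i\<close> and \<open>j\<close>
  given that \<open>S\<close> is included. Unlike the influence it is symmetric, so the one-sided
  hypothesis can be used in either index.\<close>

definition pair_cov :: "nat set pmf \<Rightarrow> nat set \<Rightarrow> nat \<Rightarrow> nat \<Rightarrow> real" where
  "pair_cov \<mu> S i j = incl \<mu> (insert i (insert j S)) / incl \<mu> S - cond_prob \<mu> i S * cond_prob \<mu> j S"

lemma pair_cov_sym: "pair_cov \<mu> S i j = pair_cov \<mu> S j i"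
  by (simp add: pair_cov_def insert_commute mult.commute)

lemma pair_cov_eq:
  assumes "0 < incl \<mu> S"
  shows "pair_cov \<mu> S i j = cond_prob \<mu> i S * (cond_prob \<mu> j (insert i S) - cond_prob \<mu> j S)"
proof (cases "incl \<mu> (insert i S) = 0")
  \<comment> \<open>Here \<open>i\<close> cannot join \<open>S\<close>. The conditional probability
    given \<open>insert i S\<close> is a division by zero, but the factor in front of it
    vanishes.\<close>
  case True
  then have "incl \<mu> (insert j (insert i S)) = 0"
    using incl_mono[of "insert i S" "insert j (insert i S)"]
    by (metis incl_nonneg order_antisym subset_insertI)
  then show ?thesis using True by (simp add: pair_cov_def cond_prob_eq_incl insert_commute)
next
  case False
  then show ?thesis using assms
    by (simp add: pair_cov_def cond_prob_eq_incl insert_commute field_simps)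
qed

lemma prob_eq_sum_Pow:
  assumes "k_homogeneous n k \<mu>"
  shows "measure_pmf.prob \<mu> E = (\<Sum>X\<in>Pow {..<n}. of_bool (X \<in> E) * pmf \<mu> X)"
proof -
  have "measure_pmf.prob \<mu> E = measure_pmf.prob \<mu> (E \<inter> set_pmf \<mu>)"
    by (rule measure_Int_set_pmf [symmetric])
  also have "E \<inter> set_pmf \<mu> = (E \<inter> Pow {..<n}) \<inter> set_pmf \<mu>"
    using assms by (auto simp: k_homogeneous_def)
  also have "measure_pmf.prob \<mu> \<dots> = measure_pmf.prob \<mu> (E \<inter> Pow {..<n})"
    by (rule measure_Int_set_pmf)
  also have "\<dots> = (\<Sum>X\<in>E \<inter> Pow {..<n}. pmf \<mu> X)"
    by (rule measure_measure_pmf_finite) auto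
  also have "\<dots> = (\<Sum>X\<in>Pow {..<n}. of_bool (X \<in> E) * pmf \<mu> X)"
    by (rule sum.mono_neutral_cong_left) (auto simp: of_bool_def)
  finally show ?thesis .
qed

text \<open>Double counting: a realization containing \<open>T\<close> has exactly
  \<open>k - card S\<close> elements outside \<open>S\<close>. \<open>T\<close> exceeds
  \<open>S\<close> when covariances are summed; \<open>g\<close> will be the potential of the
  realization.\<close>

lemma sum_extensions:
  assumes hom: "k_homogeneous n k \<mu>" and S: "S \<subseteq> T" "S \<subseteq> {..<n}"
  shows "(\<Sum>i\<in>{..<n} - S. \<Sum>X\<in>Pow {..<n}. of_bool (insert i T \<subseteq> X) * (pmf \<mu> X * g X))
       = (real k - real (card S)) * (\<Sum>X\<in>Pow {..<n}. of_bool (T \<subseteq> X) * (pmf \<mu> X * g X))"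
proof -
  have "(\<Sum>i\<in>{..<n} - S. of_bool (insert i T \<subseteq> X) * (pmf \<mu> X * g X))
      = (real k - real (card S)) * (of_bool (T \<subseteq> X) * (pmf \<mu> X * g X))" if X: "X \<subseteq> {..<n}" for X
  proof (cases "X \<in> set_pmf \<mu> \<and> T \<subseteq> X")
    case True
    then have "card X = k" using hom by (simp add: k_homogeneous_def)
    have "S \<subseteq> X" using S True by blast
    moreover have "finite X" using X finite_subset by blast
    ultimately have "card (X - S) = k - card S" "card S \<le> k"
      using \<open>card X = k\<close> by (auto simp: card_Diff_subset card_mono finite_subset)
    then have "real (card (X - S)) = real k - real (card S)"
      by (simp add: of_nat_diff)
    moreover have "(\<Sum>i\<in>{..<n} - S. of_bool (i \<in> X)) = real (card (X - S))"
    proof -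
      have "(\<Sum>i\<in>{..<n} - S. of_bool (i \<in> X)) = (\<Sum>i\<in>X - S. (1::real))"
        using X by (intro sum.mono_neutral_cong_right) auto
      then show ?thesis by simp
    qed
    ultimately show ?thesis using True by (simp flip: sum_distrib_right)
  next
    case False
    then show ?thesis by (auto simp: set_pmf_eq)
  qed
  then show ?thesis
    by (subst sum.swap) (auto simp only: sum_distrib_left Pow_iff intro!: sum.cong)
qed

context
  fixes n k :: nat and \<mu> :: "nat set pmf"
  assumes hom: "k_homogeneous n k \<mu>"
begin

lemma incl_eq_sum: "incl \<mu> S = (\<Sum>X\<in>Pow {..<n}. of_bool (S \<subseteq> X) * pmf \<mu> X)"
  unfolding incl_def by (subst prob_eq_sum_Pow[OF hom]) (simp only: mem_Collect_eq)

lemma sum_incl: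
  assumes "S \<subseteq> T" "S \<subseteq> {..<n}"
  shows "(\<Sum>i\<in>{..<n} - S. incl \<mu> (insert i T)) = (real k - real (card S)) * incl \<mu> T"
  using sum_extensions[OF hom assms, of "\<lambda>_. 1"] by (simp only: incl_eq_sum mult_1_right)

lemma sum_cond_prob:
  assumes "S \<subseteq> {..<n}" "0 < incl \<mu> S"
  shows "(\<Sum>i\<in>{..<n} - S. cond_prob \<mu> i S) = real k - real (card S)"
  using sum_incl[OF order_refl assms(1)] assms(2) by (simp add: cond_prob_eq_incl flip: sum_divide_distrib)

text \<open>Given that \<open>S\<close> is included, homogeneity makes the indicators outside
  \<open>S\<close> sum to a constant, and a constant has zero covariance with anything.\<close>

lemma pair_cov_sum:
  assumes S: "S \<subseteq> {..<n}" "0 < incl \<mu> S"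
  shows "(\<Sum>j\<in>{..<n} - S. pair_cov \<mu> S i j) = 0"
proof -
  have "(\<Sum>j\<in>{..<n} - S. pair_cov \<mu> S i j)
      = (\<Sum>j\<in>{..<n} - S. incl \<mu> (insert j (insert i S))) / incl \<mu> S
        - cond_prob \<mu> i S * (\<Sum>j\<in>{..<n} - S. cond_prob \<mu> j S)"
    by (simp add: pair_cov_def insert_commute sum_subtractf sum_distrib_left sum_divide_distrib)
  also have "\<dots> = 0"
    using sum_incl[of S "insert i S"] S sum_cond_prob[OF S]
    by (simp add: subset_insertI cond_prob_eq_incl)
  finally show ?thesis .
qed

lemma pair_cov_abs_sum:
  assumes ind: "one_sided_linf_independent n \<mu> D"
    and S: "S \<subseteq> {..<n}" "0 < incl \<mu> S" and i: "i \<in> {..<n} - S"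
  shows "(\<Sum>j\<in>{..<n} - S. \<bar>pair_cov \<mu> S i j\<bar>) \<le> cond_prob \<mu> i S * D"
proof (cases "incl \<mu> (insert i S) > 0")
  case True
  then have "(\<Sum>j\<in>{..<n} - S. \<bar>cond_prob \<mu> j (insert i S) - cond_prob \<mu> j S\<bar>) \<le> D"
    by (rule one_sided_linf_independent_incl[OF ind S(1) i])
  then have "cond_prob \<mu> i S * (\<Sum>j\<in>{..<n} - S. \<bar>cond_prob \<mu> j (insert i S) - cond_prob \<mu> j S\<bar>)
      \<le> cond_prob \<mu> i S * D"
    by (intro mult_left_mono cond_prob_nonneg)
  then show ?thesis
    by (simp add: pair_cov_eq[OF S(2)] abs_mult sum_distrib_left cond_prob_nonneg)
next
  case False
  then have "incl \<mu> (insert i S) = 0" by (simp only: incl_eq_0_iff) simp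
  then have "cond_prob \<mu> i S = 0" by (simp add: cond_prob_eq_incl)
  then show ?thesis by (simp add: pair_cov_eq[OF S(2)])
qed

end

section \<open>The sampling potential\<close>

context trace_algebra
begin

text \<open>Determined by \<open>B\<close> alone, so that the potential is a function of the
  revealed set although factor pairs are not unique.\<close>

definition two_sided_inverse :: "'a \<Rightarrow> 'a" where
  "two_sided_inverse B = (THE A. A * B = 1 \<and> B * A = 1)"

lemma two_sided_inverse_eq:
  assumes "factor_pair B V W"
  shows "two_sided_inverse B = V * adj V"
  unfolding two_sided_inverse_def
proof (rule the_equality)
  show "V * adj V * B = 1 \<and> B * (V * adj V) = 1" using factor_pair_inverse[OF assms] by blast
  fix A assume "A * B = 1 \<and> B * A = 1"
  then show "A = V * adj V"
    using factor_pair_inverse[OF assms] by (metis mult.assoc mult_1 mult_1_right)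
qed

lemma adj_sandwich_nonneg: "0 \<le> tr (adj x * (z * adj z) * x)"
  using nsq_nonneg[of "adj z * x"] by (simp add: nsq_def adj_simps mult.assoc)

lemma tr_one_plus_sum:
  "tr (adj x * (1 + (\<Sum>j\<in>J. w j *\<^sub>R y j)) * x) = nsq x + (\<Sum>j\<in>J. w j * tr (adj x * y j * x))"
  by (simp add: nsq_def distrib_left distrib_right sum_distrib_left sum_distrib_right tr_simps)

lemma one_plus_sum_ge:
  assumes "\<And>j. j \<in> J \<Longrightarrow> 0 \<le> w j"
  shows "nsq x \<le> tr (adj x * (1 + (\<Sum>j\<in>J. w j *\<^sub>R (z j * adj (z j)))) * x)"
proof -
  have "0 \<le> (\<Sum>j\<in>J. w j * tr (adj x * (z j * adj (z j)) * x))"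
    using assms by (intro sum_nonneg mult_nonneg_nonneg adj_sandwich_nonneg)
  then show ?thesis by (simp add: tr_one_plus_sum)
qed

text \<open>The potential after revealing \<open>S\<close>: the expectation of the sum over the elements not yet
  revealed is damped by \<open>1 - \<alpha>\<close>, and the drift gained when an element gets revealed
  pays for the second-order term of the perturbation bound.\<close>
definition partial_sum :: "nat \<Rightarrow> nat set pmf \<Rightarrow> real \<Rightarrow> (nat \<Rightarrow> 'a) \<Rightarrow> nat set \<Rightarrow> 'a" where
  "partial_sum n \<mu> \<alpha> z S =
     1 + (\<Sum>j<n. (if j \<in> S then 1 else (1 - \<alpha>) * cond_prob \<mu> j S) *\<^sub>R (z j * adj (z j)))"

definition potential :: "nat \<Rightarrow> nat set pmf \<Rightarrow> real \<Rightarrow> (nat \<Rightarrow> 'a) \<Rightarrow> nat \<Rightarrow> nat set \<Rightarrow> real" where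
  "potential n \<mu> \<alpha> z q S = tr (two_sided_inverse (partial_sum n \<mu> \<alpha> z S) ^ q)"

lemma partial_sum_factor_pair:
  assumes "\<And>j. j < n \<Longrightarrow> rank_one (z j)" "\<alpha> \<le> 1"
  shows "\<exists>V W. factor_pair (partial_sum n \<mu> \<alpha> z S) V W"
  unfolding partial_sum_def
  using assms by (intro factor_pair_sum_rank_one) (auto simp: cond_prob_eq_incl incl_nonneg)

text \<open>The left side averages over the next revealed index. Covariances sum to zero, so the
  drift is only the lifting of the damping at the revealed index. In the increment bound,
  \<open>D\<close> comes from independence and the extra 1 from that index.\<close>

lemma potential_step:
  fixes j :: nat
  assumes hom: "k_homogeneous n k \<mu>" and ind: "one_sided_linf_independent n \<mu> D" and D: "0 \<le> D"
    and z: "\<And>j. j < n \<Longrightarrow> rank_one (z j)" and \<alpha>: "0 \<le> \<alpha>" "\<alpha> \<le> 1"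
    and S: "S \<subseteq> {..<n}" "0 < incl \<mu> S" "card S < k"
    and R: "0 < R"
    and zR: "\<And>j. j \<in> {..<n} - S \<Longrightarrow> (z j * adj (z j)) * (z j * adj (z j)) = R *\<^sub>R (z j * adj (z j))"
    and small: "real (2 ^ Suc j) * ((D + 1) * R) \<le> 1 / 2" "2 * real (2 ^ Suc j) * (D + 1)\<^sup>2 * R \<le> \<alpha>"
  shows "(\<Sum>i\<in>{i \<in> {..<n} - S. 0 < incl \<mu> (insert i S)}.
            cond_prob \<mu> i S / (real k - real (card S)) * potential n \<mu> \<alpha> z (2 ^ Suc j) (insert i S))
         \<le> potential n \<mu> \<alpha> z (2 ^ Suc j) S"
proof -
  define N where "N = {..<n} - S"
  define I where "I = {i \<in> N. 0 < incl \<mu> (insert i S)}"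
  define m where "m = real k - real (card S)"
  define \<pi> where "\<pi> i = cond_prob \<mu> i S" for i
  define Y where "Y i = z i * adj (z i)" for i
  \<comment> \<open>Change of the coefficient of \<open>l\<close> when \<open>i\<close> is revealed.
    At \<open>l = i\<close> the new coefficient 1 is split as 1 - \<alpha> times the new conditional
    probability 1, plus \<alpha>.\<close>
  define a where "a i l = (1 - \<alpha>) * (cond_prob \<mu> l (insert i S) - \<pi> l) + (if l = i then \<alpha> else 0)" for i l
  let ?B = "partial_sum n \<mu> \<alpha> z"
  have m: "0 < m" using S(3) by (simp add: m_def)
  have finN: "finite N" "finite I" by (simp_all add: N_def I_def)
  have \<pi>0: "0 \<le> \<pi> i" for i by (simp add: \<pi>_def cond_prob_nonneg)
  have \<pi>I: "\<pi> i = 0" if "i \<in> N" "i \<notin> I" for i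
  proof -
    have "incl \<mu> (insert i S) = 0" unfolding incl_eq_0_iff using that by (simp add: I_def)
    then show ?thesis by (simp add: \<pi>_def cond_prob_eq_incl)
  qed
  have sum\<pi>: "(\<Sum>i\<in>I. \<pi> i) = m"
  proof -
    have "(\<Sum>i\<in>I. \<pi> i) = (\<Sum>i\<in>N. \<pi> i)"
      by (rule sum.mono_neutral_left) (use finN \<pi>I in \<open>auto simp: I_def\<close>)
    then show ?thesis using sum_cond_prob[OF hom S(1,2)] by (simp add: N_def \<pi>_def m_def)
  qed
  have "\<forall>T. \<exists>V W. factor_pair (?B T) V W"
    by (intro allI partial_sum_factor_pair z \<alpha>)
  then obtain V W where VW: "factor_pair (?B T) (V T) (W T)" for T
    by metis
  have pot: "potential n \<mu> \<alpha> z q T = tr ((V T * adj (V T)) ^ q)" for q T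
    by (simp add: potential_def two_sided_inverse_eq[OF VW])
  have upd: "?B (insert i S) = ?B S + (\<Sum>l\<in>N. a i l *\<^sub>R Y l)" if i: "i \<in> I" for i
  proof -
    define c where "c T j = (if j \<in> T then 1 else (1 - \<alpha>) * cond_prob \<mu> j T)" for T j
    have "c (insert i S) l - c S l = (if l \<in> N then a i l else 0)" if "l < n" for l
    proof (cases "l \<in> S")
      case True
      then show ?thesis by (simp add: c_def N_def)
    next
      case False
      have "cond_prob \<mu> i (insert i S) = 1" using i by (simp add: I_def cond_prob_eq_incl)
      then show ?thesis using False that by (auto simp: c_def a_def N_def \<pi>_def algebra_simps)
    qed
    then have "(\<Sum>l<n. (c (insert i S) l - c S l) *\<^sub>R Y l) = (\<Sum>l<n. (if l \<in> N then a i l else 0) *\<^sub>R Y l)"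
      by (intro sum.cong) auto
    also have "\<dots> = (\<Sum>l\<in>N. a i l *\<^sub>R Y l)"
      by (rule sum.mono_neutral_cong_right) (auto simp: N_def)
    finally have "(\<Sum>l<n. c (insert i S) l *\<^sub>R Y l) = (\<Sum>l<n. c S l *\<^sub>R Y l) + (\<Sum>l\<in>N. a i l *\<^sub>R Y l)"
      unfolding scaleR_diff_left sum_subtractf by (simp only: diff_eq_eq add.commute)
    moreover have "?B T = 1 + (\<Sum>l<n. c T l *\<^sub>R Y l)" for T
      by (simp add: partial_sum_def c_def Y_def)
    ultimately show ?thesis by (simp add: add.assoc)
  qed
  have cov: "\<pi> i * (cond_prob \<mu> l (insert i S) - \<pi> l) = pair_cov \<mu> S i l" for i l
    using pair_cov_eq[OF S(2)] by (simp add: \<pi>_def)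
  have cov0: "pair_cov \<mu> S i l = 0" if "i \<in> N" "i \<notin> I" for i l
    using cov[of i l] \<pi>I[OF that] by simp
  \<comment> \<open>Symmetry turns a sum over the revealed index into a sum over the second index,
    which the hypotheses control. Indices outside \<open>I\<close> have covariance 0.\<close>
  have cov_sumI: "(\<Sum>i\<in>I. g (pair_cov \<mu> S i l)) = (\<Sum>i\<in>N. g (pair_cov \<mu> S l i))"
    if "g 0 = 0" for l and g :: "real \<Rightarrow> real"
    by (rule sum.mono_neutral_cong_left)
       (use finN cov0 that in \<open>auto simp: I_def pair_cov_sym[of \<mu> S l]\<close>)
  have \<pi>if: "(\<Sum>i\<in>I. \<pi> i * (if l = i then \<alpha> else 0)) = \<alpha> * \<pi> l" if "l \<in> N" for l
    using finN \<pi>I[OF that] by (auto simp: if_distrib[of "(*) _"] sum.delta' mult.commute cong: if_cong)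
  have "(\<Sum>i\<in>I. \<pi> i / m * tr ((V (insert i S) * adj (V (insert i S))) ^ 2 ^ Suc j))
      \<le> tr ((V S * adj (V S)) ^ 2 ^ Suc j)"
  proof (rule tr_inverse_power_average[where J = N and Y = Y and R = R and \<delta> = "D + 1" and a = a
        and \<alpha> = \<alpha> and f = "\<lambda>l. \<pi> l / m"])
    show "factor_pair (?B S) (V S) (W S)" by (rule VW)
    show "nsq x \<le> tr (adj x * ?B S * x)" for x
      unfolding partial_sum_def by (rule one_plus_sum_ge) (use \<alpha> in \<open>auto simp: cond_prob_eq_incl incl_nonneg\<close>)
    show "factor_pair (?B S + (\<Sum>l\<in>N. a i l *\<^sub>R Y l)) (V (insert i S)) (W (insert i S))" if "i \<in> I" for i
      using VW[of "insert i S"] upd[OF that] by simp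
    show "adj (Y l) = Y l" for l by (simp add: Y_def adj_simps)
    show "Y l * Y l = R *\<^sub>R Y l" if "l \<in> N" for l using zR that by (simp add: Y_def N_def)
    show "(\<Sum>l\<in>N. \<bar>a i l\<bar>) \<le> D + 1" if i: "i \<in> I" for i
    proof -
      have "(\<Sum>l\<in>N. \<bar>a i l\<bar>) \<le> (\<Sum>l\<in>N. \<bar>cond_prob \<mu> l (insert i S) - \<pi> l\<bar> + (if l = i then 1 else 0))"
      proof (rule sum_mono)
        fix l
        have "(1 - \<alpha>) * \<bar>cond_prob \<mu> l (insert i S) - \<pi> l\<bar> \<le> \<bar>cond_prob \<mu> l (insert i S) - \<pi> l\<bar>"
          using \<alpha> by (simp add: mult_left_le_one_le)
        then show "\<bar>a i l\<bar> \<le> \<bar>cond_prob \<mu> l (insert i S) - \<pi> l\<bar> + (if l = i then 1 else 0)"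
          unfolding a_def using \<alpha> by (intro order_trans[OF abs_triangle_ineq]) (auto simp: abs_mult)
      qed
      also have "\<dots> \<le> D + 1"
      proof -
        have "(\<Sum>l\<in>N. \<bar>cond_prob \<mu> l (insert i S) - \<pi> l\<bar>) \<le> D"
          using one_sided_linf_independent_incl[OF ind S(1)] i by (simp add: N_def I_def \<pi>_def)
        then show ?thesis using i finN by (simp add: sum.distrib I_def)
      qed
      finally show ?thesis .
    qed
    show "(\<Sum>i\<in>I. \<pi> i / m) = 1" using sum\<pi> m by (simp flip: sum_divide_distrib)
    show "(\<Sum>i\<in>I. \<pi> i / m * a i l) = \<alpha> * (\<pi> l / m)" if l: "l \<in> N" for l
    proof -
      have "(\<Sum>i\<in>I. \<pi> i * a i l) = (\<Sum>i\<in>I. (1 - \<alpha>) * pair_cov \<mu> S i l + \<pi> i * (if l = i then \<alpha> else 0))"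
        by (simp add: a_def cov[symmetric] algebra_simps)
      also have "\<dots> = (1 - \<alpha>) * (\<Sum>i\<in>N. pair_cov \<mu> S l i) + \<alpha> * \<pi> l"
        using cov_sumI[of id l] by (simp add: sum.distrib \<pi>if l flip: sum_distrib_left)
      also have "\<dots> = \<alpha> * \<pi> l" using pair_cov_sum[OF hom S(1,2)] by (simp add: N_def)
      finally show ?thesis by (simp flip: sum_divide_distrib)
    qed
    show "(\<Sum>i\<in>I. \<pi> i / m * \<bar>a i l\<bar>) \<le> (D + 1) * (\<pi> l / m)" if l: "l \<in> N" for l
    proof -
      have "(\<Sum>i\<in>I. \<pi> i * \<bar>a i l\<bar>) \<le> (\<Sum>i\<in>I. \<bar>pair_cov \<mu> S i l\<bar> + \<pi> i * (if l = i then \<alpha> else 0))"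
      proof (rule sum_mono)
        fix i
        have "\<pi> i * \<bar>a i l\<bar> = \<bar>\<pi> i * a i l\<bar>" using \<pi>0 by (simp add: abs_mult)
        also have "\<pi> i * a i l = (1 - \<alpha>) * pair_cov \<mu> S i l + \<pi> i * (if l = i then \<alpha> else 0)"
          by (simp add: a_def cov[symmetric] algebra_simps)
        also have "\<bar>\<dots>\<bar> \<le> \<bar>pair_cov \<mu> S i l\<bar> + \<pi> i * (if l = i then \<alpha> else 0)"
          using \<alpha> \<pi>0 by (intro order_trans[OF abs_triangle_ineq] add_mono)
            (auto simp: abs_mult mult_left_le_one_le)
        finally show "\<pi> i * \<bar>a i l\<bar> \<le> \<bar>pair_cov \<mu> S i l\<bar> + \<pi> i * (if l = i then \<alpha> else 0)" .
      qed
      also have "\<dots> = (\<Sum>i\<in>N. \<bar>pair_cov \<mu> S l i\<bar>) + \<alpha> * \<pi> l"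
        using cov_sumI[of abs l] by (simp add: sum.distrib \<pi>if l)
      also have "\<dots> \<le> \<pi> l * D + 1 * \<pi> l"
        using pair_cov_abs_sum[OF hom ind S(1,2)] l \<alpha> \<pi>0
        by (intro add_mono mult_right_mono) (auto simp: N_def \<pi>_def)
      finally have "(\<Sum>i\<in>I. \<pi> i * \<bar>a i l\<bar>) / m \<le> (D + 1) * \<pi> l / m"
        using m by (intro divide_right_mono) (auto simp: algebra_simps)
      then show ?thesis by (simp add: sum_divide_distrib)
    qed
  qed (use m \<pi>0 R D small in auto)
  then show ?thesis unfolding pot by (simp add: I_def N_def m_def \<pi>_def)
qed

text \<open>The random order is never constructed: averaging over the next index is the double count
  of \<open>sum_extensions\<close>. Induction on the number of missing indices then replaces the
  tower property.\<close>

lemma potential_supermartingale: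
  fixes j :: nat
  assumes hom: "k_homogeneous n k \<mu>" and ind: "one_sided_linf_independent n \<mu> D" and D: "0 \<le> D"
    and z: "\<And>j. j < n \<Longrightarrow> rank_one (z j)" and \<alpha>: "0 \<le> \<alpha>" "\<alpha> \<le> 1" and R: "0 < R"
    and zR: "\<And>j. j \<in> {..<n} - H \<Longrightarrow> (z j * adj (z j)) * (z j * adj (z j)) = R *\<^sub>R (z j * adj (z j))"
    and small: "real (2 ^ Suc j) * ((D + 1) * R) \<le> 1 / 2" "2 * real (2 ^ Suc j) * (D + 1)\<^sup>2 * R \<le> \<alpha>"
    and S: "H \<subseteq> S" "S \<subseteq> {..<n}" "0 < incl \<mu> S"
  shows "(\<Sum>X\<in>Pow {..<n}. of_bool (S \<subseteq> X) * (pmf \<mu> X * potential n \<mu> \<alpha> z (2 ^ Suc j) X))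
         \<le> incl \<mu> S * potential n \<mu> \<alpha> z (2 ^ Suc j) S"
  using S
proof (induction "k - card S" arbitrary: S rule: less_induct)
  case less
  let ?\<Phi> = "potential n \<mu> \<alpha> z (2 ^ Suc j)"
  have finS: "finite S" using less.prems finite_subset by blast
  show ?case
  proof (cases "card S < k")
    \<comment> \<open>Nothing is missing: a realization containing \<open>S\<close> equals
      \<open>S\<close>.\<close>
    case False
    have "X = S" if "X \<in> set_pmf \<mu>" "S \<subseteq> X" for X
    proof -
      have "X \<subseteq> {..<n}" "card X = k" using hom that by (auto simp: k_homogeneous_def)
      then show ?thesis using False that card_seteq[of X S] finite_subset by fastforce
    qed
    then have "of_bool (S \<subseteq> X) * (pmf \<mu> X * ?\<Phi> X) = of_bool (S \<subseteq> X) * pmf \<mu> X * ?\<Phi> S" for X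
      by (cases "X \<in> set_pmf \<mu>") (auto simp: set_pmf_eq)
    then show ?thesis by (simp only: incl_eq_sum[OF hom] order_refl flip: sum_distrib_right)
  next
    case True
    define m where "m = real k - real (card S)"
    have m: "0 < m" using True by (simp add: m_def)
    define I where "I = {i \<in> {..<n} - S. 0 < incl \<mu> (insert i S)}"
    define g where "g i = (\<Sum>X\<in>Pow {..<n}. of_bool (insert i S \<subseteq> X) * (pmf \<mu> X * ?\<Phi> X))" for i
    \<comment> \<open>Extensions of probability zero carry no mass, so the sum shrinks to
      \<open>I\<close>, where the induction hypothesis applies.\<close>
    have g0: "g i = 0" if i: "i \<in> {..<n} - S" "i \<notin> I" for i
    proof -
      have "(\<Sum>X\<in>Pow {..<n}. of_bool (insert i S \<subseteq> X) * pmf \<mu> X) = 0"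
        using i by (simp only: I_def incl_eq_0_iff mem_Collect_eq simp_thms flip: incl_eq_sum[OF hom])
      then have "of_bool (insert i S \<subseteq> X) * pmf \<mu> X = 0" if "X \<in> Pow {..<n}" for X
        using that by (subst (asm) sum_nonneg_eq_0_iff) auto
      then show ?thesis unfolding g_def by (intro sum.neutral) auto
    qed
    have "m * (\<Sum>X\<in>Pow {..<n}. of_bool (S \<subseteq> X) * (pmf \<mu> X * ?\<Phi> X)) = (\<Sum>i\<in>{..<n} - S. g i)"
      unfolding g_def m_def by (rule sum_extensions[OF hom order_refl less.prems(2), symmetric])
    also have "\<dots> = (\<Sum>i\<in>I. g i)"
      by (rule sum.mono_neutral_right) (use g0 in \<open>auto simp: I_def\<close>)
    also have "\<dots> \<le> (\<Sum>i\<in>I. incl \<mu> (insert i S) * ?\<Phi> (insert i S))"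
    proof (rule sum_mono)
      fix i assume i: "i \<in> I"
      then have "card (insert i S) = Suc (card S)" using finS by (simp add: I_def)
      then show "g i \<le> incl \<mu> (insert i S) * ?\<Phi> (insert i S)"
        unfolding g_def using i less.prems True by (intro less.hyps) (auto simp: I_def)
    qed
    also have "\<dots> = m * incl \<mu> S * (\<Sum>i\<in>I. cond_prob \<mu> i S / m * ?\<Phi> (insert i S))"
      using m less.prems(3) by (simp add: sum_distrib_left cond_prob_eq_incl)
    also have "\<dots> \<le> m * incl \<mu> S * ?\<Phi> S"
      unfolding I_def m_def using less.prems True m
      by (intro mult_left_mono potential_step[OF hom ind D z \<alpha> _ _ _ R zR small]) (auto simp: m_def)
    finally show ?thesis using m by (simp add: mult.assoc)
  qed
qed

end

section \<open>Matrices of all sizes as one algebra\<close>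

text \<open>Families with one \<open>m \<times> m\<close> matrix for every \<open>m\<close> form a ring with unit, so that no
  dimension has to be carried along; only the trace selects a size.\<close>
typedef matrix_family =
  "{X :: nat \<Rightarrow> nat \<Rightarrow> nat \<Rightarrow> real. \<forall>m i j. \<not> (i < m \<and> j < m) \<longrightarrow> X m i j = 0}"
  morphisms entry Abs_matrix_family
  by (rule exI[of _ "\<lambda>_ _ _. 0"]) simp

setup_lifting type_definition_matrix_family

lemma matrix_family_eqI: "(\<And>m i j. i < m \<Longrightarrow> j < m \<Longrightarrow> entry X m i j = entry Y m i j) \<Longrightarrow> X = Y"
  by transfer (metis ext)

instantiation matrix_family :: real_algebra_1
begin

lift_definition zero_matrix_family :: matrix_family is "\<lambda>_ _ _. 0" by simp
lift_definition one_matrix_family :: matrix_family is "\<lambda>m i j. if i < m \<and> i = j then 1 else 0" by auto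
lift_definition plus_matrix_family :: "matrix_family \<Rightarrow> matrix_family \<Rightarrow> matrix_family"
  is "\<lambda>X Y m i j. X m i j + Y m i j" by simp
lift_definition minus_matrix_family :: "matrix_family \<Rightarrow> matrix_family \<Rightarrow> matrix_family"
  is "\<lambda>X Y m i j. X m i j - Y m i j" by simp
lift_definition uminus_matrix_family :: "matrix_family \<Rightarrow> matrix_family"
  is "\<lambda>X m i j. - X m i j" by simp
lift_definition times_matrix_family :: "matrix_family \<Rightarrow> matrix_family \<Rightarrow> matrix_family"
  is "\<lambda>X Y m i j. \<Sum>l<m. X m i l * Y m l j" by (auto intro!: sum.neutral)
lift_definition scaleR_matrix_family :: "real \<Rightarrow> matrix_family \<Rightarrow> matrix_family"
  is "\<lambda>a X m i j. a * X m i j" by simp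

lemmas entry_simps =
  zero_matrix_family.rep_eq one_matrix_family.rep_eq plus_matrix_family.rep_eq
  minus_matrix_family.rep_eq uminus_matrix_family.rep_eq times_matrix_family.rep_eq
  scaleR_matrix_family.rep_eq

instance
proof
  fix a b :: real and X Y Z :: matrix_family
  show "X + Y + Z = X + (Y + Z)" "X + Y = Y + X" "0 + X = X" "- X + X = 0" "X - Y = X + - Y"
    "a *\<^sub>R (X + Y) = a *\<^sub>R X + a *\<^sub>R Y" "(a + b) *\<^sub>R X = a *\<^sub>R X + b *\<^sub>R X"
    "a *\<^sub>R b *\<^sub>R X = (a * b) *\<^sub>R X" "1 *\<^sub>R X = X"
    by (rule matrix_family_eqI; simp add: entry_simps algebra_simps)+
  show "X * Y * Z = X * (Y * Z)"
  proof (rule matrix_family_eqI)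
    fix m i j
    have "(\<Sum>l<m. \<Sum>k<m. entry X m i k * (entry Y m k l * entry Z m l j))
        = (\<Sum>k<m. \<Sum>l<m. entry X m i k * (entry Y m k l * entry Z m l j))"
      by (rule sum.swap)
    then show "entry (X * Y * Z) m i j = entry (X * (Y * Z)) m i j"
      by (simp add: entry_simps sum_distrib_left sum_distrib_right mult.assoc)
  qed
  show "(X + Y) * Z = X * Z + Y * Z" "X * (Y + Z) = X * Y + X * Z"
    "a *\<^sub>R X * Y = a *\<^sub>R (X * Y)" "X * a *\<^sub>R Y = a *\<^sub>R (X * Y)"
    by (rule matrix_family_eqI; simp add: entry_simps algebra_simps sum.distrib sum_distrib_left)+
  show "1 * X = X" "X * 1 = X"
    by (rule matrix_family_eqI;
        simp add: entry_simps if_distrib[of "\<lambda>x. x * _"] if_distrib[of "\<lambda>x. _ * x"] cong: if_cong conj_cong)+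
  \<comment> \<open>Size 1 is always present, so zero and the unit differ even if the trace later
    selects size 0.\<close>
  have "entry (0::matrix_family) 1 0 0 \<noteq> entry 1 1 0 0" by (simp add: entry_simps)
  then show "(0::matrix_family) \<noteq> 1" by metis
qed

end

lift_definition mtranspose :: "matrix_family \<Rightarrow> matrix_family" is "\<lambda>X m i j. X m j i" by blast

definition mtrace :: "nat \<Rightarrow> matrix_family \<Rightarrow> real" where
  "mtrace r X = (\<Sum>i<r. entry X r i i)"

text \<open>The vector is the first column at size \<open>r\<close>, and every other size carries
  zero, so that rank-one identities hold as equations of whole families.\<close>

lift_definition column_family :: "nat \<Rightarrow> (nat \<Rightarrow> real) \<Rightarrow> matrix_family" is
  "\<lambda>r v m i j. if m = r \<and> i < r \<and> j = 0 then v i else 0" by auto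

interpretation mf: trace_algebra "mtrace r" mtranspose for r
proof
  fix X Y :: matrix_family and a :: real
  show "mtrace r (X + Y) = mtrace r X + mtrace r Y" "mtrace r (a *\<^sub>R X) = a * mtrace r X"
    by (simp_all add: mtrace_def entry_simps sum.distrib sum_distrib_left)
  have "(\<Sum>i<r. \<Sum>l<r. entry X r i l * entry Y r l i) = (\<Sum>l<r. \<Sum>i<r. entry X r i l * entry Y r l i)"
    by (rule sum.swap)
  then show "mtrace r (X * Y) = mtrace r (Y * X)"
    by (simp add: mtrace_def entry_simps mult.commute)
  show "mtranspose (X + Y) = mtranspose X + mtranspose Y" "mtranspose (a *\<^sub>R X) = a *\<^sub>R mtranspose X"
    "mtranspose (X * Y) = mtranspose Y * mtranspose X" "mtranspose (mtranspose X) = X"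
    by (rule matrix_family_eqI; simp add: entry_simps mtranspose.rep_eq mult.commute)+
  show "mtrace r (mtranspose X) = mtrace r X" by (simp add: mtrace_def mtranspose.rep_eq)
  show "0 \<le> mtrace r (mtranspose X * X)"
    by (simp add: mtrace_def mtranspose.rep_eq entry_simps sum_nonneg)
qed

lemma nsq_entries: "mf.nsq r X = (\<Sum>i<r. \<Sum>l<r. (entry X r l i)\<^sup>2)"
  by (simp add: mf.nsq_def mtrace_def mtranspose.rep_eq entry_simps power2_eq_square)

lemma mtrace_one: "mtrace r 1 = real r"
  by (simp add: mtrace_def entry_simps)

lemma entry_column_outer:
  "entry (column_family r v * mtranspose (column_family r v)) m i j = (if m = r \<and> i < r \<and> j < r then v i * v j else 0)"
proof -
  have "(\<Sum>l<r. (if l = 0 then v i else 0) * (if l = 0 then v j else 0)) = (if r = 0 then 0 else v i * v j)"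
    by (auto simp: if_distrib[of "\<lambda>x. x * _"] cong: if_cong)
  then show ?thesis
    by (auto simp: entry_simps mtranspose.rep_eq column_family.rep_eq)
qed

lemma mtrace_column_outer:
  "mtrace r (X * (column_family r v * mtranspose (column_family r v))) = (\<Sum>i<r. \<Sum>l<r. v i * entry X r i l * v l)"
  by (simp add: mtrace_def times_matrix_family.rep_eq[of X] entry_column_outer mult_ac)

lemma mtrace_column_sandwich:
  "mtrace r (mtranspose (column_family r v) * X * column_family r v) = (\<Sum>i<r. \<Sum>l<r. v i * entry X r i l * v l)"
  using mf.tr_assoc3[of r "mtranspose (column_family r v)" X "column_family r v"]
  by (simp add: mult.assoc mtrace_column_outer)

lemma rank_one_column: "mf.rank_one r (column_family r v)"
  unfolding mf.rank_one_def
proof (intro allI matrix_family_eqI)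
  fix X and m i j :: nat assume ij: "i < m" "j < m"
  define P where "P = column_family r v * mtranspose (column_family r v)"
  have P: "entry P m i j = (if m = r \<and> i < r \<and> j < r then v i * v j else 0)" for m i j
    unfolding P_def by (rule entry_column_outer)
  have "entry (P * X * P) m i j = (\<Sum>k<r. \<Sum>l<r. v k * entry X r k l * v l) * entry P m i j"
  proof (cases "m = r")
    case True
    have "entry (P * X * P) r i j = (\<Sum>k<r. \<Sum>l<r. (v k * entry X r k l * v l) * (v i * v j))"
      using ij True unfolding mult.assoc[of P X P]
      by (simp add: entry_simps P sum_distrib_left mult_ac)
    then show ?thesis using True ij by (simp add: P sum_distrib_right)
  next
    case False
    then show ?thesis by (simp add: entry_simps P)
  qed
  then show "entry (column_family r v * mtranspose (column_family r v) * X * column_family r v * mtranspose (column_family r v)) m i j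
    = entry (mtrace r (mtranspose (column_family r v) * X * column_family r v) *\<^sub>R (column_family r v * mtranspose (column_family r v))) m i j"
    unfolding mtrace_column_sandwich scaleR_matrix_family.rep_eq P_def by (simp add: mult.assoc)
qed

lemma column_outer_square:
  "(column_family r v * mtranspose (column_family r v)) * (column_family r v * mtranspose (column_family r v))
     = (\<Sum>i<r. (v i)\<^sup>2) *\<^sub>R (column_family r v * mtranspose (column_family r v))"
proof (rule matrix_family_eqI)
  fix m i j :: nat
  define P where "P = column_family r v * mtranspose (column_family r v)"
  have P: "entry P m i j = (if m = r \<and> i < r \<and> j < r then v i * v j else 0)" for m i j
    unfolding P_def by (rule entry_column_outer)
  have "entry (P * P) m i j = entry ((\<Sum>i<r. (v i)\<^sup>2) *\<^sub>R P) m i j"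
    by (auto simp: entry_simps P sum_distrib_right sum_distrib_left power2_eq_square mult_ac)
  then show "entry ((column_family r v * mtranspose (column_family r v)) * (column_family r v * mtranspose (column_family r v))) m i j
    = entry ((\<Sum>i<r. (v i)\<^sup>2) *\<^sub>R (column_family r v * mtranspose (column_family r v))) m i j"
    by (simp add: P_def)
qed

lemma nsq_column: "mf.nsq r (column_family r v) = (\<Sum>i<r. (v i)\<^sup>2)"
proof -
  have "mf.nsq r (column_family r v) = mtrace r (mtranspose (column_family r v) * 1 * column_family r v)"
    by (simp add: mf.nsq_def)
  also have "\<dots> = (\<Sum>i<r. \<Sum>l<r. v i * (if i = l then 1 else 0) * v l)"
    unfolding mtrace_column_sandwich by (intro sum.cong refl) (simp add: entry_simps)
  also have "\<dots> = (\<Sum>i<r. (v i)\<^sup>2)"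
    by (simp add: if_distrib[of "\<lambda>x. _ * x"] if_distrib[of "\<lambda>x. x * _"] power2_eq_square cong: if_cong)
  finally show ?thesis .
qed

text \<open>Supplies the contraction required by \<open>tr_inverse_power_ge\<close>: the product has
  a single nonzero column, bounded row by row with Cauchy-Schwarz.\<close>

lemma nsq_mult_column_le:
  assumes "(\<Sum>i<r. (v i)\<^sup>2) \<le> 1"
  shows "mf.nsq r (X * column_family r v) \<le> mf.nsq r X"
proof -
  have e: "entry (X * column_family r v) r l i = (if i = 0 then (\<Sum>k<r. entry X r l k * v k) else 0)" for l i
    by (auto simp: entry_simps column_family.rep_eq intro!: sum.cong)
  \<comment> \<open>Not an equality, because the sum is empty for r = 0.\<close>
  have "(\<Sum>i<r. (if i = 0 then a else 0)\<^sup>2) \<le> a\<^sup>2" for a :: real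
    by (simp add: if_distrib[of "\<lambda>x. x\<^sup>2"] cong: if_cong)
  then have "(\<Sum>l<r. \<Sum>i<r. (entry (X * column_family r v) r l i)\<^sup>2) \<le> (\<Sum>l<r. (\<Sum>k<r. entry X r l k * v k)\<^sup>2)"
    unfolding e by (intro sum_mono)
  moreover have "mf.nsq r (X * column_family r v) = (\<Sum>l<r. \<Sum>i<r. (entry (X * column_family r v) r l i)\<^sup>2)"
    unfolding nsq_entries by (rule sum.swap)
  ultimately have "mf.nsq r (X * column_family r v) \<le> (\<Sum>l<r. (\<Sum>k<r. entry X r l k * v k)\<^sup>2)"
    by simp
  also have "\<dots> \<le> (\<Sum>l<r. (\<Sum>k<r. (entry X r l k)\<^sup>2) * (\<Sum>k<r. (v k)\<^sup>2))"
    by (intro sum_mono Cauchy_Schwarz_ineq_sum)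
  also have "\<dots> \<le> (\<Sum>l<r. (\<Sum>k<r. (entry X r l k)\<^sup>2) * 1)"
    using assms by (intro sum_mono mult_left_mono sum_nonneg) auto
  also have "\<dots> = mf.nsq r X" unfolding nsq_entries by (simp, rule sum.swap)
  finally show ?thesis .
qed

text \<open>Each column of \<open>X\<close> is tested separately against \<open>v\<close>, so
  estimates for vectors add up to estimates for the trace form.\<close>

lemma mtrace_sandwich_column_outer:
  "mtrace r (mtranspose X * (column_family r v * mtranspose (column_family r v)) * X)
     = (\<Sum>j<r. (\<Sum>l<r. v l * entry X r l j)\<^sup>2)"
proof -
  have "mtrace r (mtranspose X * (column_family r v * mtranspose (column_family r v)) * X)
     = (\<Sum>j<r. \<Sum>k<r. \<Sum>l<r. entry X r l j * (v l * v k) * entry X r k j)"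
    by (simp add: mtrace_def times_matrix_family.rep_eq[of _ X] mtranspose.rep_eq
        times_matrix_family.rep_eq[of "mtranspose X"] entry_column_outer sum_distrib_right)
  also have "\<dots> = (\<Sum>j<r. (\<Sum>l<r. v l * entry X r l j)\<^sup>2)"
    by (simp add: power2_eq_square sum_distrib_left sum_distrib_right mult_ac)
  finally show ?thesis .
qed

section \<open>Lower tail of the sampled Gram matrix\<close>

lemma isotropic_sum_squares:
  fixes u :: "nat \<Rightarrow> nat \<Rightarrow> real"
  assumes iso: "\<And>a b. a < r \<Longrightarrow> b < r \<Longrightarrow> (\<Sum>i<n. u i a * u i b) = (if a = b then 1 else 0)"
  shows "(\<Sum>i<n. (\<Sum>a<r. u i a * y a)\<^sup>2) = (\<Sum>a<r. (y a)\<^sup>2)"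
proof -
  have "(\<Sum>i<n. (\<Sum>a<r. u i a * y a)\<^sup>2) = (\<Sum>i<n. \<Sum>a<r. \<Sum>b<r. (u i a * u i b) * (y a * y b))"
    by (simp add: power2_eq_square sum_product mult_ac)
  also have "\<dots> = (\<Sum>a<r. \<Sum>i<n. \<Sum>b<r. (u i a * u i b) * (y a * y b))"
    by (rule sum.swap)
  also have "\<dots> = (\<Sum>a<r. \<Sum>b<r. \<Sum>i<n. (u i a * u i b) * (y a * y b))"
    by (intro sum.cong refl sum.swap)
  also have "\<dots> = (\<Sum>a<r. \<Sum>b<r. (if a = b then 1 else 0) * (y a * y b))"
    by (simp add: iso flip: sum_distrib_right)
  also have "\<dots> = (\<Sum>a<r. (y a)\<^sup>2)"
    by (simp add: if_distrib[of "\<lambda>x. x * _"] power2_eq_square cong: if_cong)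
  finally show ?thesis .
qed

text \<open>An index of marginal 0 has a zero row, so the default value of division by
  \<open>p i\<close> does no harm.\<close>

lemma truncated_square_sum_eq_0:
  fixes v :: "nat \<Rightarrow> real"
  assumes "min 1 (c * (\<Sum>a<r. (v a)\<^sup>2)) = 0" "0 < c" "a < r"
  shows "v a = 0"
proof -
  have "(\<Sum>a<r. (v a)\<^sup>2) = 0" using assms by (simp add: min_def split: if_splits)
  then show ?thesis using assms(3) by (simp add: sum_nonneg_eq_0_iff)
qed

lemma projection_residual_orthogonal:
  fixes u :: "nat \<Rightarrow> nat \<Rightarrow> real"
  assumes iso: "\<And>a b. a < r \<Longrightarrow> b < r \<Longrightarrow> (\<Sum>i<n. u i a * u i b) = (if a = b then 1 else 0)"
    and a: "a < r"
  shows "(\<Sum>i<n. u i a * ((\<Sum>c<r. u i c * (\<Sum>l<n. u l c * y l)) - y i)) = 0"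
proof -
  define g where "g c = (\<Sum>l<n. u l c * y l)" for c
  have "(\<Sum>i<n. u i a * (\<Sum>c<r. u i c * g c)) = (\<Sum>c<r. (\<Sum>i<n. u i a * u i c) * g c)"
    unfolding sum_distrib_left sum_distrib_right mult.assoc by (rule sum.swap)
  also have "\<dots> = (\<Sum>c<r. if a = c then g c else 0)" using iso a by (intro sum.cong) auto
  also have "\<dots> = g a" using a by simp
  finally show ?thesis by (simp add: g_def right_diff_distrib sum_subtractf)
qed

lemma incl_eq_1:
  assumes "\<And>i. i \<in> H \<Longrightarrow> incl \<mu> {i} = 1"
  shows "X \<in> set_pmf \<mu> \<Longrightarrow> H \<subseteq> X" and "incl \<mu> H = 1"
proof -
  have "i \<in> X" if "i \<in> H" "X \<in> set_pmf \<mu>" for i X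
    using assms[OF that(1)] that(2)
    by (simp add: incl_def measure_pmf.prob_eq_1 AE_measure_pmf_iff)
  then have sub: "H \<subseteq> X" if "X \<in> set_pmf \<mu>" for X using that by blast
  then show "X \<in> set_pmf \<mu> \<Longrightarrow> H \<subseteq> X" by blast
  show "incl \<mu> H = 1" using sub by (simp add: incl_def measure_pmf.prob_eq_1 AE_measure_pmf_iff)
qed

text \<open>Markov's inequality with damping 1/10: the initial potential is at most r (10/19)^q,
  while failure forces at least (2/3)^q. The factor 20 in the hypothesis on \<open>c\<close> makes 2
  q (D + 1)^2 / c at most 1/10.\<close>

theorem leverage_sampling_lower_tail:
  fixes u :: "nat \<Rightarrow> nat \<Rightarrow> real" and j :: nat
  defines "q \<equiv> 2 ^ Suc j"
  assumes hom: "k_homogeneous n k \<mu>" and ind: "one_sided_linf_independent n \<mu> D" and D: "0 \<le> D"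
    and iso: "\<And>a b. a < r \<Longrightarrow> b < r \<Longrightarrow> (\<Sum>i<n. u i a * u i b) = (if a = b then 1 else 0)"
    and p: "\<And>i. i < n \<Longrightarrow> p i = min 1 (c * (\<Sum>a<r. (u i a)\<^sup>2))" "\<And>i. i < n \<Longrightarrow> incl \<mu> {i} = p i"
    and c: "20 * real q * (D + 1)\<^sup>2 \<le> c" "0 < c"
  shows "measure_pmf.prob \<mu>
           {X. \<exists>x. (\<Sum>i\<in>X. (\<Sum>a<r. u i a * x a)\<^sup>2 / p i) < (\<Sum>a<r. (x a)\<^sup>2) / 2}
         \<le> real r * (15 / 19) ^ q"
proof -
  define bad where "bad = {X. \<exists>x. (\<Sum>i\<in>X. (\<Sum>a<r. u i a * x a)\<^sup>2 / p i) < (\<Sum>a<r. (x a)\<^sup>2) / 2}"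
  define H where "H = {i \<in> {..<n}. p i = 1}"
  define z where "z i = column_family r (\<lambda>a. u i a / sqrt (p i))" for i
  define Y where "Y i = z i * mtranspose (z i)" for i
  let ?\<Phi> = "mf.potential r n \<mu> (1 / 10) z q"
  have p0: "0 \<le> p i" if "i < n" for i using p(1)[OF that] c by (simp add: sum_nonneg)
  have pz: "u i a = 0" if "i < n" "a < r" "p i = 0" for i a
    by (rule truncated_square_sum_eq_0[of c "u i" r]) (use p(1)[OF that(1)] that c in auto)
  have z1: "mf.rank_one r (z i)" for i unfolding z_def by (rule rank_one_column)
  have Ysand: "mtrace r (mtranspose x * Y i * x) = (\<Sum>j<r. (\<Sum>a<r. u i a * entry x r a j)\<^sup>2) / p i"
    if "i < n" for i x
    unfolding Y_def z_def mtrace_sandwich_column_outer sum_divide_distrib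
    using p0[OF that] by (intro sum.cong refl) (simp add: power_divide flip: sum_divide_distrib)
  have Hinc: "incl \<mu> H = 1" "\<And>X. X \<in> set_pmf \<mu> \<Longrightarrow> H \<subseteq> X"
    using incl_eq_1[of H \<mu>] p(2) by (auto simp: H_def)
  have Hsub: "H \<subseteq> {..<n}" by (auto simp: H_def)
  have super: "(\<Sum>X\<in>Pow {..<n}. of_bool (H \<subseteq> X) * (pmf \<mu> X * ?\<Phi> X)) \<le> incl \<mu> H * ?\<Phi> H"
    unfolding q_def
  proof (rule mf.potential_supermartingale[OF hom ind D z1 _ _ _ _ _ _ order_refl Hsub, where R = "1 / c"])
    show "z i * mtranspose (z i) * (z i * mtranspose (z i)) = (1 / c) *\<^sub>R (z i * mtranspose (z i))"
      if i: "i \<in> {..<n} - H" for i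
    proof (cases "p i = 0")
      case True
      then have "z i = 0" using i unfolding z_def by (intro matrix_family_eqI) (simp add: column_family.rep_eq entry_simps)
      then show ?thesis by simp
    next
      case False
      have "i < n" "p i \<noteq> 1" using i by (auto simp: H_def)
      then have "p i = c * (\<Sum>a<r. (u i a)\<^sup>2)" using p(1) by (simp add: min_def split: if_splits)
      then have "(\<Sum>a<r. (u i a / sqrt (p i))\<^sup>2) = 1 / c"
        using False p0[OF \<open>i < n\<close>] c(2) by (simp add: power_divide flip: sum_divide_distrib)
      then show ?thesis using column_outer_square[of r "\<lambda>a. u i a / sqrt (p i)"] by (simp add: z_def)
    qed
    have "real q * (D + 1) \<le> 20 * real q * (D + 1)\<^sup>2 / 2"
    proof -
      have "D + 1 \<le> 10 * (D + 1)\<^sup>2" using D by (simp add: power2_eq_square algebra_simps)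
      then show ?thesis using mult_left_mono[of "D + 1" "10 * (D + 1)\<^sup>2" "real q"] by simp
    qed
    then show "real (2 ^ Suc j) * ((D + 1) * (1 / c)) \<le> 1 / 2"
      unfolding q_def[symmetric] using c by (simp add: field_simps)
    show "2 * real (2 ^ Suc j) * (D + 1)\<^sup>2 * (1 / c) \<le> 1 / 10"
      unfolding q_def[symmetric] using c by (simp add: field_simps)
  qed (use c Hinc in auto)
  have fp: "\<exists>V W. mf.factor_pair (mf.partial_sum n \<mu> (1 / 10) z S) V W" for S
    by (rule mf.partial_sum_factor_pair[where r = r]) (use z1 in auto)
  have condH: "cond_prob \<mu> i H = p i" if "i < n" for i
  proof -
    have "incl \<mu> (insert i H) = incl \<mu> {i}"
      unfolding incl_def by (rule measure_pmf.finite_measure_eq_AE) (use Hinc(2) in \<open>auto simp: AE_measure_pmf_iff\<close>)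
    then show ?thesis using p(2)[OF that] by (simp add: cond_prob_eq_incl Hinc)
  qed
  have start: "?\<Phi> H \<le> real r / (19 / 10) ^ q"
  proof -
    obtain V W where VW: "mf.factor_pair (mf.partial_sum n \<mu> (1 / 10) z H) V W" using fp by blast
    \<comment> \<open>Identity plus at least 9/10 of the full Gram matrix: an index of
      \<open>H\<close> has weight 1, and for any other index the weight 9/10 p_i cancels the scaling
      1 / p_i.\<close>
    have ge: "19 / 10 * mf.nsq r x \<le> mtrace r (mtranspose x * mf.partial_sum n \<mu> (1 / 10) z H * x)" for x
    proof -
      have "mtrace r (mtranspose x * mf.partial_sum n \<mu> (1 / 10) z H * x)
        = mf.nsq r x + (\<Sum>i<n. (if i \<in> H then 1 else (1 - 1 / 10) * cond_prob \<mu> i H) * mtrace r (mtranspose x * Y i * x))"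
        unfolding mf.partial_sum_def Y_def by (rule mf.tr_one_plus_sum)
      moreover have "(\<Sum>i<n. 9 / 10 * (\<Sum>j<r. (\<Sum>a<r. u i a * entry x r a j)\<^sup>2))
        \<le> (\<Sum>i<n. (if i \<in> H then 1 else (1 - 1 / 10) * cond_prob \<mu> i H) * mtrace r (mtranspose x * Y i * x))"
      proof (rule sum_mono)
        fix i assume "i \<in> {..<n}"
        then have i: "i < n" by simp
        have nn: "0 \<le> (\<Sum>j<r. (\<Sum>a<r. u i a * entry x r a j)\<^sup>2)" by (intro sum_nonneg) auto
        show "9 / 10 * (\<Sum>j<r. (\<Sum>a<r. u i a * entry x r a j)\<^sup>2)
          \<le> (if i \<in> H then 1 else (1 - 1 / 10) * cond_prob \<mu> i H) * mtrace r (mtranspose x * Y i * x)"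
        proof (cases "p i = 0")
          case True
          then show ?thesis using i pz by (simp add: Ysand)
        next
          case False
          moreover have "i \<in> H \<longleftrightarrow> p i = 1" using i by (simp add: H_def)
          ultimately show ?thesis using i nn by (auto simp: Ysand condH)
        qed
      qed
      moreover have "(\<Sum>i<n. 9 / 10 * (\<Sum>j<r. (\<Sum>a<r. u i a * entry x r a j)\<^sup>2)) = 9 / 10 * mf.nsq r x"
      proof -
        have "(\<Sum>i<n. \<Sum>j<r. (\<Sum>a<r. u i a * entry x r a j)\<^sup>2) = (\<Sum>j<r. \<Sum>i<n. (\<Sum>a<r. u i a * entry x r a j)\<^sup>2)"
          by (rule sum.swap)
        also have "\<dots> = mf.nsq r x" by (simp add: isotropic_sum_squares[OF iso] nsq_entries)
        finally show ?thesis by (simp only: sum_distrib_left[symmetric])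
      qed
      ultimately show ?thesis by simp
    qed
    have "mtrace r ((V * mtranspose V) ^ (2 * 2 ^ j)) \<le> mtrace r 1 / (19 / 10) ^ (2 * 2 ^ j)"
      by (rule mf.tr_inverse_power_le[OF VW _ ge]) simp
    then show ?thesis
      by (simp add: mf.potential_def mf.two_sided_inverse_eq[OF VW] q_def mtrace_one)
  qed
  have \<Phi>0: "0 \<le> ?\<Phi> X" for X
  proof -
    obtain V W where VW: "mf.factor_pair (mf.partial_sum n \<mu> (1 / 10) z X) V W" using fp by blast
    have "mtrace r ((V * mtranspose V) ^ q) = mf.nsq r ((V * mtranspose V) ^ 2 ^ j)"
      by (simp add: mf.nsq_def mf.adj_simps q_def mult_2 power_add)
    then show ?thesis
      by (simp add: mf.potential_def mf.two_sided_inverse_eq[OF VW] mf.nsq_nonneg)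
  qed
  have final: "(2 / 3) ^ q \<le> ?\<Phi> X" if X: "X \<in> bad" "X \<in> set_pmf \<mu>" for X
  proof -
    have Xn: "X \<subseteq> {..<n}" "card X = k" using hom X by (auto simp: k_homogeneous_def)
    have finX: "finite X" using Xn finite_subset by blast
    obtain x where x: "(\<Sum>i\<in>X. (\<Sum>a<r. u i a * x a)\<^sup>2 / p i) < (\<Sum>a<r. (x a)\<^sup>2) / 2"
      using X by (auto simp: bad_def)
    have "0 \<le> (\<Sum>i\<in>X. (\<Sum>a<r. u i a * x a)\<^sup>2 / p i)"
      using p0 Xn by (intro sum_nonneg) auto
    then have pos: "0 < (\<Sum>a<r. (x a)\<^sup>2)" using x by linarith
    define t where "t = sqrt (\<Sum>a<r. (x a)\<^sup>2)"
    have t: "t\<^sup>2 = (\<Sum>a<r. (x a)\<^sup>2)" "0 < t" using pos by (auto simp: t_def)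
    define y where "y a = x a / t" for a
    have y1: "(\<Sum>a<r. (y a)\<^sup>2) = 1" using t pos by (simp add: y_def power_divide flip: sum_divide_distrib)
    have y2: "(\<Sum>i\<in>X. (\<Sum>a<r. u i a * y a)\<^sup>2 / p i) < 1 / 2"
    proof -
      have "(\<Sum>i\<in>X. (\<Sum>a<r. u i a * y a)\<^sup>2 / p i) = (\<Sum>i\<in>X. (\<Sum>a<r. u i a * x a)\<^sup>2 / p i) / t\<^sup>2"
        unfolding y_def times_divide_eq_right sum_divide_distrib[symmetric] power_divide
        by (simp add: sum_divide_distrib mult.commute)
      also have "\<dots> < (\<Sum>a<r. (x a)\<^sup>2) / 2 / t\<^sup>2" using x t pos by (intro divide_strict_right_mono) auto
      also have "\<dots> = 1 / 2" using pos by (simp add: t)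
      finally show ?thesis .
    qed
    obtain V W where VW: "mf.factor_pair (mf.partial_sum n \<mu> (1 / 10) z X) V W" using fp by blast
    have nx: "mf.nsq r (column_family r y) = 1" by (simp add: nsq_column y1)
    \<comment> \<open>A realization already has \<open>k\<close> elements, so nothing can join it
      and the damped part of the partial sum disappears.\<close>
    have condX: "cond_prob \<mu> i X = 0" if "i \<notin> X" for i
    proof -
      have "\<not> insert i X \<subseteq> X'" if "X' \<in> set_pmf \<mu>" for X'
      proof
        assume "insert i X \<subseteq> X'"
        moreover have "finite X'" "card X' = k"
          using hom \<open>X' \<in> set_pmf \<mu>\<close> by (auto simp: k_homogeneous_def intro: finite_subset)
        ultimately have "card (insert i X) \<le> k" using card_mono by blast
        then show False using \<open>i \<notin> X\<close> finX Xn by simp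
      qed
      then have "incl \<mu> (insert i X) = 0"
        unfolding incl_def by (subst measure_pmf_zero_iff) auto
      then show ?thesis by (simp add: cond_prob_eq_incl)
    qed
    have le: "mtrace r (mtranspose (column_family r y) * mf.partial_sum n \<mu> (1 / 10) z X * column_family r y) \<le> 3 / 2"
    proof -
      have "mtrace r (mtranspose (column_family r y) * mf.partial_sum n \<mu> (1 / 10) z X * column_family r y)
        = mf.nsq r (column_family r y) + (\<Sum>i<n. (if i \<in> X then 1 else (1 - 1 / 10) * cond_prob \<mu> i X)
            * mtrace r (mtranspose (column_family r y) * Y i * column_family r y))"
        unfolding mf.partial_sum_def Y_def by (rule mf.tr_one_plus_sum)
      also have "(\<Sum>i<n. (if i \<in> X then 1 else (1 - 1 / 10) * cond_prob \<mu> i X)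
            * mtrace r (mtranspose (column_family r y) * Y i * column_family r y))
          = (\<Sum>i\<in>X. mtrace r (mtranspose (column_family r y) * Y i * column_family r y))"
        by (rule sum.mono_neutral_cong_right) (use Xn condX in auto)
      also have "\<dots> = (\<Sum>i\<in>X. (\<Sum>a<r. u i a * y a)\<^sup>2 / p i)"
      proof (rule sum.cong[OF refl])
        fix i assume "i \<in> X"
        then have "i < n" using Xn by auto
        have "mtrace r (mtranspose (column_family r y) * Y i * column_family r y)
            = (\<Sum>a<r. \<Sum>b<r. y a * (u i a * u i b / p i) * y b)"
          unfolding mtrace_column_sandwich Y_def z_def
          using p0[OF \<open>i < n\<close>] by (intro sum.cong refl) (simp add: entry_column_outer)
        also have "\<dots> = (\<Sum>a<r. u i a * y a)\<^sup>2 / p i"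
          by (simp add: power2_eq_square sum_product sum_divide_distrib mult_ac)
        finally show "mtrace r (mtranspose (column_family r y) * Y i * column_family r y) = (\<Sum>a<r. u i a * y a)\<^sup>2 / p i" .
      qed
      finally show ?thesis using y2 nx by simp
    qed
    have "(1 / (3 / 2)) ^ 2 ^ Suc j \<le> mtrace r ((V * mtranspose V) ^ 2 ^ Suc j)"
      by (rule mf.tr_inverse_power_ge[OF VW nx le]) (simp add: nsq_mult_column_le y1)
    then show ?thesis by (simp add: mf.potential_def mf.two_sided_inverse_eq[OF VW] q_def)
  qed
  have "measure_pmf.prob \<mu> bad * (2 / 3) ^ q = (\<Sum>X\<in>Pow {..<n}. of_bool (X \<in> bad) * pmf \<mu> X * (2 / 3) ^ q)"
    by (simp only: prob_eq_sum_Pow[OF hom] sum_distrib_right)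
  also have "\<dots> \<le> (\<Sum>X\<in>Pow {..<n}. of_bool (H \<subseteq> X) * (pmf \<mu> X * ?\<Phi> X))"
  proof (rule sum_mono)
    fix X
    show "of_bool (X \<in> bad) * pmf \<mu> X * (2 / 3) ^ q \<le> of_bool (H \<subseteq> X) * (pmf \<mu> X * ?\<Phi> X)"
    proof (cases "X \<in> set_pmf \<mu>")
      case True
      then show ?thesis using Hinc(2)[OF True] final[of X] \<Phi>0[of X]
        by (auto simp: of_bool_def intro: mult_left_mono)
    next
      case False
      then show ?thesis by (simp add: set_pmf_eq)
    qed
  qed
  also have "\<dots> \<le> real r / (19 / 10) ^ q" using super start Hinc by simp
  finally have "measure_pmf.prob \<mu> bad \<le> real r / (19 / 10) ^ q / (2 / 3) ^ q"
    by (subst pos_le_divide_eq) auto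
  also have "\<dots> = real r / ((19 / 10) ^ q * (2 / 3) ^ q)" by (rule divide_divide_eq_left)
  also have "(19 / 10) ^ q * (2 / 3) ^ q = (19 / 15 :: real) ^ q" by (simp flip: power_mult_distrib)
  also have "real r / (19 / 15) ^ q = real r * (15 / 19) ^ q" by (simp add: power_divide)
  finally show ?thesis by (simp add: bad_def)
qed

section \<open>Orthonormal bases of column spans\<close>

text \<open>Gram-Schmidt, one column at a time. \<open>C\<close> writes \<open>A\<close> in the
  orthonormal columns and \<open>E\<close> writes these in the columns of \<open>A\<close>; each
  direction gives one inclusion of column spans.\<close>

lemma orthonormal_coordinates_exist:
  fixes A :: "nat \<Rightarrow> nat \<Rightarrow> real"
  shows "\<exists>r\<le>d. \<exists>u C E. (\<forall>a<r. \<forall>b<r. (\<Sum>i<n. u i a * u i b) = (if a = b then 1 else 0)) \<and>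
      (\<forall>i<n. \<forall>j<d. A i j = (\<Sum>a<r. u i a * C a j)) \<and>
      (\<forall>i<n. \<forall>a<r. u i a = (\<Sum>j<d. A i j * E j a))"
proof (induction d)
  case 0
  show ?case by (intro exI[of _ 0]) simp
next
  case (Suc d)
  then obtain r u C E where r: "r \<le> d"
    and on: "\<And>a b. a < r \<Longrightarrow> b < r \<Longrightarrow> (\<Sum>i<n. u i a * u i b) = (if a = b then 1 else 0)"
    and C: "\<And>i j. i < n \<Longrightarrow> j < d \<Longrightarrow> A i j = (\<Sum>a<r. u i a * C a j)"
    and E: "\<And>i a. i < n \<Longrightarrow> a < r \<Longrightarrow> u i a = (\<Sum>j<d. A i j * E j a)"
    by blast
  define g where "g a = (\<Sum>i<n. u i a * A i d)" for a
  define w where "w i = A i d - (\<Sum>a<r. u i a * g a)" for i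
  define s where "s = sqrt (\<Sum>i<n. (w i)\<^sup>2)"
  have uw: "(\<Sum>i<n. u i b * w i) = 0" if b: "b < r" for b
  proof -
    have "(\<Sum>i<n. u i b * (\<Sum>a<r. u i a * g a)) = (\<Sum>a<r. (\<Sum>i<n. u i b * u i a) * g a)"
      unfolding sum_distrib_left sum_distrib_right mult.assoc by (rule sum.swap)
    also have "\<dots> = (\<Sum>a<r. if b = a then g a else 0)" using on b by (intro sum.cong) auto
    also have "\<dots> = g b" using b by simp
    finally show ?thesis by (simp add: w_def g_def right_diff_distrib sum_subtractf)
  qed
  show ?case
  proof (cases "s = 0")
    case True
    then have "w i = 0" if "i < n" for i using that by (simp add: s_def sum_nonneg_eq_0_iff)
    then have Ad: "A i d = (\<Sum>a<r. u i a * g a)" if "i < n" for i using that by (simp add: w_def)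
    show ?thesis
    proof (rule exI[of _ r], rule conjI, use r in simp, rule exI[of _ u],
        rule exI[of _ "\<lambda>a j. if j = d then g a else C a j"],
        rule exI[of _ "\<lambda>j a. if j = d then 0 else E j a"], intro conjI allI impI)
      show "A i j = (\<Sum>a<r. u i a * (if j = d then g a else C a j))" if "i < n" "j < Suc d" for i j
        using that C[of i j] Ad[of i] by (cases "j = d") auto
      show "u i a = (\<Sum>j<Suc d. A i j * (if j = d then 0 else E j a))" if "i < n" "a < r" for i a
        using E[OF that] by simp
    qed (rule on)
  next
    case False
    have s2: "s * s = (\<Sum>i<n. (w i)\<^sup>2)" by (simp add: s_def sum_nonneg)
    define u' where "u' i a = (if a = r then w i / s else u i a)" for i a
    define C' where "C' a j = (if j = d then (if a = r then s else g a) else (if a = r then 0 else C a j))" for a j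
    \<comment> \<open>Rewrites the projection that is subtracted from the new column as a
      combination of the earlier columns of \<open>A\<close>.\<close>
    define h where "h j = (\<Sum>b<r. E j b * g b)" for j
    define E' where "E' j a = (if a = r then (if j = d then 1 / s else - h j / s)
        else (if j = d then 0 else E j a))" for j a
    have 1: "(\<Sum>i<n. u' i a * u' i b) = (if a = b then 1 else 0)" if ab: "a < Suc r" "b < Suc r" for a b
    proof -
      consider "a = r" "b = r" | "a = r" "b < r" | "a < r" "b = r" | "a < r" "b < r" using ab by linarith
      then show ?thesis
      proof cases
        case 1
        have "(\<Sum>i<n. u' i a * u' i b) = (\<Sum>i<n. (w i)\<^sup>2) / (s * s)"
          by (simp add: 1 u'_def power2_eq_square sum_divide_distrib)
        then show ?thesis using 1 False by (simp flip: s2)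
      next
        case 2
        have "(\<Sum>i<n. u' i a * u' i b) = (\<Sum>i<n. u i b * w i) / s"
          using 2 by (simp add: u'_def sum_divide_distrib mult.commute)
        then show ?thesis using 2 uw by simp
      next
        case 3
        have "(\<Sum>i<n. u' i a * u' i b) = (\<Sum>i<n. u i a * w i) / s"
          using 3 by (simp add: u'_def sum_divide_distrib)
        then show ?thesis using 3 uw by simp
      next
        case 4
        then show ?thesis using on by (simp add: u'_def)
      qed
    qed
    have 2: "A i j = (\<Sum>a<Suc r. u' i a * C' a j)" if ij: "i < n" "j < Suc d" for i j
    proof (cases "j = d")
      case True
      then show ?thesis using False by (simp add: u'_def C'_def w_def)
    next
      case neq: False
      then show ?thesis using C ij by (simp add: u'_def C'_def)
    qed
    have 3: "u' i a = (\<Sum>j<Suc d. A i j * E' j a)" if ia: "i < n" "a < Suc r" for i a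
    proof (cases "a = r")
      case True
      have "(\<Sum>a<r. u i a * g a) = (\<Sum>a<r. \<Sum>j<d. A i j * (E j a * g a))"
        using E ia by (simp add: sum_distrib_right mult.assoc)
      also have "\<dots> = (\<Sum>j<d. A i j * h j)"
        by (subst sum.swap) (simp add: h_def sum_distrib_left)
      finally have "w i / s = (A i d - (\<Sum>j<d. A i j * h j)) / s" by (simp add: w_def)
      then show ?thesis using True
        by (simp add: u'_def E'_def diff_divide_distrib sum_divide_distrib sum_negf)
    next
      case neq: False
      then show ?thesis using E ia by (simp add: u'_def E'_def)
    qed
    show ?thesis
      by (rule exI[of _ "Suc r"], rule conjI, use r in simp, rule exI[of _ u'], rule exI[of _ C'],
          rule exI[of _ E'], intro conjI allI impI) (rule 1 2 3; assumption)+
  qed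
qed

section \<open>Column spans in matrix notation\<close>

lemma mult_mat_vec_index:
  assumes "A \<in> carrier_mat n d" "x \<in> carrier_vec d" "i < n"
  shows "(A *\<^sub>v x) $ i = (\<Sum>j<d. A $$ (i, j) * x $ j)"
  using assms by (auto simp: scalar_prod_def atLeast0LessThan intro!: sum.cong)

lemma colspan_subset:
  assumes A: "A \<in> carrier_mat n d" and B: "B \<in> carrier_mat n r"
    and C: "\<And>i a. i < n \<Longrightarrow> a < r \<Longrightarrow> B $$ (i, a) = (\<Sum>j<d. A $$ (i, j) * C j a)"
  shows "colspan B \<subseteq> colspan A"
proof
  fix v assume "v \<in> colspan B"
  then obtain x where x: "x \<in> carrier_vec r" "v = B *\<^sub>v x" using B by (auto simp: colspan_def)
  define y where "y = Matrix.vec d (\<lambda>j. \<Sum>a<r. C j a * x $ a)"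
  have "B *\<^sub>v x = A *\<^sub>v y"
  proof (rule eq_vecI)
    fix i assume "i < dim_vec (A *\<^sub>v y)"
    then have i: "i < n" using A by simp
    have "(B *\<^sub>v x) $ i = (\<Sum>a<r. \<Sum>j<d. A $$ (i, j) * (C j a * x $ a))"
      using mult_mat_vec_index[OF B x(1) i] i by (simp add: C sum_distrib_right mult.assoc)
    also have "\<dots> = (\<Sum>j<d. A $$ (i, j) * (\<Sum>a<r. C j a * x $ a))"
      by (subst sum.swap) (simp add: sum_distrib_left)
    also have "\<dots> = (A *\<^sub>v y) $ i"
      using mult_mat_vec_index[OF A _ i, of y] by (simp add: y_def)
    finally show "(B *\<^sub>v x) $ i = (A *\<^sub>v y) $ i" .
  qed (use A B in simp)
  moreover have "y \<in> carrier_vec d" by (simp add: y_def)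
  ultimately show "v \<in> colspan A" using x A by (auto simp: colspan_def)
qed

lemma gram_index:
  assumes "U \<in> carrier_mat n r" "a < r" "b < r"
  shows "(transpose_mat U * U) $$ (a, b) = (\<Sum>i<n. U $$ (i, a) * U $$ (i, b))"
  using assms by (auto simp: scalar_prod_def atLeast0LessThan intro!: sum.cong)

lemma orthonormal_colspan_basis_exists:
  assumes A: "A \<in> carrier_mat n d"
  obtains U where "orthonormal_colspan_basis A U" "dim_col U \<le> d"
proof -
  obtain r u C E where r: "r \<le> d"
    and on: "\<And>a b. a < r \<Longrightarrow> b < r \<Longrightarrow> (\<Sum>i<n. u i a * u i b) = (if a = b then (1::real) else 0)"
    and C: "\<And>i j. i < n \<Longrightarrow> j < d \<Longrightarrow> A $$ (i, j) = (\<Sum>a<r. u i a * C a j)"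
    and E: "\<And>i a. i < n \<Longrightarrow> a < r \<Longrightarrow> u i a = (\<Sum>j<d. A $$ (i, j) * E j a)"
    using orthonormal_coordinates_exist[of d n "\<lambda>i j. A $$ (i, j)"] by blast
  define U where "U = Matrix.mat n r (\<lambda>(i, a). u i a)"
  have U: "U \<in> carrier_mat n r" by (simp add: U_def)
  have "transpose_mat U * U = 1\<^sub>m (dim_col U)"
    by (rule eq_matI) (use on U in \<open>auto simp: gram_index[OF U] simp del: index_mult_mat(1), auto simp: U_def\<close>)
  moreover have "colspan U \<subseteq> colspan A"
    by (rule colspan_subset[OF A U, of E]) (use E in \<open>simp add: U_def\<close>)
  moreover have "colspan A \<subseteq> colspan U"
    by (rule colspan_subset[OF U A, of C]) (use C in \<open>simp add: U_def\<close>)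
  ultimately have "orthonormal_colspan_basis A U"
    using A U by (auto simp: orthonormal_colspan_basis_def)
  then show ?thesis using that U r by auto
qed

lemma Bessel_inequality:
  fixes v :: "nat \<Rightarrow> nat \<Rightarrow> real"
  assumes on: "\<And>a b. a < r \<Longrightarrow> b < r \<Longrightarrow> (\<Sum>i<n. v i a * v i b) = (if a = b then 1 else 0)"
  shows "(\<Sum>a<r. (\<Sum>i<n. v i a * y i)\<^sup>2) \<le> (\<Sum>i<n. (y i)\<^sup>2)"
proof -
  define g where "g a = (\<Sum>i<n. v i a * y i)" for a
  have "0 \<le> (\<Sum>i<n. (y i - (\<Sum>a<r. v i a * g a))\<^sup>2)" by (intro sum_nonneg) auto
  also have "\<dots> = (\<Sum>i<n. (y i)\<^sup>2) - 2 * (\<Sum>i<n. y i * (\<Sum>a<r. v i a * g a)) + (\<Sum>i<n. (\<Sum>a<r. v i a * g a)\<^sup>2)"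
    by (simp add: power2_diff sum.distrib sum_subtractf sum_distrib_left mult.assoc)
  also have "(\<Sum>i<n. y i * (\<Sum>a<r. v i a * g a)) = (\<Sum>a<r. (g a)\<^sup>2)"
  proof -
    have "(\<Sum>i<n. y i * (\<Sum>a<r. v i a * g a)) = (\<Sum>a<r. \<Sum>i<n. v i a * y i * g a)"
      unfolding sum_distrib_left by (subst sum.swap) (simp add: mult_ac)
    then show ?thesis by (simp add: g_def power2_eq_square flip: sum_distrib_right)
  qed
  also have "(\<Sum>i<n. (\<Sum>a<r. v i a * g a)\<^sup>2) = (\<Sum>a<r. (g a)\<^sup>2)"
    by (rule isotropic_sum_squares[OF on])
  finally show ?thesis by (simp add: g_def)
qed

lemma orthonormal_basis_gram:
  assumes "orthonormal_colspan_basis A U" "A \<in> carrier_mat n d" "a < dim_col U" "b < dim_col U"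
  shows "(\<Sum>i<n. U $$ (i, a) * U $$ (i, b)) = (if a = b then 1 else 0)"
proof -
  have U: "U \<in> carrier_mat n (dim_col U)" and one: "transpose_mat U * U = 1\<^sub>m (dim_col U)"
    using assms by (auto simp: orthonormal_colspan_basis_def)
  show ?thesis using gram_index[OF U assms(3,4)] assms(3,4) by (simp add: one)
qed

text \<open>\<open>leverage_score\<close> uses a basis picked by choice, while Gram-Schmidt bounds
  the size of one particular basis; this transfers the bound. Count the squared entries of
  \<open>transpose_mat U * V\<close>: a column of \<open>V\<close> lies in the span of
  \<open>U\<close> and contributes 1, and a column of \<open>U\<close> contributes at most 1 by
  Bessel.\<close>

lemma orthonormal_colspan_basis_dim_le:
  assumes A: "A \<in> carrier_mat n d"
    and U: "orthonormal_colspan_basis A U" and V: "orthonormal_colspan_basis A V"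
  shows "dim_col V \<le> dim_col U"
proof -
  define r s where "r = dim_col U" and "s = dim_col V"
  have Uc: "U \<in> carrier_mat n r" and Vc: "V \<in> carrier_mat n s" and span: "colspan V = colspan U"
    using U V A by (auto simp: orthonormal_colspan_basis_def r_def s_def)
  have Uon: "(\<Sum>i<n. U $$ (i, a) * U $$ (i, b)) = (if a = b then 1 else 0)" if "a < r" "b < r" for a b
    using orthonormal_basis_gram[OF U A] that by (simp add: r_def)
  have Von: "(\<Sum>i<n. V $$ (i, a) * V $$ (i, b)) = (if a = b then 1 else 0)" if "a < s" "b < s" for a b
    using orthonormal_basis_gram[OF V A] that by (simp add: s_def)
  have colV: "\<exists>x. \<forall>i<n. V $$ (i, b) = (\<Sum>a<r. U $$ (i, a) * x a)" if b: "b < s" for b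
  proof -
    have "V *\<^sub>v unit_vec s b \<in> colspan V" using Vc by (auto simp: colspan_def)
    then obtain x where x: "x \<in> carrier_vec r" "V *\<^sub>v unit_vec s b = U *\<^sub>v x"
      using span Uc by (auto simp: colspan_def)
    have "V $$ (i, b) = (\<Sum>a<r. U $$ (i, a) * x $ a)" if i: "i < n" for i
    proof -
      have "(V *\<^sub>v unit_vec s b) $ i = (\<Sum>j<s. V $$ (i, j) * unit_vec s b $ j)"
        using mult_mat_vec_index[OF Vc _ i, of "unit_vec s b"] by simp
      also have "\<dots> = (\<Sum>j<s. if j = b then V $$ (i, j) else 0)" using b by (intro sum.cong) auto
      also have "\<dots> = V $$ (i, b)" using b by simp
      finally show ?thesis using mult_mat_vec_index[OF Uc x(1) i] x(2) by simp
    qed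
    then show ?thesis by (intro exI[of _ "\<lambda>a. x $ a"]) simp
  qed
  have "(\<Sum>a<r. (\<Sum>i<n. U $$ (i, a) * V $$ (i, b))\<^sup>2) = 1" if b: "b < s" for b
  proof -
    obtain x where x: "\<And>i. i < n \<Longrightarrow> V $$ (i, b) = (\<Sum>a<r. U $$ (i, a) * x a)" using colV[OF b] by blast
    have "1 = (\<Sum>i<n. (V $$ (i, b))\<^sup>2)" using Von[OF b b] by (simp add: power2_eq_square)
    also have "\<dots> = (\<Sum>i<n. (\<Sum>a<r. U $$ (i, a) * x a)\<^sup>2)" using x by simp
    also have "\<dots> = (\<Sum>a<r. (x a)\<^sup>2)" by (rule isotropic_sum_squares[OF Uon])
    also have "\<dots> = (\<Sum>a<r. (\<Sum>i<n. U $$ (i, a) * V $$ (i, b))\<^sup>2)"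
    proof (rule sum.cong[OF refl])
      fix a assume a: "a \<in> {..<r}"
      have "(\<Sum>i<n. U $$ (i, a) * V $$ (i, b)) = (\<Sum>i<n. \<Sum>c<r. U $$ (i, a) * U $$ (i, c) * x c)"
        using x by (simp add: sum_distrib_left mult.assoc)
      also have "\<dots> = (\<Sum>c<r. (\<Sum>i<n. U $$ (i, a) * U $$ (i, c)) * x c)"
        by (subst sum.swap) (simp add: sum_distrib_right)
      also have "\<dots> = (\<Sum>c<r. if a = c then x c else 0)" using Uon a by (intro sum.cong) auto
      also have "\<dots> = x a" using a by simp
      finally show "(x a)\<^sup>2 = (\<Sum>i<n. U $$ (i, a) * V $$ (i, b))\<^sup>2" by simp
    qed
    finally show ?thesis by simp
  qed
  then have "real s = (\<Sum>b<s. \<Sum>a<r. (\<Sum>i<n. U $$ (i, a) * V $$ (i, b))\<^sup>2)" by simp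
  also have "\<dots> = (\<Sum>a<r. \<Sum>b<s. (\<Sum>i<n. V $$ (i, b) * U $$ (i, a))\<^sup>2)"
    by (subst sum.swap) (simp add: mult.commute)
  also have "\<dots> \<le> (\<Sum>a<r. \<Sum>i<n. (U $$ (i, a))\<^sup>2)"
    by (intro sum_mono Bessel_inequality Von)
  also have "\<dots> = (\<Sum>a<r. 1)" using Uon by (simp add: power2_eq_square)
  finally show ?thesis by (simp add: r_def s_def)
qed

text \<open>The passage from matrices to real coordinates. The last two clauses are the two
  inclusions between the column spans.\<close>

lemma leverage_basis:
  assumes A: "A \<in> carrier_mat n d"
  shows "\<exists>r u. r \<le> d \<and> (\<forall>a<r. \<forall>b<r. (\<Sum>i<n. u i a * u i b) = (if a = b then (1::real) else 0)) \<and>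
    (\<forall>i<n. leverage_score A i = (\<Sum>a<r. (u i a)\<^sup>2)) \<and>
    (\<forall>x\<in>carrier_vec d. \<exists>y. \<forall>i<n. (A *\<^sub>v x) $ i = (\<Sum>a<r. u i a * y a)) \<and>
    (\<forall>y. \<exists>x\<in>carrier_vec d. \<forall>i<n. (A *\<^sub>v x) $ i = (\<Sum>a<r. u i a * y a))"
proof -
  obtain U0 where U0: "orthonormal_colspan_basis A U0" "dim_col U0 \<le> d"
    using orthonormal_colspan_basis_exists[OF A] .
  define U where "U = (SOME U. orthonormal_colspan_basis A U)"
  have U: "orthonormal_colspan_basis A U" unfolding U_def using U0(1) by (rule someI)
  define r where "r = dim_col U"
  have Uc: "U \<in> carrier_mat n r" and span: "colspan U = colspan A"
    using U A by (auto simp: orthonormal_colspan_basis_def r_def)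
  show ?thesis
  proof (intro exI[of _ r] exI[of _ "\<lambda>i a. U $$ (i, a)"] conjI allI impI ballI)
    show "r \<le> d" using orthonormal_colspan_basis_dim_le[OF A U0(1) U] U0(2) by (simp add: r_def)
    show "(\<Sum>i<n. U $$ (i, a) * U $$ (i, b)) = (if a = b then 1 else 0)" if "a < r" "b < r" for a b
      using orthonormal_basis_gram[OF U A] that by (simp add: r_def)
    show "leverage_score A i = (\<Sum>a<r. (U $$ (i, a))\<^sup>2)" if "i < n" for i
      unfolding leverage_score_def U_def[symmetric] sqnorm_def using Uc that
      by (auto intro!: sum.cong)
    show "\<exists>y. \<forall>i<n. (A *\<^sub>v x) $ i = (\<Sum>a<r. U $$ (i, a) * y a)" if x: "x \<in> carrier_vec d" for x
    proof -
      have "A *\<^sub>v x \<in> colspan U" unfolding span using x A by (auto simp: colspan_def)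
      then obtain y where y: "y \<in> carrier_vec r" "A *\<^sub>v x = U *\<^sub>v y" using Uc by (auto simp: colspan_def)
      show ?thesis
        by (rule exI[of _ "\<lambda>a. y $ a"]) (use y mult_mat_vec_index[OF Uc y(1)] in simp)
    qed
    show "\<exists>x\<in>carrier_vec d. \<forall>i<n. (A *\<^sub>v x) $ i = (\<Sum>a<r. U $$ (i, a) * y a)" for y
    proof -
      define v where "v = Matrix.vec r y"
      have v: "v \<in> carrier_vec r" by (simp add: v_def)
      have "U *\<^sub>v v \<in> colspan A" unfolding span[symmetric] using v Uc by (auto simp: colspan_def)
      then obtain x where x: "x \<in> carrier_vec d" "U *\<^sub>v v = A *\<^sub>v x" using A by (auto simp: colspan_def)
      show ?thesis
        by (rule bexI[OF _ x(1)]) (use x(2)[symmetric] mult_mat_vec_index[OF Uc v] in \<open>simp add: v_def\<close>)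
    qed
  qed
qed

section \<open>The sketched regression problem\<close>

lemma sqnorm_sampling_mat:
  assumes A: "A \<in> carrier_mat n d" and b: "b \<in> carrier_vec n" and x: "x \<in> carrier_vec d"
    and X: "X \<subseteq> {..<n}" and p: "\<And>i. i < n \<Longrightarrow> 0 \<le> p i"
  shows "sqnorm ((sampling_mat n p X * A) *\<^sub>v x - sampling_mat n p X *\<^sub>v b)
       = (\<Sum>i\<in>X. ((A *\<^sub>v x) $ i - b $ i)\<^sup>2 / p i)"
proof -
  define S where "S = sampling_mat n p X"
  define s where "s = sorted_list_of_set X"
  have finX: "finite X" using X finite_subset by blast
  have S: "S \<in> carrier_mat (card X) n" by (simp add: S_def sampling_mat_def)
  have s: "length s = card X" "set s = X" "distinct s" using finX by (simp_all add: s_def)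
  have sn: "s ! t < n" "s ! t \<in> X" if "t < card X" for t using that s X nth_mem[of t s] by auto
  have Sv: "(S *\<^sub>v v) $ t = v $ (s ! t) / sqrt (p (s ! t))" if v: "v \<in> carrier_vec n" and t: "t < card X" for v t
  proof -
    have "(S *\<^sub>v v) $ t = (\<Sum>i<n. S $$ (t, i) * v $ i)" by (rule mult_mat_vec_index[OF S v t])
    also have "\<dots> = (\<Sum>i<n. if i = s ! t then v $ i / sqrt (p i) else 0)"
      using t by (intro sum.cong) (auto simp: S_def sampling_mat_def Let_def s_def)
    also have "\<dots> = v $ (s ! t) / sqrt (p (s ! t))" using sn[OF t] by simp
    finally show ?thesis .
  qed
  have Ax: "A *\<^sub>v x \<in> carrier_vec n" using A x by simp
  have "sqnorm ((S * A) *\<^sub>v x - S *\<^sub>v b) = (\<Sum>t<card X. ((S *\<^sub>v (A *\<^sub>v x)) $ t - (S *\<^sub>v b) $ t)\<^sup>2)"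
    using S by (simp add: sqnorm_def assoc_mult_mat_vec[OF S A x])
  also have "\<dots> = (\<Sum>t<card X. ((A *\<^sub>v x) $ (s ! t) - b $ (s ! t))\<^sup>2 / p (s ! t))"
    using sn p by (intro sum.cong refl) (simp add: Sv Ax b power_divide flip: diff_divide_distrib)
  also have "\<dots> = (\<Sum>i\<in>X. ((A *\<^sub>v x) $ i - b $ i)\<^sup>2 / p i)"
    by (rule sum.reindex_bij_betw[OF bij_betw_nth]) (use s in auto)
  finally show ?thesis by (simp add: S_def)
qed

text \<open>Here \<rho> plays the optimal residual and \<open>z\<close> the coordinates of the
  deviation from the optimum. Expanding \<open>opt\<close> and inserting \<open>lower\<close> gives
  Z / 2 + 2 h <= 0, that is Z <= -4 h. Since h^2 <= Z G, squaring produces the constant 16.\<close>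

lemma sketched_minimizer_error:
  fixes u :: "nat \<Rightarrow> nat \<Rightarrow> real"
  assumes lower: "(\<Sum>a<r. (z a)\<^sup>2) / 2 \<le> (\<Sum>i\<in>X. (\<Sum>a<r. u i a * z a)\<^sup>2 / p i)"
    and opt: "(\<Sum>i\<in>X. ((\<Sum>a<r. u i a * z a) + \<rho> i)\<^sup>2 / p i) \<le> (\<Sum>i\<in>X. (\<rho> i)\<^sup>2 / p i)"
  shows "(\<Sum>a<r. (z a)\<^sup>2) \<le> 16 * (\<Sum>a<r. (\<Sum>i\<in>X. u i a * \<rho> i / p i)\<^sup>2)"
proof -
  define g where "g a = (\<Sum>i\<in>X. u i a * \<rho> i / p i)" for a
  define Z where "Z = (\<Sum>a<r. (z a)\<^sup>2)"
  define G where "G = (\<Sum>a<r. (g a)\<^sup>2)"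
  define h where "h = (\<Sum>a<r. z a * g a)"
  have cross: "(\<Sum>i\<in>X. (\<Sum>a<r. u i a * z a) * \<rho> i / p i) = h"
    unfolding h_def g_def sum_distrib_left sum_distrib_right sum_divide_distrib
    by (subst sum.swap) (simp add: mult_ac)
  have "(\<Sum>i\<in>X. ((\<Sum>a<r. u i a * z a) + \<rho> i)\<^sup>2 / p i)
      = (\<Sum>i\<in>X. (\<Sum>a<r. u i a * z a)\<^sup>2 / p i) + 2 * (\<Sum>i\<in>X. (\<Sum>a<r. u i a * z a) * \<rho> i / p i)
        + (\<Sum>i\<in>X. (\<rho> i)\<^sup>2 / p i)"
  proof -
    have "(\<Sum>i\<in>X. ((\<Sum>a<r. u i a * z a) + \<rho> i)\<^sup>2 / p i)
        = (\<Sum>i\<in>X. (\<Sum>a<r. u i a * z a)\<^sup>2 / p i + 2 * ((\<Sum>a<r. u i a * z a) * \<rho> i / p i) + (\<rho> i)\<^sup>2 / p i)"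
      unfolding power2_sum add_divide_distrib by (intro sum.cong refl) simp
    then show ?thesis by (simp only: sum.distrib sum_distrib_left[of 2])
  qed
  then have Zh: "Z \<le> 4 * (- h)" using opt lower by (simp add: cross Z_def)
  have Z0: "0 \<le> Z" by (simp add: Z_def sum_nonneg)
  have "Z * Z \<le> (4 * (- h)) * (4 * (- h))" using Zh Z0 by (intro mult_mono) auto
  also have "\<dots> = 16 * h\<^sup>2" by (simp add: power2_eq_square)
  also have "h\<^sup>2 \<le> Z * G" unfolding h_def Z_def G_def by (rule Cauchy_Schwarz_ineq_sum)
  finally have "Z * Z \<le> Z * (16 * G)" by simp
  moreover have "0 \<le> G" by (simp add: G_def sum_nonneg)
  ultimately have "Z \<le> 16 * G" using Z0 by (cases "Z = 0") auto
  then show ?thesis by (simp add: Z_def G_def g_def)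
qed

text \<open>The second moment is a covariance part plus the squared mean, and the mean vanishes by
  \<open>orth\<close>. In the covariance part the arithmetic-geometric mean inequality moves each
  term to its two indices, symmetry merges the halves, and the row sum p_i D times \<tau>_i
  \<rho>_i^2 / p_i^2 equals D / c times \<rho>_i^2 when p_i = c \<tau>_i.\<close>

lemma residual_second_moment:
  fixes u :: "nat \<Rightarrow> nat \<Rightarrow> real"
  assumes hom: "k_homogeneous n k \<mu>" and ind: "one_sided_linf_independent n \<mu> D" and D: "0 \<le> D"
    and p: "\<And>i. i < n \<Longrightarrow> p i = min 1 (c * (\<Sum>a<r. (u i a)\<^sup>2))" "\<And>i. i < n \<Longrightarrow> incl \<mu> {i} = p i"
    and c: "0 < c"
    and orth: "\<And>a. a < r \<Longrightarrow> (\<Sum>i<n. u i a * \<rho> i) = 0"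
  shows "(\<Sum>X\<in>Pow {..<n}. pmf \<mu> X * (\<Sum>a<r. (\<Sum>i\<in>X. u i a * \<rho> i / p i)\<^sup>2)) \<le> D / c * (\<Sum>i<n. (\<rho> i)\<^sup>2)"
proof -
  define x where "x i a = u i a * \<rho> i / p i" for i a
  define xx where "xx i l = (\<Sum>a<r. x i a * x l a)" for i l
  let ?cov = "pair_cov \<mu> {}"
  have incl0: "incl \<mu> {} = 1" by (simp add: incl_def)
  have cond0: "cond_prob \<mu> i {} = p i" if "i < n" for i using p(2)[OF that] by (simp add: cond_prob_eq_incl incl0)
  have p0: "0 \<le> p i" if "i < n" for i using p(1)[OF that] c by (simp add: sum_nonneg)
  have pz: "u i a = 0" if "i < n" "a < r" "p i = 0" for i a
    by (rule truncated_square_sum_eq_0[of c "u i" r]) (use p(1)[OF that(1)] that c in auto)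
  \<comment> \<open>Undoes the division by the marginal; if that is 0, both sides vanish.\<close>
  have px: "p i * x i a = u i a * \<rho> i" if "i < n" "a < r" for i a
    using pz[OF that] by (cases "p i = 0") (auto simp: x_def)
  have expand: "(\<Sum>a<r. (\<Sum>i\<in>X. x i a)\<^sup>2) = (\<Sum>i<n. \<Sum>l<n. of_bool ({i, l} \<subseteq> X) * xx i l)" if X: "X \<subseteq> {..<n}" for X
  proof -
    have "(\<Sum>i\<in>X. x i a) = (\<Sum>i<n. of_bool (i \<in> X) * x i a)" for a
      by (rule sum.mono_neutral_cong_left) (use X in auto)
    then have "(\<Sum>a<r. (\<Sum>i\<in>X. x i a)\<^sup>2)
        = (\<Sum>a<r. \<Sum>i<n. \<Sum>l<n. of_bool (i \<in> X) * x i a * (of_bool (l \<in> X) * x l a))"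
      by (simp only: power2_eq_square sum_product)
    also have "\<dots> = (\<Sum>i<n. \<Sum>a<r. \<Sum>l<n. of_bool (i \<in> X) * x i a * (of_bool (l \<in> X) * x l a))"
      by (rule sum.swap)
    also have "\<dots> = (\<Sum>i<n. \<Sum>l<n. \<Sum>a<r. of_bool (i \<in> X) * x i a * (of_bool (l \<in> X) * x l a))"
      by (intro sum.cong refl sum.swap)
    also have "\<dots> = (\<Sum>i<n. \<Sum>l<n. of_bool ({i, l} \<subseteq> X) * xx i l)"
      unfolding xx_def sum_distrib_left by (intro sum.cong refl) (auto simp: of_bool_def)
    finally show ?thesis .
  qed
  have "(\<Sum>X\<in>Pow {..<n}. pmf \<mu> X * (\<Sum>a<r. (\<Sum>i\<in>X. x i a)\<^sup>2))
      = (\<Sum>X\<in>Pow {..<n}. \<Sum>i<n. \<Sum>l<n. of_bool ({i, l} \<subseteq> X) * pmf \<mu> X * xx i l)"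
    by (intro sum.cong refl) (simp only: expand Pow_iff sum_distrib_left mult_ac)
  also have "\<dots> = (\<Sum>i<n. \<Sum>X\<in>Pow {..<n}. \<Sum>l<n. of_bool ({i, l} \<subseteq> X) * pmf \<mu> X * xx i l)"
    by (rule sum.swap)
  also have "\<dots> = (\<Sum>i<n. \<Sum>l<n. \<Sum>X\<in>Pow {..<n}. of_bool ({i, l} \<subseteq> X) * pmf \<mu> X * xx i l)"
    by (intro sum.cong refl sum.swap)
  also have "\<dots> = (\<Sum>i<n. \<Sum>l<n. incl \<mu> {i, l} * xx i l)"
    by (simp only: incl_eq_sum[OF hom] sum_distrib_right)
  also have "\<dots> = (\<Sum>i<n. \<Sum>l<n. ?cov i l * xx i l + p i * p l * xx i l)"
    by (intro sum.cong refl) (simp add: pair_cov_def incl0 cond0 algebra_simps)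
  also have "\<dots> = (\<Sum>i<n. \<Sum>l<n. ?cov i l * xx i l) + (\<Sum>i<n. \<Sum>l<n. p i * p l * xx i l)"
    by (simp add: sum.distrib)
  also have "(\<Sum>i<n. \<Sum>l<n. p i * p l * xx i l) = 0"
  proof -
    have "(\<Sum>i<n. \<Sum>l<n. p i * p l * xx i l) = (\<Sum>i<n. \<Sum>l<n. \<Sum>a<r. (p i * x i a) * (p l * x l a))"
      by (simp add: xx_def sum_distrib_left mult_ac)
    also have "\<dots> = (\<Sum>i<n. \<Sum>a<r. \<Sum>l<n. (p i * x i a) * (p l * x l a))"
      by (intro sum.cong refl sum.swap)
    also have "\<dots> = (\<Sum>a<r. \<Sum>i<n. \<Sum>l<n. (p i * x i a) * (p l * x l a))" by (rule sum.swap)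
    also have "\<dots> = (\<Sum>a<r. (\<Sum>i<n. p i * x i a) * (\<Sum>l<n. p l * x l a))" by (simp only: sum_product)
    also have "\<dots> = 0" by (intro sum.neutral ballI) (simp add: px orth)
    finally show ?thesis .
  qed
  also have "(\<Sum>i<n. \<Sum>l<n. ?cov i l * xx i l) \<le> (\<Sum>i<n. \<Sum>l<n. \<bar>?cov i l\<bar> * (xx i i + xx l l) / 2)"
  proof (intro sum_mono)
    fix i l
    have "0 \<le> (\<Sum>a<r. (\<bar>x i a\<bar> - \<bar>x l a\<bar>)\<^sup>2)" by (intro sum_nonneg) auto
    then have "2 * (\<Sum>a<r. \<bar>x i a\<bar> * \<bar>x l a\<bar>) \<le> xx i i + xx l l"
      by (simp add: xx_def power2_diff sum.distrib sum_subtractf sum_distrib_left mult.assoc)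
        (simp add: power2_eq_square)
    moreover have "2 * \<bar>xx i l\<bar> \<le> 2 * (\<Sum>a<r. \<bar>x i a\<bar> * \<bar>x l a\<bar>)"
      unfolding xx_def using sum_abs[of "\<lambda>a. x i a * x l a" "{..<r}"] by (simp add: abs_mult)
    ultimately have "2 * \<bar>xx i l\<bar> \<le> xx i i + xx l l" by (rule order_trans[rotated])
    then have "\<bar>xx i l\<bar> \<le> (xx i i + xx l l) / 2" by (simp add: mult.commute)
    then have "\<bar>?cov i l\<bar> * \<bar>xx i l\<bar> \<le> \<bar>?cov i l\<bar> * ((xx i i + xx l l) / 2)"
      by (intro mult_left_mono) auto
    moreover have "?cov i l * xx i l \<le> \<bar>?cov i l\<bar> * \<bar>xx i l\<bar>" by (metis abs_ge_self abs_mult)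
    ultimately show "?cov i l * xx i l \<le> \<bar>?cov i l\<bar> * (xx i i + xx l l) / 2" by simp
  qed
  also have "(\<Sum>i<n. \<Sum>l<n. \<bar>?cov i l\<bar> * (xx i i + xx l l) / 2) = (\<Sum>i<n. (\<Sum>l<n. \<bar>?cov i l\<bar>) * xx i i)"
  proof -
    have "(\<Sum>i<n. \<Sum>l<n. \<bar>?cov i l\<bar> * xx l l) = (\<Sum>l<n. \<Sum>i<n. \<bar>?cov i l\<bar> * xx l l)" by (rule sum.swap)
    also have "\<dots> = (\<Sum>i<n. \<Sum>l<n. \<bar>?cov i l\<bar> * xx i i)"
      by (intro sum.cong refl) (simp add: pair_cov_sym[of \<mu> "{}"])
    finally show ?thesis
      by (simp add: distrib_left add_divide_distrib sum.distrib flip: sum_divide_distrib sum_distrib_right)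
  qed
  also have "\<dots> \<le> (\<Sum>i<n. D / c * (\<rho> i)\<^sup>2)"
  proof (rule sum_mono)
    fix i assume "i \<in> {..<n}"
    then have i: "i < n" by simp
    have "xx i i = (\<Sum>a<r. (u i a)\<^sup>2 * ((\<rho> i)\<^sup>2 / (p i)\<^sup>2))"
      by (simp add: xx_def x_def power2_eq_square mult_ac)
    also have "\<dots> = (\<Sum>a<r. (u i a)\<^sup>2) * ((\<rho> i)\<^sup>2 / (p i)\<^sup>2)"
      by (rule sum_distrib_right[symmetric])
    finally have xxi: "xx i i = (\<Sum>a<r. (u i a)\<^sup>2) * (\<rho> i)\<^sup>2 / (p i)\<^sup>2" by simp
    have rhs: "0 \<le> D / c * (\<rho> i)\<^sup>2" using D c by simp
    consider "p i = 0" | "p i = 1" | "p i \<noteq> 0" "p i = c * (\<Sum>a<r. (u i a)\<^sup>2)"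
      using p(1)[OF i] by (auto simp: min_def split: if_splits)
    then show "(\<Sum>l<n. \<bar>?cov i l\<bar>) * xx i i \<le> D / c * (\<rho> i)\<^sup>2"
    proof cases
      case 1
      then show ?thesis using rhs by (simp add: xxi)
    next
      \<comment> \<open>A certain index has a constant indicator and hence no covariance. This case
        is separate because 1 / c need not bound its leverage score.\<close>
      case 2
      have "incl \<mu> {l, i} = incl \<mu> {l}" for l
      proof -
        have "i \<in> Y" if "Y \<in> set_pmf \<mu>" for Y
          using incl_eq_1(1)[of "{i}" \<mu> Y] that p(2)[OF i] 2 by simp
        then show ?thesis
          unfolding incl_def by (intro measure_pmf.finite_measure_eq_AE) (auto simp: AE_measure_pmf_iff)
      qed
      then have "?cov i l = 0" if "l < n" for l
        using that 2 i p(2) by (simp add: pair_cov_def incl0 cond0 insert_commute[of i])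
      then show ?thesis using rhs by simp
    next
      case 3
      have "(\<Sum>l\<in>{..<n} - {}. \<bar>?cov i l\<bar>) \<le> cond_prob \<mu> i {} * D"
        by (rule pair_cov_abs_sum[OF hom ind]) (use i incl0 in auto)
      then have "(\<Sum>l<n. \<bar>?cov i l\<bar>) \<le> p i * D" by (simp add: cond0 i)
      then have "(\<Sum>l<n. \<bar>?cov i l\<bar>) * xx i i \<le> p i * D * xx i i"
        by (intro mult_right_mono) (auto simp: xx_def intro!: sum_nonneg)
      also have "\<dots> = D * (\<rho> i)\<^sup>2 * (p i * (\<Sum>a<r. (u i a)\<^sup>2) / (p i)\<^sup>2)" by (simp add: xxi)
      also have "p i * (\<Sum>a<r. (u i a)\<^sup>2) / (p i)\<^sup>2 = (\<Sum>a<r. (u i a)\<^sup>2) / p i"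
        using 3(1) by (simp add: power2_eq_square)
      also have "(\<Sum>a<r. (u i a)\<^sup>2) / p i = 1 / c"
        using 3 by (simp add: field_simps)
      finally show ?thesis by simp
    qed
  qed
  finally show ?thesis by (simp add: x_def sum_distrib_left)
qed

lemma residual_tail:
  fixes u :: "nat \<Rightarrow> nat \<Rightarrow> real"
  assumes hom: "k_homogeneous n k \<mu>" and ind: "one_sided_linf_independent n \<mu> D" and D: "0 \<le> D"
    and p: "\<And>i. i < n \<Longrightarrow> p i = min 1 (c * (\<Sum>a<r. (u i a)\<^sup>2))" "\<And>i. i < n \<Longrightarrow> incl \<mu> {i} = p i"
    and c: "0 < c"
    and orth: "\<And>a. a < r \<Longrightarrow> (\<Sum>i<n. u i a * \<rho> i) = 0"
    and \<eta>: "0 < \<eta>"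
  shows "measure_pmf.prob \<mu>
           {X. X \<subseteq> {..<n} \<and> \<eta> * (\<Sum>i<n. (\<rho> i)\<^sup>2) < (\<Sum>a<r. (\<Sum>i\<in>X. u i a * \<rho> i / p i)\<^sup>2)}
         \<le> D / (c * \<eta>)"
proof -
  define Q where "Q = (\<Sum>i<n. (\<rho> i)\<^sup>2)"
  define G where "G X = (\<Sum>a<r. (\<Sum>i\<in>X. u i a * \<rho> i / p i)\<^sup>2)" for X
  define bad where "bad = {X. X \<subseteq> {..<n} \<and> \<eta> * Q < G X}"
  have G0: "0 \<le> G X" for X by (simp add: G_def sum_nonneg)
  have "measure_pmf.prob \<mu> bad \<le> D / (c * \<eta>)"
  proof (cases "Q = 0")
    \<comment> \<open>Markov's inequality would divide by \<open>Q\<close>. With zero residual all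
      sampled terms vanish, and the strict inequality defining \<open>bad\<close> fails.\<close>
    case True
    then have \<rho>0: "\<rho> i = 0" if "i < n" for i using that by (simp add: Q_def sum_nonneg_eq_0_iff)
    have "G X = 0" if "X \<subseteq> {..<n}" for X
      unfolding G_def using that \<rho>0 by (intro sum.neutral ballI) (auto simp: subset_iff intro!: sum.neutral)
    then have "bad = {}" by (auto simp: bad_def True)
    then show ?thesis using D c \<eta> by simp
  next
    case False
    then have Q: "0 < Q" using sum_nonneg[of "{..<n}" "\<lambda>i. (\<rho> i)\<^sup>2"] by (simp add: Q_def less_le)
    have "measure_pmf.prob \<mu> bad * (\<eta> * Q) = (\<Sum>X\<in>Pow {..<n}. of_bool (X \<in> bad) * pmf \<mu> X * (\<eta> * Q))"
      by (simp only: prob_eq_sum_Pow[OF hom] sum_distrib_right)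
    also have "\<dots> \<le> (\<Sum>X\<in>Pow {..<n}. pmf \<mu> X * G X)"
    proof (rule sum_mono)
      fix X
      show "of_bool (X \<in> bad) * pmf \<mu> X * (\<eta> * Q) \<le> pmf \<mu> X * G X"
        using G0[of X] by (cases "X \<in> bad") (auto simp: bad_def intro: mult_left_mono)
    qed
    also have "\<dots> \<le> D / c * Q"
      unfolding G_def Q_def by (rule residual_second_moment[OF hom ind D p c orth])
    finally show ?thesis using Q \<eta> c by (simp add: field_simps)
  qed
  then show ?thesis by (simp add: bad_def G_def Q_def)
qed

text \<open>The deterministic half: on a realization satisfying \<open>lower\<close> and
  \<open>cross\<close>, every sketched minimizer is good. By Pythagoras its excess error is the
  squared length of \<open>z\<close>, and the 1/16 in \<open>cross\<close> cancels the 16 of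
  \<open>sketched_minimizer_error\<close>.\<close>

lemma least_squares_from_sketch:
  fixes u :: "nat \<Rightarrow> nat \<Rightarrow> real"
  assumes A: "A \<in> carrier_mat n d" and b: "b \<in> carrier_vec n"
    and iso: "\<And>a b. a < r \<Longrightarrow> b < r \<Longrightarrow> (\<Sum>i<n. u i a * u i b) = (if a = b then 1 else 0)"
    and coord: "\<And>x. x \<in> carrier_vec d \<Longrightarrow> \<exists>y. \<forall>i<n. (A *\<^sub>v x) $ i = (\<Sum>a<r. u i a * y a)"
      "\<And>y. \<exists>x\<in>carrier_vec d. \<forall>i<n. (A *\<^sub>v x) $ i = (\<Sum>a<r. u i a * y a)"
    and p: "\<And>i. i < n \<Longrightarrow> 0 \<le> p i" and X: "X \<subseteq> {..<n}" and \<epsilon>: "0 < \<epsilon>"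
    and \<rho>: "\<And>i. \<rho> i = (\<Sum>a<r. u i a * (\<Sum>l<n. u l a * b $ l)) - b $ i"
    and lower: "\<And>z. (\<Sum>a<r. (z a)\<^sup>2) / 2 \<le> (\<Sum>i\<in>X. (\<Sum>a<r. u i a * z a)\<^sup>2 / p i)"
    and cross: "(\<Sum>a<r. (\<Sum>i\<in>X. u i a * \<rho> i / p i)\<^sup>2) \<le> \<epsilon> / 16 * (\<Sum>i<n. (\<rho> i)\<^sup>2)"
    and xt: "xt \<in> carrier_vec d"
    and opt: "\<And>x. x \<in> carrier_vec d \<Longrightarrow>
      sqnorm ((sampling_mat n p X * A) *\<^sub>v xt - sampling_mat n p X *\<^sub>v b)
        \<le> sqnorm ((sampling_mat n p X * A) *\<^sub>v x - sampling_mat n p X *\<^sub>v b)"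
  shows "sqnorm (A *\<^sub>v xt - b) \<le> (1 + \<epsilon>) * (INF x\<in>carrier_vec d. sqnorm (A *\<^sub>v x - b))"
proof -
  define ys where "ys a = (\<Sum>l<n. u l a * b $ l)" for a
  have \<rho>': "\<rho> i = (\<Sum>a<r. u i a * ys a) - b $ i" for i by (simp add: \<rho> ys_def)
  have orth: "(\<Sum>i<n. u i a * \<rho> i) = 0" if a: "a < r" for a
    unfolding \<rho> by (rule projection_residual_orthogonal[OF iso a])
  have Pyth: "(\<Sum>i<n. ((\<Sum>a<r. u i a * z a) + \<rho> i)\<^sup>2) = (\<Sum>a<r. (z a)\<^sup>2) + (\<Sum>i<n. (\<rho> i)\<^sup>2)" for z
  proof -
    have "(\<Sum>i<n. (\<Sum>a<r. u i a * z a) * \<rho> i) = (\<Sum>a<r. (\<Sum>i<n. u i a * \<rho> i) * z a)"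
      unfolding sum_distrib_right by (subst sum.swap) (simp add: mult_ac)
    also have "\<dots> = 0" using orth by simp
    finally have "(\<Sum>i<n. 2 * ((\<Sum>a<r. u i a * z a) * \<rho> i)) = 0" by (simp only: sum_distrib_left[symmetric])
    then show ?thesis
      by (simp add: power2_sum sum.distrib isotropic_sum_squares[OF iso] mult.assoc)
  qed
  have sqn: "sqnorm (A *\<^sub>v x - b) = (\<Sum>i<n. ((A *\<^sub>v x) $ i - b $ i)\<^sup>2)" for x
    using A b by (simp add: sqnorm_def)
  have res: "\<exists>z. \<forall>i<n. (A *\<^sub>v x) $ i - b $ i = (\<Sum>a<r. u i a * z a) + \<rho> i" if x: "x \<in> carrier_vec d" for x
  proof -
    obtain y where y: "\<forall>i<n. (A *\<^sub>v x) $ i = (\<Sum>a<r. u i a * y a)" using coord(1)[OF x] by blast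
    show ?thesis
      by (rule exI[of _ "\<lambda>a. y a - ys a"]) (use y in \<open>simp add: \<rho>' right_diff_distrib sum_subtractf\<close>)
  qed
  have ge: "(\<Sum>i<n. (\<rho> i)\<^sup>2) \<le> sqnorm (A *\<^sub>v x - b)" if x: "x \<in> carrier_vec d" for x
  proof -
    obtain z where "\<forall>i<n. (A *\<^sub>v x) $ i - b $ i = (\<Sum>a<r. u i a * z a) + \<rho> i" using res[OF x] by blast
    then have "sqnorm (A *\<^sub>v x - b) = (\<Sum>a<r. (z a)\<^sup>2) + (\<Sum>i<n. (\<rho> i)\<^sup>2)"
      by (simp add: sqn Pyth)
    then show ?thesis by (simp add: sum_nonneg)
  qed
  have INF: "(\<Sum>i<n. (\<rho> i)\<^sup>2) \<le> (INF x\<in>carrier_vec d. sqnorm (A *\<^sub>v x - b))"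
    by (rule cINF_greatest) (use ge in \<open>auto intro: zero_carrier_vec\<close>)
  obtain xs where xs: "xs \<in> carrier_vec d" "\<forall>i<n. (A *\<^sub>v xs) $ i = (\<Sum>a<r. u i a * ys a)"
    using coord(2)[of ys] by blast
  obtain z where z: "\<forall>i<n. (A *\<^sub>v xt) $ i - b $ i = (\<Sum>a<r. u i a * z a) + \<rho> i" using res[OF xt] by blast
  have "(\<Sum>a<r. (z a)\<^sup>2) \<le> 16 * (\<Sum>a<r. (\<Sum>i\<in>X. u i a * \<rho> i / p i)\<^sup>2)"
  proof (rule sketched_minimizer_error[OF lower])
    have "(\<Sum>i\<in>X. ((A *\<^sub>v xt) $ i - b $ i)\<^sup>2 / p i) \<le> (\<Sum>i\<in>X. ((A *\<^sub>v xs) $ i - b $ i)\<^sup>2 / p i)"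
      using opt[OF xs(1)] by (simp only: sqnorm_sampling_mat[OF A b _ X p] xt xs(1))
    moreover have "(\<Sum>i\<in>X. ((A *\<^sub>v xt) $ i - b $ i)\<^sup>2 / p i) = (\<Sum>i\<in>X. ((\<Sum>a<r. u i a * z a) + \<rho> i)\<^sup>2 / p i)"
      using X z by (intro sum.cong refl) (auto simp: subset_iff)
    moreover have "(\<Sum>i\<in>X. ((A *\<^sub>v xs) $ i - b $ i)\<^sup>2 / p i) = (\<Sum>i\<in>X. (\<rho> i)\<^sup>2 / p i)"
      using X xs(2) by (intro sum.cong refl) (auto simp: subset_iff \<rho>')
    ultimately show "(\<Sum>i\<in>X. ((\<Sum>a<r. u i a * z a) + \<rho> i)\<^sup>2 / p i) \<le> (\<Sum>i\<in>X. (\<rho> i)\<^sup>2 / p i)" by simp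
  qed
  also have "\<dots> \<le> 16 * (\<epsilon> / 16 * (\<Sum>i<n. (\<rho> i)\<^sup>2))" using cross by (intro mult_left_mono) auto
  finally have "(\<Sum>a<r. (z a)\<^sup>2) \<le> \<epsilon> * (\<Sum>i<n. (\<rho> i)\<^sup>2)" by simp
  moreover have "sqnorm (A *\<^sub>v xt - b) = (\<Sum>a<r. (z a)\<^sup>2) + (\<Sum>i<n. (\<rho> i)\<^sup>2)"
    using z by (simp add: sqn Pyth)
  ultimately have "sqnorm (A *\<^sub>v xt - b) \<le> (1 + \<epsilon>) * (\<Sum>i<n. (\<rho> i)\<^sup>2)" by (simp add: algebra_simps)
  also have "\<dots> \<le> (1 + \<epsilon>) * (INF x\<in>carrier_vec d. sqnorm (A *\<^sub>v x - b))"
    using INF \<epsilon> by (intro mult_left_mono) auto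
  finally show ?thesis .
qed

section \<open>Constants and the union bound\<close>

lemma power_of_two_between:
  fixes y :: real
  assumes "1 < y"
  obtains j :: nat where "y \<le> 2 ^ Suc j" "2 ^ Suc j \<le> 2 * y"
proof -
  define m where "m = nat \<lceil>log 2 y\<rceil>"
  have l: "0 < log 2 y" using assms by simp
  have m: "log 2 y \<le> real m" "real m \<le> log 2 y + 1" "0 < m" using l unfolding m_def by linarith+
  have "y = 2 powr (log 2 y)" using assms by simp
  also have "\<dots> \<le> 2 powr real m" using m by simp
  finally have 1: "y \<le> 2 ^ m" by (simp add: powr_realpow)
  have "2 ^ m = (2::real) powr real m" by (simp add: powr_realpow)
  also have "\<dots> \<le> 2 powr (log 2 y + 1)" using m by simp
  also have "\<dots> = 2 * y" using assms by (simp add: powr_add)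
  finally have 2: "2 ^ m \<le> 2 * y" .
  show ?thesis using that[of "m - 1"] 1 2 m(3) by simp
qed

text \<open>15/19 is at most exp (-1/5), so q / 5 >= ln d + 6 absorbs the factor \<open>r\<close>
  and leaves exp (-6), which is below 1/200 because (5/2)^6 exceeds 200.\<close>

lemma lower_tail_numerics:
  assumes d: "1 \<le> d" and q: "5 * ln (real d) + 30 \<le> real q" and r: "r \<le> d"
  shows "real r * (15 / 19) ^ q \<le> 1 / 200"
proof -
  have "exp (1 / 5) \<le> 1 + 1 / 5 + (1 / 5 :: real)\<^sup>2" by (rule exp_bound) auto
  then have "exp (1 / 5 :: real) \<le> 19 / 15" by (simp add: power2_eq_square)
  then have "15 / 19 \<le> exp (- (1 / 5) :: real)" by (simp add: exp_minus field_simps)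
  then have "(15 / 19 :: real) ^ q \<le> exp (- (1 / 5)) ^ q" by (intro power_mono) auto
  also have "\<dots> = exp (- (real q / 5))" by (simp flip: exp_of_nat_mult)
  also have "\<dots> \<le> exp (- (ln (real d)) - 6)" using q by simp
  also have "\<dots> = 1 / (real d * exp 6)" using d by (simp add: exp_diff exp_minus field_simps)
  finally have "real r * (15 / 19) ^ q \<le> real d * (1 / (real d * exp 6))"
    using r by (intro mult_mono) auto
  also have "\<dots> = 1 / exp 6" using d by simp
  also have "\<dots> \<le> 1 / 200"
  proof -
    have "5 / 2 \<le> exp (1 :: real)" using exp_lower_Taylor_quadratic[of 1] by simp
    then have "(5 / 2) ^ 6 \<le> exp (1 :: real) ^ 6" by (intro power_mono) auto
    also have "\<dots> = exp 6" by (simp flip: exp_of_nat_mult)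
    finally show ?thesis by (simp add: field_simps power_numeral_reduce)
  qed
  finally show ?thesis .
qed

lemma leverage_sampling_least_squares:
  fixes D c \<epsilon> :: real and A :: "real mat" and b :: "real Matrix.vec"
  assumes D1: "1 \<le> D"
    and A: "A \<in> carrier_mat n d" and b: "b \<in> carrier_vec n" and \<epsilon>: "0 < \<epsilon>" "\<epsilon> < 1"
    and hom: "k_homogeneous n k \<mu>" and ind: "one_sided_linf_independent n \<mu> D" and c: "0 < c"
    and marg: "\<forall>i<n. measure_pmf.prob \<mu> {X. i \<in> X} = min 1 (c * leverage_score A i)"
    and k: "6000 * D\<^sup>2 * (real d * ln (real d) + real d / \<epsilon>) \<le> real k"
  shows "99 / 100 \<le> measure_pmf.prob \<mu>
      {X. \<forall>xt \<in> carrier_vec d.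
            (let S = sampling_mat n (\<lambda>i. min 1 (c * leverage_score A i)) X in
             (\<forall>x \<in> carrier_vec d. sqnorm ((S * A) *\<^sub>v xt - S *\<^sub>v b) \<le> sqnorm ((S * A) *\<^sub>v x - S *\<^sub>v b)))
            \<longrightarrow> sqnorm (A *\<^sub>v xt - b) \<le> (1 + \<epsilon>) * (INF x\<in>carrier_vec d. sqnorm (A *\<^sub>v x - b))}"
proof -
  define p where "p = (\<lambda>i. min 1 (c * leverage_score A i))"
  define good where "good = {X. \<forall>xt \<in> carrier_vec d.
            (let S = sampling_mat n p X in
             (\<forall>x \<in> carrier_vec d. sqnorm ((S * A) *\<^sub>v xt - S *\<^sub>v b) \<le> sqnorm ((S * A) *\<^sub>v x - S *\<^sub>v b)))
            \<longrightarrow> sqnorm (A *\<^sub>v xt - b) \<le> (1 + \<epsilon>) * (INF x\<in>carrier_vec d. sqnorm (A *\<^sub>v x - b))}"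
  have "99 / 100 \<le> measure_pmf.prob \<mu> good"
  proof (cases "d = 0")
    \<comment> \<open>There is only one vector of dimension 0; the other case divides by
      \<open>d\<close>.\<close>
    case True
    have "sqnorm (A *\<^sub>v xt - b) \<le> (1 + \<epsilon>) * (INF x\<in>carrier_vec d. sqnorm (A *\<^sub>v x - b))"
      if xt: "xt \<in> carrier_vec d" for xt
    proof -
      have "x = xt" if "x \<in> carrier_vec d" for x
        by (rule eq_vecI) (use that xt True in \<open>simp_all add: carrier_vecD\<close>)
      then have "carrier_vec d = {xt}" using xt by blast
      moreover have "0 \<le> sqnorm (A *\<^sub>v xt - b)" by (simp add: sqnorm_def sum_nonneg)
      ultimately show ?thesis using \<epsilon> by (simp add: algebra_simps)
    qed
    then have "good = UNIV" by (simp add: good_def)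
    then show ?thesis by simp
  next
    case False
    then have d1: "1 \<le> d" by simp
    obtain r u where r: "r \<le> d"
      and iso: "\<And>a b. a < r \<Longrightarrow> b < r \<Longrightarrow> (\<Sum>i<n. u i a * u i b) = (if a = b then (1::real) else 0)"
      and lev: "\<And>i. i < n \<Longrightarrow> leverage_score A i = (\<Sum>a<r. (u i a)\<^sup>2)"
      and coord: "\<And>x. x \<in> carrier_vec d \<Longrightarrow> \<exists>y. \<forall>i<n. (A *\<^sub>v x) $ i = (\<Sum>a<r. u i a * y a)"
        "\<And>y. \<exists>x\<in>carrier_vec d. \<forall>i<n. (A *\<^sub>v x) $ i = (\<Sum>a<r. u i a * y a)"
      using leverage_basis[OF A] by blast
    have p: "p i = min 1 (c * (\<Sum>a<r. (u i a)\<^sup>2))" "incl \<mu> {i} = p i" if "i < n" for i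
      using that lev marg by (simp_all add: p_def incl_def)
    have p0: "0 \<le> p i" if "i < n" for i using p(1)[OF that] c by (simp add: sum_nonneg)
    \<comment> \<open>Turns the hypothesis on \<open>k\<close> into one on \<open>c\<close>: the
      marginals sum to \<open>k\<close>, and the leverage scores sum to \<open>r\<close>, at most
      \<open>d\<close>.\<close>
    have "real k = (\<Sum>i<n. p i)"
      using sum_incl[OF hom, of "{}" "{}"] p(2) by (simp add: incl_def)
    also have "\<dots> \<le> (\<Sum>i<n. c * (\<Sum>a<r. (u i a)\<^sup>2))" by (intro sum_mono) (simp add: p)
    also have "\<dots> = c * (\<Sum>a<r. \<Sum>i<n. u i a * u i a)"
      by (subst sum.swap) (simp add: sum_distrib_left power2_eq_square)
    also have "\<dots> = c * real r" using iso by simp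
    also have "\<dots> \<le> c * real d" using r c by simp
    finally have kd: "real k \<le> c * real d" .
    have "real d * (6000 * D\<^sup>2 * (ln (real d) + 1 / \<epsilon>)) \<le> real d * c"
      using k kd by (simp add: algebra_simps)
    then have c_ge: "6000 * D\<^sup>2 * (ln (real d) + 1 / \<epsilon>) \<le> c" using d1 by simp
    have ln0: "0 \<le> ln (real d)" using d1 by simp
    have inv\<epsilon>: "1 \<le> 1 / \<epsilon>" using \<epsilon> by simp
    have D0: "0 \<le> D" using D1 by simp
    \<comment> \<open>Rounding up to a power of two, as the trace inequality demands, costs a factor
      2.\<close>
    obtain j where j: "5 * ln (real d) + 30 \<le> 2 ^ Suc j" "2 ^ Suc j \<le> 2 * (5 * ln (real d) + 30)"
      by (rule power_of_two_between[of "5 * ln (real d) + 30"]) (use ln0 in auto)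
    \<comment> \<open>The source of 6000: the left side is at most D^2 (800 ln d + 4800), and 1 /
      \<epsilon> >= 1 absorbs the constant term.\<close>
    have qc: "20 * real (2 ^ Suc j) * (D + 1)\<^sup>2 \<le> c"
    proof -
      have "(D + 1)\<^sup>2 \<le> (2 * D)\<^sup>2" using D1 by (intro power_mono) auto
      then have "20 * real (2 ^ Suc j) * (D + 1)\<^sup>2 \<le> 20 * (2 * (5 * ln (real d) + 30)) * (2 * D)\<^sup>2"
        using j ln0 by (intro mult_mono) auto
      also have "\<dots> = 4 * D\<^sup>2 * (200 * ln (real d) + 1200)" by (simp add: power2_eq_square algebra_simps)
      also have "\<dots> \<le> 4 * D\<^sup>2 * (1500 * (ln (real d) + 1 / \<epsilon>))"
        using ln0 inv\<epsilon> by (intro mult_left_mono) auto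
      also have "\<dots> = 6000 * D\<^sup>2 * (ln (real d) + 1 / \<epsilon>)" by (simp add: algebra_simps)
      also note c_ge
      finally show ?thesis .
    qed
    define \<rho> where "\<rho> i = (\<Sum>a<r. u i a * (\<Sum>l<n. u l a * b $ l)) - b $ i" for i
    have orth: "(\<Sum>i<n. u i a * \<rho> i) = 0" if a: "a < r" for a
      unfolding \<rho>_def by (rule projection_residual_orthogonal[OF iso a])
    define bad1 where "bad1 = {X. \<exists>x. (\<Sum>i\<in>X. (\<Sum>a<r. u i a * x a)\<^sup>2 / p i) < (\<Sum>a<r. (x a)\<^sup>2) / 2}"
    define bad2 where "bad2 = {X. X \<subseteq> {..<n} \<and>
      \<epsilon> / 16 * (\<Sum>i<n. (\<rho> i)\<^sup>2) < (\<Sum>a<r. (\<Sum>i\<in>X. u i a * \<rho> i / p i)\<^sup>2)}"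
    have "measure_pmf.prob \<mu> bad1 \<le> real r * (15 / 19) ^ 2 ^ Suc j"
      unfolding bad1_def by (rule leverage_sampling_lower_tail[OF hom ind D0 iso p qc c])
    also have "\<dots> \<le> 1 / 200" by (rule lower_tail_numerics[OF d1 _ r]) (use j in simp)
    finally have prob1: "measure_pmf.prob \<mu> bad1 \<le> 1 / 200" .
    have "measure_pmf.prob \<mu> bad2 \<le> D / (c * (\<epsilon> / 16))"
      unfolding bad2_def by (rule residual_tail[OF hom ind D0 p c orth]) (use \<epsilon> in auto)
    \<comment> \<open>This amounts to 3200 D <= c \<epsilon>, which 6000 D^2 <= c \<epsilon> covers
      because D >= 1. Each bad event gets half of the failure budget 1/100.\<close>
    also have "\<dots> \<le> 1 / 200"
    proof -
      have "6000 * D\<^sup>2 * (1 / \<epsilon>) \<le> 6000 * D\<^sup>2 * (ln (real d) + 1 / \<epsilon>)" using ln0 by (intro mult_left_mono) auto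
      then have "6000 * D\<^sup>2 * (1 / \<epsilon>) \<le> c" using c_ge by linarith
      then have "6000 * D\<^sup>2 \<le> c * \<epsilon>" using \<epsilon> by (simp add: field_simps)
      moreover have "3200 * D \<le> 6000 * D\<^sup>2" using D1 by (simp add: power2_eq_square)
      ultimately show ?thesis using c \<epsilon> by (simp add: field_simps)
    qed
    finally have prob2: "measure_pmf.prob \<mu> bad2 \<le> 1 / 200" .
    have "X \<in> good \<union> (bad1 \<union> bad2)" if X: "X \<in> set_pmf \<mu>" for X
    proof (rule ccontr)
      assume "X \<notin> good \<union> (bad1 \<union> bad2)"
      then have nb: "X \<notin> good" "X \<notin> bad1" "X \<notin> bad2" by auto
      have Xn: "X \<subseteq> {..<n}" using hom X by (simp add: k_homogeneous_def)
      have lower: "(\<Sum>a<r. (z a)\<^sup>2) / 2 \<le> (\<Sum>i\<in>X. (\<Sum>a<r. u i a * z a)\<^sup>2 / p i)" for z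
        using nb(2) by (auto simp: bad1_def not_less)
      have cross: "(\<Sum>a<r. (\<Sum>i\<in>X. u i a * \<rho> i / p i)\<^sup>2) \<le> \<epsilon> / 16 * (\<Sum>i<n. (\<rho> i)\<^sup>2)"
        using nb(3) Xn by (auto simp: bad2_def not_less)
      have "X \<in> good"
        unfolding good_def Let_def
        using least_squares_from_sketch[OF A b iso coord p0 Xn \<epsilon>(1) \<rho>_def lower cross] by blast
      then show False using nb(1) by simp
    qed
    then have "1 = measure_pmf.prob \<mu> (good \<union> (bad1 \<union> bad2))"
      by (subst measure_pmf.prob_eq_1[THEN iffD2]) (auto simp: AE_measure_pmf_iff)
    also have "\<dots> \<le> measure_pmf.prob \<mu> good + measure_pmf.prob \<mu> (bad1 \<union> bad2)"
      by (rule measure_Un_le) auto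
    also have "\<dots> \<le> measure_pmf.prob \<mu> good + (measure_pmf.prob \<mu> bad1 + measure_pmf.prob \<mu> bad2)"
      by (intro add_left_mono measure_Un_le) auto
    finally show ?thesis using prob1 prob2 by simp
  qed
  then show ?thesis unfolding good_def p_def .
qed

theorem theorem1p1:
  fixes D :: real
  assumes "D \<ge> 1"
  shows "\<exists>C>0. \<forall>(n::nat) (d::nat) (A::real mat) (b::real Matrix.vec) (\<epsilon>::real)
            (\<mu>::nat set pmf) (k::nat) (c::real).
    A \<in> carrier_mat n d \<longrightarrow> b \<in> carrier_vec n \<longrightarrow>
    0 < \<epsilon> \<longrightarrow> \<epsilon> < 1 \<longrightarrow>
    k_homogeneous n k \<mu> \<longrightarrow>
    one_sided_linf_independent n \<mu> D \<longrightarrow>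
    c > 0 \<longrightarrow>
    (\<forall>i<n. measure_pmf.prob \<mu> {X. i \<in> X} = min 1 (c * leverage_score A i)) \<longrightarrow>
    real k \<ge> C * (real d * ln (real d) + real d / \<epsilon>) \<longrightarrow>
    measure_pmf.prob \<mu>
      {X. \<forall>xt \<in> carrier_vec d.
            (let S = sampling_mat n (\<lambda>i. min 1 (c * leverage_score A i)) X in
             (\<forall>x \<in> carrier_vec d. sqnorm (Matrix.mult_mat_vec (S * A) xt - Matrix.mult_mat_vec S b) \<le> sqnorm (Matrix.mult_mat_vec (S * A) x - Matrix.mult_mat_vec S b)))
            \<longrightarrow> sqnorm (Matrix.mult_mat_vec A xt - b) \<le> (1 + \<epsilon>) * (INF x\<in>carrier_vec d. sqnorm (Matrix.mult_mat_vec A x - b))}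
      \<ge> 99 / 100"
proof (rule exI[of _ "6000 * D\<^sup>2"], rule conjI)
  show "0 < 6000 * D\<^sup>2" using assms by simp
qed (intro allI impI, rule leverage_sampling_least_squares[OF assms])

end
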